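(* Let $1\le p<\infty$, $N\in\mathbb N$. Consider $E_1\subset\mathfrak{LC}_p$ with $L^1_{loc}$-equicontinuous $m$-bounds, assume that all the functions in $E_1$ are continuously differentiable with respect to $x$ for a.e. $t\in\mathbb R$ and, for any $f\in E_1$, assume that $J_xf\in\mathfrak{SC}_p(\mathbb R^{N\times N})$, where $J_xf$ is the Jacobian of $f$ with respect to the coordinates $x$. Let $\Theta=\{\theta^I_j\mid I=[q_1,q_2],\ q_1,q_2\in\mathbb Q,\ j\in\mathbb N\}$ with $$\theta^I_j(s)=\sup_{t\in I,\,f\in E_1}\int_t^{t+s}m_f^j(u)\,du,$$ where $m^j_f$ is the optimal $m$-bound of $f$ on $B_j$, and let $E$ be the closure of $\{(f,J_xf)\mid f\in E_1\}$ in $\mathfrak{LC}_p\times\Theta\mathfrak C_p(\mathbb R^{N\times N})$ with respect to the product topology $\mathcal T_\Theta\times\mathcal T_\Theta$. For any $(g,G)\in E$, if $x(t,g,x_0)$ and $y(t,g,G,x_0,y_0)$ are respectively the solutions of the Cauchy problems $$\begin{cases}\dot x=g(t,x)\\ x(0)=x_0\end{cases}\quad\text{and}\quad\begin{cases}\dot y=G\big(t,x(t,g,x_0)\big)\,y\\ y(0)=y_0\end{cases}$$ defined for $t\in[T_0,T_1]\subset I_{g,x_0}$ (the maximal interval of definition of $x(\cdot,g,x_0)$), then $$\lim_{\varepsilon\to0^+}\left|\frac{x(t,g,x_0+\varepsilon y_0)-x(t,g,x_0)}{\varepsilon}-y(t,g,G,x_0,y_0)\right|=0,$$ uniformly for $t\in[T_0,T_1]$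 and $y_0\in B_1$.
   Context: $B_j$ is the closed ball of radius $j$ centered at $0$ in $\mathbb R^N$. $L^p_{loc}$ is the set of functions $\mathbb R\to\mathbb R$ belonging to $L^p(I)$ for every compact interval $I$. For a space of functions $f:\mathbb R\times\mathbb R^N\to\mathbb R^M$, the symbol $(\mathbb R^M)$ is omitted when $M=N$. Consider for $f:\mathbb R\times\mathbb R^N\to\mathbb R^M$: (C1) $f$ is Borel measurable; (C2) for every compact $K\subset\mathbb R^N$ there is $m^K\in L^p_{loc}$ with $|f(t,x)|\le m^K(t)$ for a.e. $t$ and all $x\in K$. $\mathfrak{SC}_p(\mathbb R^M)$ is the set of $f$ satisfying (C1), (C2) and such that $f(t,\cdot)$ is continuous for a.e. $t$. $\mathfrak{LC}_p(\mathbb R^M)$ is the set of $f$ satisfying (C1), (C2) and: for every compact $K\subset\mathbb R^N$ there is $l^K\in L^p_{loc}$ with $|f(t,x)-f(t,y)|\le l^K(t)|x-y|$ for a.e. $t$ and all $x,y\in K$. A suitable set of moduli of continuity is a countable set of non-decreasing continuous functions $\Theta=\{\theta^I_j:[0,\infty)\to[0,\infty)\mid j\in\mathbb N,\ I=[q_1,q_2],\ q_1,q_2\in\mathbb Q\}$ with $\theta^I_j(0)=0$ and $\theta^{I_1}_{j_1}\le\theta^{I_2}_{j_2}$ whenever $I_1\subseteq I_2$, $j_1\le j_2$; $\mathcal K^I_j$ is the set of continuous functions $I\to B_j$ admitting $\theta^I_j$ as modulus of continuity. $\Theta\mathfrak C_p(\mathbb R^M)$ is the set of $f$ satisfying (C1),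 (C2) and, for each $j$ and each $I$ with rational endpoints: if $x_n\to x$ uniformly with $x_n,x\in\mathcal K^I_j$, then $\int_I|f(t,x_n(t))-f(t,x(t))|^pdt\to0$. Every function in $\mathfrak{SC}_p(\mathbb R^M)$ defines an element of $\Theta\mathfrak C_p(\mathbb R^M)$. Functions in the same space differing only on a Lebesgue-null subset of $\mathbb R^{1+N}$ are identified. $\mathcal T_\Theta$ is the topology (on $\Theta\mathfrak C_p(\mathbb R^M)$, and on $\mathfrak{LC}_p(\mathbb R^M)$) generated by the seminorms $\sup_{x(\cdot)\in\mathcal K^I_j}\big[\int_I|f(t,x(t))|^pdt\big]^{1/p}$, $I$ with rational endpoints, $j\in\mathbb N$. The optimal $m$-bound of $f$ on $B_j$ is $m^j_f(t)=\sup_{x\in B_j}|f(t,x)|$. $E_1\subset\mathfrak{LC}_p$ has $L^1_{loc}$-equicontinuous $m$-bounds if for each $j\in\mathbb N$ and all $r,\varepsilon>0$ there is $\delta>0$ such that $\sup_{f\in E_1}\int_s^t m^j_f(u)\,du<\varepsilon$ whenever $-r\le s\le t\le r$, $t-s<\delta$. Under this assumption the family $\Theta$ of the claim is a suitable set of moduli of continuity. Solutions are in the Carathéodory (integral) sense; for $g\in\mathfrak{LC}_p$ the solution $x(\cdot,g,x_0)$ is unique, with maximal interval $I_{g,x_0}$. *)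

theory Defs
  imports "HOL-Analysis.Analysis"
begin

text \<open>
  Integrals are taken with respect to \<^const>\<open>lebesgue\<close> (the completion of \<^const>\<open>lborel\<close>):
  an optimal m-bound of a Borel function is in general only Lebesgue measurable, and a Bochner
  integral over \<^const>\<open>lborel\<close> would then silently be 0.
\<close>

section \<open>Spaces of Caratheodory functions\<close>

definition Lp_loc :: "real \<Rightarrow> (real \<Rightarrow> real) set" where
  "Lp_loc p = {m \<in> borel_measurable lebesgue.
     \<forall>a b. set_integrable lebesgue {a..b} (\<lambda>t. \<bar>m t\<bar> powr p)}"

definition cond_C1 :: "(real \<Rightarrow> 'a::euclidean_space \<Rightarrow> 'b::euclidean_space) \<Rightarrow> bool" where
  "cond_C1 f \<longleftrightarrow> (\<lambda>(t, x). f t x) \<in> borel_measurable borel"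

definition cond_C2 :: "real \<Rightarrow> (real \<Rightarrow> 'a::euclidean_space \<Rightarrow> 'b::euclidean_space) \<Rightarrow> bool" where
  "cond_C2 p f \<longleftrightarrow> (\<forall>K. compact K \<longrightarrow>
     (\<exists>m\<in>Lp_loc p. AE t in lebesgue. \<forall>x\<in>K. norm (f t x) \<le> m t))"

definition SC :: "real \<Rightarrow> (real \<Rightarrow> 'a::euclidean_space \<Rightarrow> 'b::euclidean_space) set" where
  "SC p = {f. cond_C1 f \<and> cond_C2 p f \<and> (AE t in lebesgue. continuous_on UNIV (f t))}"

definition LC :: "real \<Rightarrow> (real \<Rightarrow> 'a::euclidean_space \<Rightarrow> 'b::euclidean_space) set" where
  "LC p = {f. cond_C1 f \<and> cond_C2 p f \<and>
     (\<forall>K. compact K \<longrightarrow> (\<exists>l\<in>Lp_loc p. AE t in lebesgue.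
        \<forall>x\<in>K. \<forall>y\<in>K. norm (f t x - f t y) \<le> l t * norm (x - y)))}"

text \<open>
  A family of moduli of continuity is a function \<open>\<Theta> I j s\<close> of a compact interval \<open>I\<close> with
  rational endpoints, an index \<open>j\<close> and an argument \<open>s \<ge> 0\<close>.  It is suitable if each \<open>\<Theta> I j\<close>
  is nonnegative, nondecreasing and continuous on \<open>{0..}\<close> with \<open>\<Theta> I j 0 = 0\<close>, and \<open>\<Theta>\<close> is monotone
  in \<open>I\<close> and \<open>j\<close>; the definitions below make sense without this.
\<close>

definition rat_intervals :: "real set set" where
  "rat_intervals = {{q1..q2} | q1 q2. q1 \<in> \<rat> \<and> q2 \<in> \<rat> \<and> q1 \<le> q2}"

definition moduli_functions ::
    "(real set \<Rightarrow> nat \<Rightarrow> real \<Rightarrow> real) \<Rightarrow> real set \<Rightarrow> nat \<Rightarrow> (real \<Rightarrow> 'a::euclidean_space) set" where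
  "moduli_functions \<Theta> I j = {x. continuous_on I x \<and> x ` I \<subseteq> cball 0 (real j) \<and>
     (\<forall>s\<in>I. \<forall>t\<in>I. norm (x t - x s) \<le> \<Theta> I j \<bar>t - s\<bar>)}"

definition Theta_C ::
    "(real set \<Rightarrow> nat \<Rightarrow> real \<Rightarrow> real) \<Rightarrow> real \<Rightarrow>
     (real \<Rightarrow> 'a::euclidean_space \<Rightarrow> 'b::euclidean_space) set" where
  "Theta_C \<Theta> p = {f. cond_C1 f \<and> cond_C2 p f \<and>
     (\<forall>I\<in>rat_intervals. \<forall>j xs x.
        (\<forall>n. xs n \<in> moduli_functions \<Theta> I j) \<longrightarrow> x \<in> moduli_functions \<Theta> I j \<longrightarrow>
        uniform_limit I xs x sequentially \<longrightarrow>
        (\<lambda>n::nat. LINT t:I|lebesgue. norm (f t (xs n t) - f t (x t)) powr p) \<longlonglongrightarrow> 0)}"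

definition Theta_seminorm ::
    "(real set \<Rightarrow> nat \<Rightarrow> real \<Rightarrow> real) \<Rightarrow> real \<Rightarrow> real set \<Rightarrow> nat \<Rightarrow>
     (real \<Rightarrow> 'a::euclidean_space \<Rightarrow> 'b::euclidean_space) \<Rightarrow> real" where
  "Theta_seminorm \<Theta> p I j f =
     (SUP x\<in>moduli_functions \<Theta> I j. (LINT t:I|lebesgue. norm (f t (x t)) powr p) powr (1 / p))"

text \<open>
  The topology generated by the seminorms, on a carrier \<open>S\<close> of functions rather than of classes
  of functions that agree almost everywhere.  For suitable \<open>\<Theta>\<close>, on \<open>LC p\<close> and \<open>Theta_C \<Theta> p\<close> all seminorms of
  \<open>f - g\<close> vanish exactly when \<open>f\<close> and \<open>g\<close> differ on a Lebesgue null set, so open sets and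
  closures are saturated under this identification, and passing to classes changes nothing.
\<close>

definition Theta_topology ::
    "(real set \<Rightarrow> nat \<Rightarrow> real \<Rightarrow> real) \<Rightarrow> real \<Rightarrow>
     (real \<Rightarrow> 'a::euclidean_space \<Rightarrow> 'b::euclidean_space) set \<Rightarrow>
     (real \<Rightarrow> 'a \<Rightarrow> 'b) topology" where
  "Theta_topology \<Theta> p S = topology_generated_by
     {{g \<in> S. Theta_seminorm \<Theta> p I j (\<lambda>t x. g t x - f t x) < r} | I j f r.
        I \<in> rat_intervals \<and> f \<in> S \<and> r > 0}"

section \<open>Optimal m-bounds\<close>

text \<open>Condition (C2) makes the supremum finite for almost every \<open>t\<close>.\<close>

definition m_bound :: "(real \<Rightarrow> 'a::euclidean_space \<Rightarrow> 'b::euclidean_space) \<Rightarrow> nat \<Rightarrow> real \<Rightarrow> real" where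
  "m_bound f j t = (SUP x\<in>cball 0 (real j). norm (f t x))"

text \<open>The supremum is taken in \<^typ>\<open>ereal\<close>, as it may be infinite a priori.\<close>

definition L1_loc_equicontinuous_m_bounds ::
    "(real \<Rightarrow> 'a::euclidean_space \<Rightarrow> 'b::euclidean_space) set \<Rightarrow> bool" where
  "L1_loc_equicontinuous_m_bounds E1 \<longleftrightarrow>
     (\<forall>j. \<forall>r>0. \<forall>\<epsilon>>0. \<exists>\<delta>>0. \<forall>s t. - r \<le> s \<and> s \<le> t \<and> t \<le> r \<and> t - s < \<delta> \<longrightarrow>
        (SUP f\<in>E1. ereal (LINT u:{s..t}|lebesgue. m_bound f j u)) < ereal \<epsilon>)"

text \<open>If \<open>E1\<close> has equicontinuous m-bounds, the set below is bounded.\<close>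

definition m_bound_moduli ::
    "(real \<Rightarrow> 'a::euclidean_space \<Rightarrow> 'b::euclidean_space) set \<Rightarrow> real set \<Rightarrow> nat \<Rightarrow> real \<Rightarrow> real" where
  "m_bound_moduli E1 I j s = (SUP (t, f)\<in>I \<times> E1. LINT u:{t..t + s}|lebesgue. m_bound f j u)"

section \<open>Jacobians\<close>

definition continuously_differentiable_in_x ::
    "(real \<Rightarrow> real^'n \<Rightarrow> real^'m) \<Rightarrow> bool" where
  "continuously_differentiable_in_x f \<longleftrightarrow> (AE t in lebesgue.
     (\<forall>x. f t differentiable at x) \<and> continuous_on UNIV (\<lambda>x. jacobian (f t) (at x)))"

text \<open>
  The Jacobian is determined only for almost every \<open>t\<close>, hence is treated as a relation:
  the values of \<open>J t\<close> for exceptional \<open>t\<close> are free.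
\<close>

definition is_jacobian_x ::
    "(real \<Rightarrow> real^'n \<Rightarrow> real^'m) \<Rightarrow> (real \<Rightarrow> real^'n \<Rightarrow> real^'n^'m) \<Rightarrow> bool" where
  "is_jacobian_x f J \<longleftrightarrow> (AE t in lebesgue. \<forall>x. J t x = jacobian (f t) (at x))"

section \<open>Solutions of Cauchy problems\<close>

text \<open>\<open>x\<close> solves \<open>x' = f(t,x)\<close>, \<open>x(0) = x0\<close> on the interval \<open>J\<close>.\<close>

definition caratheodory_solution ::
    "(real \<Rightarrow> 'a::euclidean_space \<Rightarrow> 'a) \<Rightarrow> 'a \<Rightarrow> real set \<Rightarrow> (real \<Rightarrow> 'a) \<Rightarrow> bool" where
  "caratheodory_solution f x0 J x \<longleftrightarrow> is_interval J \<and> 0 \<in> J \<and> continuous_on J x \<and>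
     (\<forall>t\<in>J. interval_lebesgue_integrable lebesgue 0 (ereal t) (\<lambda>s. f s (x s)) \<and>
        x t = x0 + (LINT s=0..ereal t|lebesgue. f s (x s)))"

text \<open>
  When solutions are unique, as for \<open>f \<in> LC p\<close> and for the linear equations below, the
  solutions on all intervals glue together: the union of these intervals is the maximal interval
  and \<open>sol f x0\<close> is the maximal solution.  Outside the maximal interval \<open>sol f x0\<close> is unspecified.
\<close>

definition maximal_interval ::
    "(real \<Rightarrow> 'a::euclidean_space \<Rightarrow> 'a) \<Rightarrow> 'a \<Rightarrow> real set" where
  "maximal_interval f x0 = \<Union>{J. \<exists>x. caratheodory_solution f x0 J x}"

definition sol :: "(real \<Rightarrow> 'a::euclidean_space \<Rightarrow> 'a) \<Rightarrow> 'a \<Rightarrow> real \<Rightarrow> 'a" where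
  "sol f x0 t = (THE v. \<exists>J x. caratheodory_solution f x0 J x \<and> t \<in> J \<and> x t = v)"

definition linearized_field ::
    "(real \<Rightarrow> real^'n \<Rightarrow> real^'n) \<Rightarrow> (real \<Rightarrow> real^'n \<Rightarrow> real^'n^'n) \<Rightarrow> real^'n \<Rightarrow>
     real \<Rightarrow> real^'n \<Rightarrow> real^'n" where
  "linearized_field g G x0 t y = G t (sol g x0 t) *v y"

end

theory Submission
  imports Defs
begin

text \<open>
  Let \<open>x\<close> and \<open>u\<close> be the solutions of \<open>x' = g(t,x)\<close> that start at \<open>x0\<close> and at \<open>x0 + \<epsilon> y0\<close>, and let \<open>y\<close> solve the
  linearized equation.  With the remainder \<open>R(t) = g(t,u) - g(t,x) - G(t,x)(u - x)\<close>, the error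
  \<open>w = u - x - \<epsilon> y\<close> satisfies \<open>w' = G(t,x) w + R\<close> and \<open>w(0) = 0\<close>.  Gronwall's inequality therefore bounds \<open>w\<close> by
  a constant times \<open>\<integral>|R|\<close> (\<open>linearization_error_le\<close>), and the distance of \<open>u\<close> and \<open>x\<close> by a constant times
  \<open>\<epsilon>\<close> (\<open>nearby_solutions\<close>).  So everything reduces to the estimate \<open>\<integral>|R| = o(sup |u - x|)\<close>, uniformly
  in \<open>u\<close> (\<open>linearization_remainder\<close>).

  For \<open>f \<in> E1\<close> with Jacobian \<open>J\<close>, the mean value formula along the segment from \<open>x\<close> to \<open>u\<close> and Tonelli's theorem
  bound the integral of the remainder by \<open>sup |u - x|\<close> times
  \<open>sup\<^sub>l \<integral>|J(t, x + l(u - x)) - J(t,x)| dt\<close> (\<open>integral_remainder_le\<close>).  If \<open>x\<close> and \<open>u\<close> belong to the set \<open>\<K>\<^sup>I\<^sub>j\<close> of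
  functions with modulus of continuity \<open>\<theta>\<^sup>I\<^sub>j\<close>, then so do all \<open>x + l(u - x)\<close>, since \<open>\<K>\<^sup>I\<^sub>j\<close> is convex.  All
  these integrals are thus continuous for \<open>\<T>\<^sub>\<Theta>\<close>, and \<open>(f, J)\<close> may be replaced by its limit \<open>(g, G)\<close>.
  For \<open>G\<close> the supremum over \<open>l\<close> tends to \<open>0\<close> as \<open>u\<close> tends to \<open>x\<close> uniformly, by the definition of
  \<open>\<Theta>\<CC>\<^sub>p\<close> (\<open>Theta_C_L1_modulus\<close>).

  It remains to see that the solutions of \<open>g\<close> do belong to \<open>\<K>\<^sup>I\<^sub>j\<close>.  The moduli are built from the m-bounds of
  \<open>E1\<close>, and \<open>g\<close> is a limit of \<open>E1\<close> only along functions in \<open>\<K>\<^sup>I\<^sub>j\<close>.  Constants are such functions, and they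
  suffice: every continuous function is a limit of step functions
  (\<open>integral_superposition_le_modulus\<close>).

  Existence of solutions on a prescribed interval comes from Picard iteration for fields that are
  globally Lipschitz with an integrable constant (\<open>caratheodory_global_existence\<close>).  The linearized equation is
  of this kind, and so is \<open>g\<close> after composition with the projection onto a ball.
\<close>

section \<open>Lebesgue integrals on subsets of the real line\<close>

lemma integral_norm_le_AE:
  fixes f :: "real \<Rightarrow> 'a::euclidean_space"
  assumes f: "f absolutely_integrable_on S" and k: "k absolutely_integrable_on S"
    and le: "AE t in lebesgue. t \<in> S \<longrightarrow> norm (f t) \<le> k t"
  shows "norm (integral S f) \<le> integral S k"
proof -
  have "norm (integral S f) = norm (LINT t|lebesgue. indicat_real S t *\<^sub>R f t)"
    using set_lebesgue_integral_eq_integral(2)[OF f] by (simp add: set_lebesgue_integral_def)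
  also have "\<dots> \<le> (LINT t|lebesgue. norm (indicat_real S t *\<^sub>R f t))"
    by (rule integral_norm_bound)
  also have "\<dots> \<le> (LINT t|lebesgue. indicat_real S t *\<^sub>R k t)"
  proof (rule integral_mono_AE)
    show "integrable lebesgue (\<lambda>t. norm (indicat_real S t *\<^sub>R f t))"
      using f unfolding set_integrable_def by (rule integrable_norm)
    show "AE t in lebesgue. norm (indicat_real S t *\<^sub>R f t) \<le> indicat_real S t *\<^sub>R k t"
      using le by eventually_elim (auto simp: indicator_def)
  qed (use k in \<open>simp add: set_integrable_def\<close>)
  also have "\<dots> = integral S k"
    using set_lebesgue_integral_eq_integral(2)[OF k] by (simp add: set_lebesgue_integral_def)
  finally show ?thesis .
qed

lemma integral_le_AE:
  fixes f :: "real \<Rightarrow> real"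
  assumes f: "f absolutely_integrable_on S" and k: "k absolutely_integrable_on S"
    and le: "AE t in lebesgue. t \<in> S \<longrightarrow> f t \<le> k t"
  shows "integral S f \<le> integral S k"
  using set_integral_mono_AE[OF f k] le
  by (simp add: set_lebesgue_integral_eq_integral(2)[OF f] set_lebesgue_integral_eq_integral(2)[OF k])

lemma absolutely_integrable_continuous_mult:
  fixes l u :: "real \<Rightarrow> real"
  assumes l: "l absolutely_integrable_on {a..b}" and u: "continuous_on {a..b} u"
  shows "(\<lambda>t. l t * u t) absolutely_integrable_on {a..b}"
proof -
  have "(\<lambda>t. u t * l t) absolutely_integrable_on {a..b}"
  proof (rule absolutely_integrable_bounded_measurable_product_real[OF _ _ _ l])
    show "u \<in> borel_measurable (lebesgue_on {a..b})"
      by (rule continuous_imp_measurable_on_sets_lebesgue[OF u]) auto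
    show "bounded (u ` {a..b})"
      by (intro compact_imp_bounded compact_continuous_image u) auto
  qed auto
  then show ?thesis by (simp add: mult.commute)
qed

lemma integral_subset_le_AE:
  fixes f :: "real \<Rightarrow> real"
  assumes f: "f absolutely_integrable_on {c..d}" and sub: "{a..b} \<subseteq> {c..d}" and nonneg: "AE t in lebesgue. 0 \<le> f t"
  shows "integral {a..b} f \<le> integral {c..d} f"
proof -
  note f' = absolutely_integrable_on_subinterval[OF f sub]
  have "(LINT t:{a..b}|lebesgue. f t) \<le> (LINT t:{c..d}|lebesgue. f t)"
    unfolding set_lebesgue_integral_def
  proof (rule integral_mono_AE)
    show "AE t in lebesgue. indicat_real {a..b} t *\<^sub>R f t \<le> indicat_real {c..d} t *\<^sub>R f t"
      using nonneg by eventually_elim (use sub in \<open>auto simp: indicator_def\<close>)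
  qed (use f f' in \<open>auto simp: set_integrable_def\<close>)
  then show ?thesis using set_lebesgue_integral_eq_integral(2)[OF f] set_lebesgue_integral_eq_integral(2)[OF f'] by simp
qed

lemma nn_integral_eq_integral_on:
  fixes h :: "real \<Rightarrow> real"
  assumes h: "h absolutely_integrable_on {a..b}" and nonneg: "\<And>t. 0 \<le> h t"
  shows "(\<integral>\<^sup>+t. ennreal (h t) * indicator {a..b} t \<partial>lebesgue) = ennreal (integral {a..b} h)"
proof -
  have "(\<integral>\<^sup>+t. ennreal (h t) * indicator {a..b} t \<partial>lebesgue) = (\<integral>\<^sup>+t. ennreal (indicat_real {a..b} t *\<^sub>R h t) \<partial>lebesgue)"
    by (intro nn_integral_cong) (auto simp: indicator_def)
  also have "\<dots> = ennreal (LINT t|lebesgue. indicat_real {a..b} t *\<^sub>R h t)"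
    using h nonneg unfolding set_integrable_def by (intro nn_integral_eq_integral AE_I2) auto
  also have "\<dots> = ennreal (integral {a..b} h)"
    using set_lebesgue_integral_eq_integral(2)[OF h] by (simp add: set_lebesgue_integral_def)
  finally show ?thesis .
qed

lemma integral_tendsto_AE:
  fixes h :: "nat \<Rightarrow> real \<Rightarrow> 'a::euclidean_space"
  assumes h: "\<And>n. h n absolutely_integrable_on S" and g: "g absolutely_integrable_on S"
    and k: "k absolutely_integrable_on S"
    and bound: "\<And>n. AE t in lebesgue. t \<in> S \<longrightarrow> norm (h n t) \<le> k t"
    and lim: "AE t in lebesgue. t \<in> S \<longrightarrow> (\<lambda>n. h n t) \<longlonglongrightarrow> g t"
  shows "(\<lambda>n. integral S (h n)) \<longlonglongrightarrow> integral S g"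
proof -
  have "(\<lambda>n. LINT t|lebesgue. indicat_real S t *\<^sub>R h n t) \<longlonglongrightarrow> (LINT t|lebesgue. indicat_real S t *\<^sub>R g t)"
  proof (rule integral_dominated_convergence)
    show "AE t in lebesgue. (\<lambda>n. indicat_real S t *\<^sub>R h n t) \<longlonglongrightarrow> indicat_real S t *\<^sub>R g t"
      using lim by eventually_elim (auto simp: indicator_def)
    show "AE t in lebesgue. norm (indicat_real S t *\<^sub>R h n t) \<le> indicat_real S t *\<^sub>R k t" for n
      using bound[of n] by eventually_elim (auto simp: indicator_def)
    show "integrable lebesgue (\<lambda>t. indicat_real S t *\<^sub>R k t)"
      using k by (simp add: set_integrable_def)
  qed (use h g in \<open>auto simp: set_integrable_def\<close>)
  then show ?thesis
    using set_lebesgue_integral_eq_integral(2)[OF h] set_lebesgue_integral_eq_integral(2)[OF g]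
    by (simp add: set_lebesgue_integral_def)
qed

lemma continuous_on_of_modulus:
  fixes x :: "real \<Rightarrow> 'a::metric_space"
  assumes "continuous_on S A" and "\<And>s t. s \<in> S \<Longrightarrow> t \<in> S \<Longrightarrow> s \<le> t \<Longrightarrow> dist (x s) (x t) \<le> A t - (A s :: real)"
  shows "continuous_on S x"
proof -
  have *: "dist (x s) (x t) \<le> dist (A s) (A t)" if "s \<in> S" "t \<in> S" for s t
    using assms(2)[of s t] assms(2)[of t s] that
    by (cases "s \<le> t") (auto simp: dist_real_def dist_commute)
  then show ?thesis
    using assms(1) unfolding continuous_on_iff by (meson le_less_trans)
qed

section \<open>Gronwall's inequality with an integrable kernel\<close>

text \<open>
  The constant depends on the kernel and the interval only, so one constant serves all functions \<open>u\<close>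
  and all \<open>c\<close>; the uniformity in the theorem rests on this.  The kernel is merely integrable, so instead
  of differentiating an exponential, the interval is cut into pieces on which \<open>l\<close> has integral at most
  \<open>1/2\<close>: there the term with the supremum of \<open>u\<close> is absorbed by the left-hand side.  Working outwards
  from \<open>0\<close>, both signs of \<open>t\<close> are treated at once.
\<close>

lemma gronwall_two_sided:
  fixes l :: "real \<Rightarrow> real"
  assumes ab: "a \<le> 0" "0 \<le> b"
    and l: "l absolutely_integrable_on {a..b}" and l0: "\<And>t. 0 \<le> l t"
  obtains C where "C \<ge> 0"
    "\<And>u c t. \<lbrakk>continuous_on {a..b} u; \<And>t. t \<in> {a..b} \<Longrightarrow> 0 \<le> u t;
      \<And>t. t \<in> {a..b} \<Longrightarrow> u t \<le> c + integral {min 0 t..max 0 t} (\<lambda>s. l s * u s); t \<in> {a..b}\<rbrakk>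
      \<Longrightarrow> u t \<le> C * c"
proof -
  define A where "A t = integral {a..t} l" for t
  have lint: "l integrable_on {a..b}" using l by (rule set_lebesgue_integral_eq_integral(1))
  have "uniformly_continuous_on {a..b} A"
    unfolding A_def by (intro compact_uniformly_continuous indefinite_integral_continuous_1 lint) auto
  then obtain d where d: "d > 0"
    "\<And>s t. s \<in> {a..b} \<Longrightarrow> t \<in> {a..b} \<Longrightarrow> dist t s < d \<Longrightarrow> dist (A t) (A s) < 1/2"
    unfolding uniformly_continuous_on_def by (metis half_gt_zero zero_less_one)
  define e where "e = d / 2"
  have e: "e > 0" "e < d" using d by (auto simp: e_def)
  have sub: "l absolutely_integrable_on {s..t}" if "a \<le> s" "t \<le> b" for s t
    using that by (intro absolutely_integrable_on_subinterval[OF l]) auto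
  have subint: "l integrable_on {s..t}" if "a \<le> s" "t \<le> b" for s t
    using sub[OF that] by (rule set_lebesgue_integral_eq_integral(1))
  have short: "integral {s..t} l \<le> 1/2" if "a \<le> s" "s \<le> t" "t \<le> b" "t - s \<le> e" for s t
  proof -
    have "A s + integral {s..t} l = A t"
      unfolding A_def using that by (intro Henstock_Kurzweil_Integration.integral_combine subint) auto
    moreover have "dist (A t) (A s) < 1/2" using that e by (intro d) (auto simp: dist_real_def)
    ultimately show ?thesis unfolding dist_real_def by linarith
  qed
  define L where "L = integral {a..b} l"
  have L: "integral {s..t} l \<le> L" if "a \<le> s" "t \<le> b" for s t
    unfolding L_def using that l0 by (intro integral_subset_le subint lint) auto
  have L0: "0 \<le> L" unfolding L_def using l0 by (intro integral_nonneg lint) auto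
  define H where "H u c \<longleftrightarrow> continuous_on {a..b} u \<and> (\<forall>t\<in>{a..b}. 0 \<le> u t) \<and>
      (\<forall>t\<in>{a..b}. u t \<le> c + integral {min 0 t..max 0 t} (\<lambda>s. l s * u s))" for u c
  have *: "\<exists>C\<ge>0. \<forall>u c t. H u c \<longrightarrow> t \<in> {a..b} \<longrightarrow> \<bar>t\<bar> \<le> real n * e \<longrightarrow> u t \<le> C * c" for n
  proof (induction n)
    case 0
    show ?case
    proof (intro exI[of _ 1] conjI allI impI)
      fix u c t assume "H u c" "t \<in> {a..b}" "\<bar>t\<bar> \<le> real 0 * e"
      then show "u t \<le> 1 * c" by (force simp: H_def)
    qed auto
  next
    case (Suc n)
    then obtain C where C: "C \<ge> 0"
      "\<And>u c t. H u c \<Longrightarrow> t \<in> {a..b} \<Longrightarrow> \<bar>t\<bar> \<le> real n * e \<Longrightarrow> u t \<le> C * c" by blast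
    define C' where "C' = C + 2 * (1 + C * L)"
    show ?case
    proof (intro exI[of _ C'] conjI allI impI)
      show "C' \<ge> 0" using C L0 by (simp add: C'_def)
      fix u c t assume H: "H u c" and t: "t \<in> {a..b}" "\<bar>t\<bar> \<le> real (Suc n) * e"
      have cu: "continuous_on {a..b} u" and u0: "\<And>t. t \<in> {a..b} \<Longrightarrow> 0 \<le> u t"
        and ule: "\<And>t. t \<in> {a..b} \<Longrightarrow> u t \<le> c + integral {min 0 t..max 0 t} (\<lambda>s. l s * u s)"
        using H by (auto simp: H_def)
      have c0: "0 \<le> c" using u0[of 0] ule[of 0] ab by auto
      define S where "S = {a..b} \<inter> {- (real (Suc n) * e)..real (Suc n) * e}"
      have "compact S" by (auto simp: S_def intro: compact_Int_closed)
      moreover have "S \<noteq> {}" using t by (force simp: S_def)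
      moreover have "continuous_on S u" by (rule continuous_on_subset[OF cu]) (auto simp: S_def)
      ultimately obtain m where m: "m \<in> S" "\<And>s. s \<in> S \<Longrightarrow> u s \<le> u m"
        using continuous_attains_sup by metis
      have mI: "m \<in> {a..b}" "\<bar>m\<bar> \<le> real (Suc n) * e" using m by (auto simp: S_def)
      have tS: "t \<in> S" using t by (auto simp: S_def)
      have lu: "(\<lambda>s. l s * u s) absolutely_integrable_on {a..b}"
        by (rule absolutely_integrable_continuous_mult[OF l cu])
      have lus: "(\<lambda>s. l s * u s) integrable_on {s..t}" if "a \<le> s" "t \<le> b" for s t
        using that by (intro integrable_on_subinterval[OF set_lebesgue_integral_eq_integral(1)[OF lu]]) auto
      \<comment> \<open>On the part that is already treated, \<open>u \<le> C * c\<close>; on the new part,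
        of length at most \<open>e\<close>, \<open>u\<close> is at most its maximum \<open>u m\<close>.\<close>
      have near: "integral {s..t} (\<lambda>s. l s * u s) \<le> C * c * L"
        if "a \<le> s" "t \<le> b" "\<And>r. r \<in> {s..t} \<Longrightarrow> \<bar>r\<bar> \<le> real n * e" for s t
      proof -
        have "integral {s..t} (\<lambda>s. l s * u s) \<le> integral {s..t} (\<lambda>s. l s * (C * c))"
          using that by (intro integral_le lus mult_left_mono l0 C(2)[OF H] integrable_on_mult_left subint) auto
        also have "\<dots> = integral {s..t} l * (C * c)" by simp
        also have "\<dots> \<le> L * (C * c)" using that C(1) c0 by (intro mult_right_mono L) auto
        finally show ?thesis by (simp add: mult_ac)
      qed
      have far: "integral {s..t} (\<lambda>s. l s * u s) \<le> u m / 2"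
        if "a \<le> s" "s \<le> t" "t \<le> b" "t - s \<le> e" "{s..t} \<subseteq> S" for s t
      proof -
        have "integral {s..t} (\<lambda>s. l s * u s) \<le> integral {s..t} (\<lambda>s. l s * u m)"
          using that by (intro integral_le lus mult_left_mono l0 m integrable_on_mult_left subint) auto
        also have "\<dots> = integral {s..t} l * u m" by simp
        also have "\<dots> \<le> 1/2 * u m" using that u0 mI by (intro mult_right_mono short) auto
        finally show ?thesis by simp
      qed
      \<comment> \<open>\<open>real n * e\<close> is kept opaque so that the splitting point \<open>q\<close>
        enters linear arithmetic as an atom.\<close>
      obtain q where q: "q = real n * e" "0 \<le> q" "real (Suc n) * e = q + e"
        using e by (simp add: algebra_simps)
      have um: "u m \<le> C' * c"
      proof -
        consider "\<bar>m\<bar> \<le> q" | "q < m" | "m < - q" by linarith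
        then show ?thesis
        proof cases
          case 1
          then have "u m \<le> C * c" using C(2)[OF H] mI q(1) by auto
          also have "\<dots> \<le> C' * c" using c0 C L0 by (intro mult_right_mono) (auto simp: C'_def)
          finally show ?thesis .
        next
          case 2
          have "integral {0..q} (\<lambda>s. l s * u s) + integral {q..m} (\<lambda>s. l s * u s)
              = integral {0..m} (\<lambda>s. l s * u s)"
            using 2 q(2) mI ab by (intro Henstock_Kurzweil_Integration.integral_combine lus) auto
          moreover have "integral {0..q} (\<lambda>s. l s * u s) \<le> C * c * L"
            using q(2) ab 2 mI by (intro near) (auto simp: q(1)[symmetric])
          moreover have "integral {q..m} (\<lambda>s. l s * u s) \<le> u m / 2"
            using 2 q(2) mI(1) mI(2)[unfolded q(3)] ab by (intro far) (auto simp: S_def q(3) simp del: of_nat_Suc)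
          ultimately have "u m \<le> c + C * c * L + u m / 2"
            using ule[OF mI(1)] 2 q(2) by simp
          then have "u m \<le> 2 * (1 + C * L) * c" by (simp add: algebra_simps)
          also have "\<dots> \<le> C' * c" using c0 C L0 by (intro mult_right_mono) (auto simp: C'_def)
          finally show ?thesis .
        next
          case 3
          have "integral {m..-q} (\<lambda>s. l s * u s) + integral {-q..0} (\<lambda>s. l s * u s)
              = integral {m..0} (\<lambda>s. l s * u s)"
            using 3 q(2) mI ab by (intro Henstock_Kurzweil_Integration.integral_combine lus) auto
          moreover have "integral {-q..0} (\<lambda>s. l s * u s) \<le> C * c * L"
            using q(2) ab 3 mI by (intro near) (auto simp: q(1)[symmetric])
          moreover have "integral {m..-q} (\<lambda>s. l s * u s) \<le> u m / 2"
            using 3 q(2) mI(1) mI(2)[unfolded q(3)] ab by (intro far) (auto simp: S_def q(3) simp del: of_nat_Suc)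
          ultimately have "u m \<le> c + C * c * L + u m / 2"
            using ule[OF mI(1)] 3 q(2) by simp
          then have "u m \<le> 2 * (1 + C * L) * c" by (simp add: algebra_simps)
          also have "\<dots> \<le> C' * c" using c0 C L0 by (intro mult_right_mono) (auto simp: C'_def)
          finally show ?thesis .
        qed
      qed
      show "u t \<le> C' * c" using m(2)[OF tS] um by linarith
    qed
  qed
  obtain n where n: "max (-a) b < real n * e" using reals_Archimedean3[OF e(1)] by blast
  from *[of n] obtain C where C: "C \<ge> 0"
    "\<And>u c t. H u c \<Longrightarrow> t \<in> {a..b} \<Longrightarrow> \<bar>t\<bar> \<le> real n * e \<Longrightarrow> u t \<le> C * c" by blast
  show thesis
  proof (rule that[OF C(1)])
    fix u c t
    assume "continuous_on {a..b} u" "\<And>t. t \<in> {a..b} \<Longrightarrow> 0 \<le> u t"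
      "\<And>t. t \<in> {a..b} \<Longrightarrow> u t \<le> c + integral {min 0 t..max 0 t} (\<lambda>s. l s * u s)"
      and t: "t \<in> {a..b}"
    then have "H u c" by (simp add: H_def)
    then show "u t \<le> C * c" using n t by (intro C(2)) auto
  qed
qed

section \<open>Caratheodory solutions on compact intervals\<close>

text \<open>
  The primitive of \<open>h\<close> that vanishes at \<open>0\<close>.  Anchoring it at the left end \<open>a \<le> 0\<close> of the interval gives
  one formula for both signs of \<open>t\<close>.
\<close>

definition integral_from_0 :: "real \<Rightarrow> (real \<Rightarrow> 'a::euclidean_space) \<Rightarrow> real \<Rightarrow> 'a" where
  "integral_from_0 a h t = integral {a..t} h - integral {a..0} h"

lemma integral_from_0_diff:
  assumes "h absolutely_integrable_on {a..b}" "a \<le> s" "s \<le> t" "t \<le> b"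
  shows "integral_from_0 a h t - integral_from_0 a h s = integral {s..t} h"
proof -
  have "h integrable_on {a..t}"
    using assms by (intro integrable_on_subinterval[OF set_lebesgue_integral_eq_integral(1)[OF assms(1)]]) auto
  then have "integral {a..s} h + integral {s..t} h = integral {a..t} h"
    using assms by (intro Henstock_Kurzweil_Integration.integral_combine) auto
  then show ?thesis by (simp add: integral_from_0_def algebra_simps)
qed

lemma integral_from_0_if:
  assumes "h absolutely_integrable_on {a..b}" "a \<le> 0" "0 \<le> b" "t \<in> {a..b}"
  shows "integral_from_0 a h t = (if 0 \<le> t then integral {0..t} h else - integral {t..0} h)"
proof -
  have 0: "integral_from_0 a h 0 = 0" by (simp add: integral_from_0_def)
  show ?thesis
    using integral_from_0_diff[OF assms(1), of 0 t] integral_from_0_diff[OF assms(1), of t 0] assms 0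
    by (cases "0 \<le> t") (simp_all add: eq_commute[of "- integral_from_0 a h t"])
qed

lemma integral_from_0_minus:
  assumes "f absolutely_integrable_on {a..b}" "g absolutely_integrable_on {a..b}" "0 \<le> b" "t \<le> b"
  shows "integral_from_0 a (\<lambda>s. f s - g s) t = integral_from_0 a f t - integral_from_0 a g t"
proof -
  have "integral {a..r} (\<lambda>s. f s - g s) = integral {a..r} f - integral {a..r} g" if "r \<le> b" for r
    using that
    by (intro integral_diff integrable_on_subinterval[OF set_lebesgue_integral_eq_integral(1)[OF assms(1)]]
        integrable_on_subinterval[OF set_lebesgue_integral_eq_integral(1)[OF assms(2)]]) auto
  then show ?thesis using assms(3,4) by (simp add: integral_from_0_def)
qed

lemma norm_integral_from_0_le:
  assumes h: "h absolutely_integrable_on {a..b}" and k: "k absolutely_integrable_on {a..b}"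
    and ab: "a \<le> 0" "0 \<le> b" "t \<in> {a..b}"
    and le: "AE s in lebesgue. s \<in> {a..b} \<longrightarrow> norm (h s) \<le> k s"
  shows "norm (integral_from_0 a h t) \<le> integral {min 0 t..max 0 t} k"
proof -
  have sub: "{min 0 t..max 0 t} \<subseteq> {a..b}" using ab by auto
  have "norm (integral_from_0 a h t) = norm (integral {min 0 t..max 0 t} h)"
    using integral_from_0_if[OF h ab] by simp
  also have "\<dots> \<le> integral {min 0 t..max 0 t} k"
  proof (rule integral_norm_le_AE)
    show "AE s in lebesgue. s \<in> {min 0 t..max 0 t} \<longrightarrow> norm (h s) \<le> k s"
      using le by eventually_elim (use sub in blast)
  qed (rule absolutely_integrable_on_subinterval[OF h sub] absolutely_integrable_on_subinterval[OF k sub])+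
  finally show ?thesis .
qed

lemma continuous_on_integral_from_0:
  assumes "h absolutely_integrable_on {a..b}"
  shows "continuous_on {a..b} (integral_from_0 a h)"
  unfolding integral_from_0_def
  by (intro continuous_intros indefinite_integral_continuous_1 set_lebesgue_integral_eq_integral(1)[OF assms])

lemma interval_lebesgue_integral_from_0:
  fixes h :: "real \<Rightarrow> 'a::euclidean_space"
  shows "interval_lebesgue_integrable lebesgue 0 (ereal t) h \<longleftrightarrow> h absolutely_integrable_on {min 0 t..max 0 t}"
    and "h absolutely_integrable_on {min 0 t..max 0 t} \<Longrightarrow>
      (LINT s=0..ereal t|lebesgue. h s) = (if 0 \<le> t then integral {0..t} h else - integral {t..0} h)"
proof -
  show "interval_lebesgue_integrable lebesgue 0 (ereal t) h \<longleftrightarrow> h absolutely_integrable_on {min 0 t..max 0 t}"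
    by (simp add: interval_lebesgue_integrable_def zero_ereal_def absolutely_integrable_on_Icc_iff_Ioo)
  assume "h absolutely_integrable_on {min 0 t..max 0 t}"
  then have h: "h absolutely_integrable_on {min 0 t<..<max 0 t}"
    by (simp add: absolutely_integrable_on_Icc_iff_Ioo)
  then show "(LINT s=0..ereal t|lebesgue. h s) = (if 0 \<le> t then integral {0..t} h else - integral {t..0} h)"
    using set_lebesgue_integral_eq_integral(2)[OF h]
    by (auto simp: interval_lebesgue_integral_def zero_ereal_def integral_open_interval_real)
qed

text \<open>
  Integrability on the segments from \<open>0\<close> to every \<open>t\<close> is integrability on \<open>{a..b}\<close>, because the two
  segments that reach the end points cover the interval.
\<close>

lemma caratheodory_solution_iff:
  fixes F :: "real \<Rightarrow> 'a::euclidean_space \<Rightarrow> 'a"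
  assumes ab: "a \<le> 0" "0 \<le> b"
  shows "caratheodory_solution F x0 {a..b} x \<longleftrightarrow>
    continuous_on {a..b} x \<and> (\<lambda>s. F s (x s)) absolutely_integrable_on {a..b} \<and>
    (\<forall>t\<in>{a..b}. x t = x0 + integral_from_0 a (\<lambda>s. F s (x s)) t)" (is "?L \<longleftrightarrow> ?R")
proof -
  let ?h = "\<lambda>s. F s (x s)"
  have sub: "?h absolutely_integrable_on {min 0 t..max 0 t}"
    if "?h absolutely_integrable_on {a..b}" "t \<in> {a..b}" for t
    using that ab by (intro absolutely_integrable_on_subinterval[OF that(1)]) auto
  have eq: "(LINT s=0..ereal t|lebesgue. ?h s) = integral_from_0 a ?h t"
    if "?h absolutely_integrable_on {a..b}" "t \<in> {a..b}" for t
    using interval_lebesgue_integral_from_0(2)[OF sub[OF that]] integral_from_0_if[OF that(1) ab that(2)] by simp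
  show ?thesis
  proof
    assume L: ?L
    have int: "?h absolutely_integrable_on {min 0 t..max 0 t}" if "t \<in> {a..b}" for t
      using L that interval_lebesgue_integral_from_0(1)[of t ?h] unfolding caratheodory_solution_def by blast
    have "?h absolutely_integrable_on ({a..0} \<union> {0..b})"
      using int[of a] int[of b] ab by (intro set_integrable_Un) auto
    moreover have "{a..0} \<union> {0..b} = {a..b}" using ab by auto
    ultimately have h: "?h absolutely_integrable_on {a..b}" by simp
    show ?R using L h eq[OF h] by (simp add: caratheodory_solution_def)
  next
    assume R: ?R
    then have h: "?h absolutely_integrable_on {a..b}" by blast
    show ?L
      using R ab eq[OF h] sub[OF h] interval_lebesgue_integral_from_0(1)[of _ ?h]
      by (auto simp: caratheodory_solution_def is_interval_cc)
  qed
qed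

lemma caratheodory_solution_subset:
  "caratheodory_solution F x0 J x \<Longrightarrow> is_interval J' \<Longrightarrow> 0 \<in> J' \<Longrightarrow> J' \<subseteq> J \<Longrightarrow> caratheodory_solution F x0 J' x"
  unfolding caratheodory_solution_def by (auto intro: continuous_on_subset)

lemma caratheodory_solution_cong:
  fixes F :: "real \<Rightarrow> 'a::euclidean_space \<Rightarrow> 'a"
  assumes "a \<le> 0" "0 \<le> b" "caratheodory_solution F x0 {a..b} x"
    and eq: "\<And>t. t \<in> {a..b} \<Longrightarrow> x t = y t" and F: "\<And>t. t \<in> {a..b} \<Longrightarrow> F t (x t) = F' t (x t)"
  shows "caratheodory_solution F' x0 {a..b} y"
proof -
  have 1: "continuous_on {a..b} x" "(\<lambda>s. F s (x s)) absolutely_integrable_on {a..b}"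
    "\<And>t. t \<in> {a..b} \<Longrightarrow> x t = x0 + integral_from_0 a (\<lambda>s. F s (x s)) t"
    using assms(3) unfolding caratheodory_solution_iff[OF assms(1,2)] by auto
  have FF: "F t (x t) = F' t (y t)" if "t \<in> {a..b}" for t using F[OF that] eq[OF that] by simp
  have "continuous_on {a..b} y" using 1(1) eq continuous_on_cong[of "{a..b}" _ x y] by blast
  moreover have "(\<lambda>s. F' s (y s)) absolutely_integrable_on {a..b}"
    by (rule absolutely_integrable_spike[OF 1(2), of "{}"]) (use FF in auto)
  moreover have "integral_from_0 a (\<lambda>s. F s (x s)) t = integral_from_0 a (\<lambda>s. F' s (y s)) t" if "t \<in> {a..b}" for t
    using that FF assms(1,2) by (auto simp: integral_from_0_def intro!: arg_cong2[where f="(-)"] integral_cong)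
  ultimately show ?thesis
    unfolding caratheodory_solution_iff[OF assms(1,2)] using 1(3) eq by auto
qed

text \<open>
  The integral equation at \<open>t\<close> only involves the segment from \<open>0\<close> to \<open>t\<close>, so a past and a future can be
  chosen independently.
\<close>

lemma caratheodory_solution_glue:
  fixes F :: "real \<Rightarrow> 'a::euclidean_space \<Rightarrow> 'a"
  assumes "a \<le> 0" "0 \<le> b" and x: "caratheodory_solution F x0 {a..0} x" and y: "caratheodory_solution F x0 {0..b} y"
  shows "caratheodory_solution F x0 {a..b} (\<lambda>t. if t \<le> 0 then x t else y t)" (is "caratheodory_solution _ _ _ ?z")
proof -
  have "x 0 = x0" "y 0 = x0"
    using x y assms(1,2) by (auto simp: caratheodory_solution_iff integral_from_0_def)
  then have z1: "?z t = x t" if "t \<in> {a..0}" for t using that by auto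
  have z2: "?z t = y t" if "t \<in> {0..b}" for t using that \<open>x 0 = x0\<close> \<open>y 0 = x0\<close> by auto
  have X: "caratheodory_solution F x0 {a..0} ?z"
    by (rule caratheodory_solution_cong[OF _ _ x]) (use assms z1 in auto)
  have Y: "caratheodory_solution F x0 {0..b} ?z"
    by (rule caratheodory_solution_cong[OF _ _ y]) (use assms z2 in auto)
  have "continuous_on ({a..0} \<union> {0..b}) ?z"
    using X Y unfolding caratheodory_solution_def by (intro continuous_on_closed_Un) auto
  moreover have "{a..0} \<union> {0..b} = {a..b}" using assms by auto
  ultimately have "continuous_on {a..b} ?z" by simp
  then show ?thesis
    using X Y assms(1,2) unfolding caratheodory_solution_def
    by (auto simp: is_interval_cc) (meson atLeastAtMost_iff linear)+
qed

text \<open>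
  Gronwall's inequality for the distance of two solutions.  The constant does not depend on the solutions,
  which yields uniqueness and Lipschitz dependence on the initial value together.
\<close>

lemma caratheodory_solution_dist:
  fixes F :: "real \<Rightarrow> 'a::euclidean_space \<Rightarrow> 'a"
  assumes ab: "a \<le> 0" "0 \<le> b"
    and l: "l absolutely_integrable_on {a..b}" "\<And>t. 0 \<le> l t"
    and lip: "AE t in lebesgue. t \<in> {a..b} \<longrightarrow> (\<forall>x\<in>K. \<forall>y\<in>K. norm (F t x - F t y) \<le> l t * norm (x - y))"
  obtains C where "C \<ge> 0"
    "\<And>x0 y0 x y t. \<lbrakk>caratheodory_solution F x0 {a..b} x; caratheodory_solution F y0 {a..b} y;
      x ` {a..b} \<subseteq> K; y ` {a..b} \<subseteq> K; t \<in> {a..b}\<rbrakk> \<Longrightarrow> norm (x t - y t) \<le> C * norm (x0 - y0)"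
proof -
  obtain C where C: "C \<ge> 0"
    "\<And>u c t. \<lbrakk>continuous_on {a..b} u; \<And>t. t \<in> {a..b} \<Longrightarrow> 0 \<le> u t;
      \<And>t. t \<in> {a..b} \<Longrightarrow> u t \<le> c + integral {min 0 t..max 0 t} (\<lambda>s. l s * u s); t \<in> {a..b}\<rbrakk>
      \<Longrightarrow> u t \<le> C * c"
    by (rule gronwall_two_sided[OF ab l]) blast
  show thesis
  proof (rule that[OF C(1)])
    fix x0 y0 x y t
    assume x: "caratheodory_solution F x0 {a..b} x" and y: "caratheodory_solution F y0 {a..b} y"
      and K: "x ` {a..b} \<subseteq> K" "y ` {a..b} \<subseteq> K" and t: "t \<in> {a..b}"
    note x = x[unfolded caratheodory_solution_iff[OF ab]] and y = y[unfolded caratheodory_solution_iff[OF ab]]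
    let ?h = "\<lambda>s. F s (x s) - F s (y s)"
    have h: "?h absolutely_integrable_on {a..b}" using x y by (intro set_integral_diff) auto
    have cu: "continuous_on {a..b} (\<lambda>t. norm (x t - y t))"
      using x y by (intro continuous_intros) auto
    show "norm (x t - y t) \<le> C * norm (x0 - y0)"
    proof (rule C(2)[OF cu _ _ t])
      fix t assume t: "t \<in> {a..b}"
      have "x t - y t = (x0 - y0) + integral_from_0 a ?h t"
        using integral_from_0_minus[where f="\<lambda>s. F s (x s)" and a=a and b=b and t=t and g="\<lambda>s. F s (y s)"] x y t ab by simp
      then have "norm (x t - y t) \<le> norm (x0 - y0) + norm (integral_from_0 a ?h t)"
        by (metis norm_triangle_ineq)
      also have "norm (integral_from_0 a ?h t) \<le> integral {min 0 t..max 0 t} (\<lambda>s. l s * norm (x s - y s))"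
      proof (rule norm_integral_from_0_le[OF h _ ab t])
        show "AE s in lebesgue. s \<in> {a..b} \<longrightarrow> norm (?h s) \<le> l s * norm (x s - y s)"
          using lip by eventually_elim (use K in blast)
      qed (rule absolutely_integrable_continuous_mult[OF l(1) cu])
      finally show "norm (x t - y t) \<le> norm (x0 - y0) + integral {min 0 t..max 0 t} (\<lambda>s. l s * norm (x s - y s))"
        by simp
    qed auto
  qed
qed

definition L1_locally_lipschitz_on :: "real set \<Rightarrow> (real \<Rightarrow> 'a::euclidean_space \<Rightarrow> 'a) \<Rightarrow> bool" where
  "L1_locally_lipschitz_on S F \<longleftrightarrow> (\<forall>K. compact K \<longrightarrow> (\<exists>l. l absolutely_integrable_on S \<and>
     (AE t in lebesgue. t \<in> S \<longrightarrow> (\<forall>x\<in>K. \<forall>y\<in>K. norm (F t x - F t y) \<le> l t * norm (x - y)))))"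

lemma caratheodory_solution_unique:
  fixes F :: "real \<Rightarrow> 'a::euclidean_space \<Rightarrow> 'a"
  assumes ab: "a \<le> 0" "0 \<le> b" and lip: "L1_locally_lipschitz_on {a..b} F"
    and x: "caratheodory_solution F x0 {a..b} x" and y: "caratheodory_solution F x0 {a..b} y" and t: "t \<in> {a..b}"
  shows "x t = y t"
proof -
  let ?K = "x ` {a..b} \<union> y ` {a..b}"
  have "compact ?K"
    using x y unfolding caratheodory_solution_def by (intro compact_Un compact_continuous_image) auto
  then obtain l where l: "l absolutely_integrable_on {a..b}"
    "AE t in lebesgue. t \<in> {a..b} \<longrightarrow> (\<forall>x\<in>?K. \<forall>y\<in>?K. norm (F t x - F t y) \<le> l t * norm (x - y))"
    using lip unfolding L1_locally_lipschitz_on_def by blast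
  have "AE t in lebesgue. t \<in> {a..b} \<longrightarrow> (\<forall>x\<in>?K. \<forall>y\<in>?K. norm (F t x - F t y) \<le> \<bar>l t\<bar> * norm (x - y))"
    using l(2) by eventually_elim (meson abs_ge_self mult_right_mono norm_ge_zero order_trans)
  then obtain C where "\<And>x0 y0 x y t. \<lbrakk>caratheodory_solution F x0 {a..b} x; caratheodory_solution F y0 {a..b} y;
      x ` {a..b} \<subseteq> ?K; y ` {a..b} \<subseteq> ?K; t \<in> {a..b}\<rbrakk> \<Longrightarrow> norm (x t - y t) \<le> C * norm (x0 - y0)"
    by (rule caratheodory_solution_dist[OF ab set_integrable_abs[OF l(1)] abs_ge_zero]) blast
  from this[OF x y _ _ t] show ?thesis by simp
qed

lemma L1_locally_lipschitz_on_subinterval: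
  fixes F :: "real \<Rightarrow> 'a::euclidean_space \<Rightarrow> 'a"
  shows "L1_locally_lipschitz_on {a..b} F \<Longrightarrow> {c..d} \<subseteq> {a..b} \<Longrightarrow> L1_locally_lipschitz_on {c..d} F"
proof -
  assume lip: "L1_locally_lipschitz_on {a..b} F" and sub: "{c..d} \<subseteq> {a..b}"
  show ?thesis
    unfolding L1_locally_lipschitz_on_def
  proof (intro allI impI)
    fix K :: "'a set" assume "compact K"
    then obtain l where l: "l absolutely_integrable_on {a..b}"
      "AE t in lebesgue. t \<in> {a..b} \<longrightarrow> (\<forall>x\<in>K. \<forall>y\<in>K. norm (F t x - F t y) \<le> l t * norm (x - y))"
      using lip unfolding L1_locally_lipschitz_on_def by blast
    have "AE t in lebesgue. t \<in> {c..d} \<longrightarrow> (\<forall>x\<in>K. \<forall>y\<in>K. norm (F t x - F t y) \<le> l t * norm (x - y))"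
      using l(2) by eventually_elim (use sub in blast)
    with absolutely_integrable_on_subinterval[OF l(1) sub]
    show "\<exists>l. l absolutely_integrable_on {c..d} \<and>
      (AE t in lebesgue. t \<in> {c..d} \<longrightarrow> (\<forall>x\<in>K. \<forall>y\<in>K. norm (F t x - F t y) \<le> l t * norm (x - y)))" by blast
  qed
qed

lemma interval_from_0_subset:
  fixes t :: real
  assumes "is_interval J" "0 \<in> J" "t \<in> J"
  shows "{min 0 t..max 0 t} \<subseteq> J"
proof
  fix s assume "s \<in> {min 0 t..max 0 t}"
  then show "s \<in> J"
    using mem_is_interval_1_I[OF assms(1,2,3), of s] mem_is_interval_1_I[OF assms(1,3,2), of s]
    by (cases "0 \<le> t") auto
qed

text \<open>
  A competing solution may live on a different interval; it is compared with \<open>x\<close> on the segment between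
  \<open>0\<close> and \<open>t\<close>, which lies in both.
\<close>

lemma sol_eq:
  fixes F :: "real \<Rightarrow> 'a::euclidean_space \<Rightarrow> 'a"
  assumes ab: "a \<le> 0" "0 \<le> b" and lip: "L1_locally_lipschitz_on {a..b} F"
    and x: "caratheodory_solution F x0 {a..b} x" and t: "t \<in> {a..b}"
  shows "sol F x0 t = x t"
  unfolding sol_def
proof (rule the_equality)
  show "\<exists>J y. caratheodory_solution F x0 J y \<and> t \<in> J \<and> y t = x t" using x t by blast
  fix v assume "\<exists>J y. caratheodory_solution F x0 J y \<and> t \<in> J \<and> y t = v"
  then obtain J y where y: "caratheodory_solution F x0 J y" "t \<in> J" "y t = v" by blast
  let ?I = "{min 0 t..max 0 t}"
  have J: "is_interval J" "0 \<in> J" using y by (auto simp: caratheodory_solution_def)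
  have "?I \<subseteq> J" by (rule interval_from_0_subset[OF J y(2)])
  then have "caratheodory_solution F x0 ?I y"
    by (intro caratheodory_solution_subset[OF y(1)]) (auto simp: is_interval_cc)
  moreover have "caratheodory_solution F x0 ?I x"
    using ab t by (intro caratheodory_solution_subset[OF x]) (auto simp: is_interval_cc)
  moreover have "L1_locally_lipschitz_on ?I F"
    using ab t by (intro L1_locally_lipschitz_on_subinterval[OF lip]) auto
  ultimately have "y t = x t"
    by (intro caratheodory_solution_unique[of "min 0 t" "max 0 t" F x0 y x t]) auto
  then show "v = x t" using y(3) by simp
qed

text \<open>
  \<open>{T0..T1}\<close> need not contain \<open>0\<close>, and \<open>T0\<close> and \<open>T1\<close> may be reached by different solutions.  Both are
  solutions on an interval that contains \<open>0\<close>, so they can be cut and glued there.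
\<close>

lemma solution_on_maximal_subinterval:
  fixes F :: "real \<Rightarrow> 'a::euclidean_space \<Rightarrow> 'a"
  assumes "T0 \<le> T1" "{T0..T1} \<subseteq> maximal_interval F x0"
  obtains x where "caratheodory_solution F x0 {min 0 T0..max 0 T1} x"
proof -
  have *: "\<exists>x. caratheodory_solution F x0 {min 0 t..max 0 t} x" if "t \<in> {T0..T1}" for t
  proof -
    have "t \<in> maximal_interval F x0" by (rule subsetD[OF assms(2) that])
    then obtain J where "\<exists>x. caratheodory_solution F x0 J x" "t \<in> J"
      unfolding maximal_interval_def by (elim UnionE CollectE) (rule that)
    then obtain y where y: "caratheodory_solution F x0 J y" "t \<in> J" by (elim exE) (rule that)
    have J: "is_interval J" "0 \<in> J" using y by (auto simp: caratheodory_solution_def)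
    have "{min 0 t..max 0 t} \<subseteq> J" by (rule interval_from_0_subset[OF J y(2)])
    then have "caratheodory_solution F x0 {min 0 t..max 0 t} y"
      by (intro caratheodory_solution_subset[OF y(1)]) (auto simp: is_interval_cc)
    then show ?thesis by (intro exI[of _ y])
  qed
  obtain x where "caratheodory_solution F x0 {min 0 T0..max 0 T0} x" using *[of T0] assms(1) by (metis atLeastAtMost_iff order_refl)
  then have x: "caratheodory_solution F x0 {min 0 T0..0} x"
    by (rule caratheodory_solution_subset) (auto simp: is_interval_cc)
  obtain y where "caratheodory_solution F x0 {min 0 T1..max 0 T1} y" using *[of T1] assms(1) by (metis atLeastAtMost_iff order_refl)
  then have y: "caratheodory_solution F x0 {0..max 0 T1} y"
    by (rule caratheodory_solution_subset) (auto simp: is_interval_cc)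
  show thesis by (rule that[OF caratheodory_solution_glue[OF _ _ x y]]) auto
qed

section \<open>Existence for globally Lipschitz fields\<close>

text \<open>
  Picard iteration.  The partial sums \<open>U n\<close> of the distances of consecutive iterates satisfy
  \<open>U (n+1) t \<le> c + \<integral> l U (n+1)\<close>, so Gronwall's inequality bounds them uniformly in \<open>n\<close>.  Hence the iterates
  converge pointwise and boundedly, and dominated convergence passes to the limit in the integral equation.
\<close>

theorem caratheodory_global_existence:
  fixes F :: "real \<Rightarrow> 'a::euclidean_space \<Rightarrow> 'a"
  assumes ab: "a \<le> 0" "0 \<le> b"
    and l: "l absolutely_integrable_on {a..b}" "\<And>t. 0 \<le> l t"
    and lip: "AE t in lebesgue. t \<in> {a..b} \<longrightarrow> (\<forall>x y. norm (F t x - F t y) \<le> l t * norm (x - y))"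
    and int: "\<And>x. continuous_on {a..b} x \<Longrightarrow> (\<lambda>t. F t (x t)) absolutely_integrable_on {a..b}"
  obtains x where "caratheodory_solution F x0 {a..b} x"
proof -
  obtain C where C: "C \<ge> 0"
    "\<And>u c t. \<lbrakk>continuous_on {a..b} u; \<And>t. t \<in> {a..b} \<Longrightarrow> 0 \<le> u t;
      \<And>t. t \<in> {a..b} \<Longrightarrow> u t \<le> c + integral {min 0 t..max 0 t} (\<lambda>s. l s * u s); t \<in> {a..b}\<rbrakk>
      \<Longrightarrow> u t \<le> C * c"
    by (rule gronwall_two_sided[OF ab l]) blast
  define P where "P x t = x0 + integral_from_0 a (\<lambda>s. F s (x s)) t" for x t
  define X where "X n = (P ^^ n) (\<lambda>_. x0)" for n
  have XS: "X (Suc n) = P (X n)" for n by (simp add: X_def)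
  have cX: "continuous_on {a..b} (X n)" for n
  proof (induction n)
    case (Suc n)
    have "X (Suc n) = (\<lambda>t. x0 + integral_from_0 a (\<lambda>s. F s (X n s)) t)"
      by (simp add: XS P_def fun_eq_iff)
    then show ?case
      by (simp only:) (intro continuous_on_add continuous_on_const continuous_on_integral_from_0 int[OF Suc])
  qed (simp add: X_def)
  note iX = int[OF cX]
  define D where "D n t = norm (X (Suc n) t - X n t)" for n t
  have cD: "continuous_on {a..b} (D n)" for n
    unfolding D_def by (intro continuous_intros cX)
  have DS: "D (Suc n) t \<le> integral {min 0 t..max 0 t} (\<lambda>s. l s * D n s)" if t: "t \<in> {a..b}" for n t
  proof -
    let ?h = "\<lambda>s. F s (X (Suc n) s) - F s (X n s)"
    have h: "?h absolutely_integrable_on {a..b}" by (intro set_integral_diff iX)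
    have "X (Suc (Suc n)) t - X (Suc n) t = integral_from_0 a ?h t"
      using integral_from_0_minus[OF iX[of "Suc n"] iX[of n], of t] t ab
      by (simp add: XS[of "Suc n"] XS[of n] P_def)
    then have "D (Suc n) t = norm (integral_from_0 a ?h t)" by (simp add: D_def)
    also have "\<dots> \<le> integral {min 0 t..max 0 t} (\<lambda>s. l s * D n s)"
    proof (rule norm_integral_from_0_le[OF h _ ab t])
      show "AE s in lebesgue. s \<in> {a..b} \<longrightarrow> norm (?h s) \<le> l s * D n s"
        using lip by eventually_elim (simp add: D_def)
    qed (rule absolutely_integrable_continuous_mult[OF l(1) cD])
    finally show ?thesis .
  qed
  obtain c where c: "\<And>t. t \<in> {a..b} \<Longrightarrow> D 0 t \<le> c"
  proof -
    have "{a..b} \<noteq> {}" using ab by auto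
    from continuous_attains_sup[OF compact_Icc this cD[of 0]] show thesis using that by blast
  qed
  define U where "U n t = (\<Sum>k<n. D k t)" for n t
  have cU: "continuous_on {a..b} (U n)" for n
    unfolding U_def by (intro continuous_on_sum cD)
  have D0: "0 \<le> D n t" for n t by (simp add: D_def)
  have U0: "0 \<le> U n t" for n t by (simp add: U_def sum_nonneg D0)
  have sub: "g integrable_on {min 0 t..max 0 t}" if "g absolutely_integrable_on {a..b}" "t \<in> {a..b}" for g :: "real \<Rightarrow> real" and t
    using that ab by (intro integrable_on_subinterval[OF set_lebesgue_integral_eq_integral(1)[OF that(1)]]) auto
  have US: "U (Suc n) t \<le> C * c" if t: "t \<in> {a..b}" for n t
  proof (rule C(2)[OF cU U0 _ t])
    fix t assume t: "t \<in> {a..b}"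
    let ?I = "{min 0 t..max 0 t}"
    have lD: "(\<lambda>s. l s * D k s) integrable_on ?I" for k
      by (rule sub[OF absolutely_integrable_continuous_mult[OF l(1) cD] t])
    have lU: "(\<lambda>s. l s * U k s) integrable_on ?I" for k
      by (rule sub[OF absolutely_integrable_continuous_mult[OF l(1) cU] t])
    have "U (Suc n) t = D 0 t + (\<Sum>k<n. D (Suc k) t)"
      by (simp only: U_def sum.lessThan_Suc_shift)
    also have "\<dots> \<le> c + (\<Sum>k<n. integral ?I (\<lambda>s. l s * D k s))"
      by (intro add_mono sum_mono c DS t)
    also have "(\<Sum>k<n. integral ?I (\<lambda>s. l s * D k s)) = integral ?I (\<lambda>s. l s * U n s)"
      using lD by (simp add: U_def sum_distrib_left integral_sum)
    also have "\<dots> \<le> integral ?I (\<lambda>s. l s * U (Suc n) s)"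
      by (intro integral_le lU mult_left_mono l) (simp add: U_def D0)
    finally show "U (Suc n) t \<le> c + integral ?I (\<lambda>s. l s * U (Suc n) s)" by simp
  qed
  have UB: "U n t \<le> C * c" if t: "t \<in> {a..b}" for n t
    using US[OF t, of n] D0[of n t] by (simp add: U_def)
  have XU: "norm (X n t - x0) \<le> U n t" for n t
  proof -
    have "X n t - x0 = (\<Sum>k<n. X (Suc k) t - X k t)"
      by (subst sum_lessThan_telescope) (simp add: X_def)
    then show ?thesis by (simp add: U_def D_def norm_sum)
  qed
  have "\<exists>y. (\<lambda>n. X n t) \<longlonglongrightarrow> y" if t: "t \<in> {a..b}" for t
  proof -
    have "summable (\<lambda>k. D k t)"
      using UB[OF t] by (intro summableI_nonneg_bounded[of _ "C * c"] D0) (simp add: U_def)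
    then have "summable (\<lambda>k. X (Suc k) t - X k t)"
      unfolding D_def by (rule summable_norm_cancel)
    then have "(\<lambda>n. \<Sum>k<n. X (Suc k) t - X k t) \<longlonglongrightarrow> (\<Sum>k. X (Suc k) t - X k t)"
      by (rule summable_LIMSEQ)
    then have "(\<lambda>n. X n t - X 0 t) \<longlonglongrightarrow> (\<Sum>k. X (Suc k) t - X k t)"
      using sum_lessThan_telescope[of "\<lambda>k. X k t"] by simp
    from tendsto_add[OF this tendsto_const[of "X 0 t"]] have "(\<lambda>n. X n t) \<longlonglongrightarrow> (\<Sum>k. X (Suc k) t - X k t) + X 0 t"
      by simp
    then show ?thesis by (intro exI)
  qed
  then have "\<forall>t\<in>{a..b}. \<exists>y. (\<lambda>n. X n t) \<longlonglongrightarrow> y" by blast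
  from bchoice[OF this] obtain x where x: "\<And>t. t \<in> {a..b} \<Longrightarrow> (\<lambda>n. X n t) \<longlonglongrightarrow> x t" by blast
  \<comment> \<open>One integrable bound for all \<open>F s (X n s)\<close>: it dominates the integrands and
    gives all iterates a common modulus of continuity, which the limit inherits.\<close>
  define k where "k s = norm (F s x0) + l s * (C * c)" for s
  have k: "k absolutely_integrable_on {a..b}"
    unfolding k_def using int[of "\<lambda>_. x0"]
    by (intro set_integral_add set_integrable_norm set_integrable_mult_left impI l) auto
  have dom: "AE s in lebesgue. s \<in> {a..b} \<longrightarrow> norm (F s (X n s)) \<le> k s" for n
    using lip
  proof eventually_elim
    case (elim s)
    show ?case
    proof
      assume s: "s \<in> {a..b}"
      have "norm (F s (X n s)) \<le> norm (F s x0) + norm (F s (X n s) - F s x0)"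
        by (metis add.commute norm_triangle_sub)
      also have "norm (F s (X n s) - F s x0) \<le> l s * norm (X n s - x0)" using elim s by blast
      also have "\<dots> \<le> l s * (C * c)" using XU[of n s] UB[OF s, of n] l by (intro mult_left_mono) auto
      finally show "norm (F s (X n s)) \<le> k s" by (simp add: k_def)
    qed
  qed
  have cx: "continuous_on {a..b} x"
  proof (rule continuous_on_of_modulus[OF continuous_on_integral_from_0[OF k]])
    fix s t assume st: "s \<in> {a..b}" "t \<in> {a..b}" "s \<le> t"
    have "norm (X (Suc n) s - X (Suc n) t) \<le> integral {s..t} k" for n
    proof -
      have "X (Suc n) t - X (Suc n) s = integral {s..t} (\<lambda>r. F r (X n r))"
        using integral_from_0_diff[OF iX[of n], of s t] st by (simp add: XS P_def)
      moreover have "norm (integral {s..t} (\<lambda>r. F r (X n r))) \<le> integral {s..t} k"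
      proof (rule integral_norm_le_AE)
        show "AE r in lebesgue. r \<in> {s..t} \<longrightarrow> norm (F r (X n r)) \<le> k r"
          using dom[of n] by eventually_elim (use st in auto)
      qed (use st in \<open>auto intro!: absolutely_integrable_on_subinterval[OF iX] absolutely_integrable_on_subinterval[OF k]\<close>)
      ultimately show ?thesis by (metis norm_minus_commute)
    qed
    moreover have "(\<lambda>n. norm (X (Suc n) s - X (Suc n) t)) \<longlonglongrightarrow> norm (x s - x t)"
      using st by (intro tendsto_intros LIMSEQ_Suc x)
    ultimately have "norm (x s - x t) \<le> integral {s..t} k"
      by (meson LIMSEQ_le_const2)
    then show "dist (x s) (x t) \<le> integral_from_0 a k t - integral_from_0 a k s"
      using integral_from_0_diff[OF k, of s t] st by (simp add: dist_norm)
  qed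
  have "x t = x0 + integral_from_0 a (\<lambda>s. F s (x s)) t" if t: "t \<in> {a..b}" for t
  proof -
    have lim: "(\<lambda>n. integral {a..r} (\<lambda>s. F s (X n s))) \<longlonglongrightarrow> integral {a..r} (\<lambda>s. F s (x s))" if r: "r \<in> {a..b}" for r
    proof (rule integral_tendsto_AE)
      have sub: "{a..r} \<subseteq> {a..b}" using r by auto
      show "(\<lambda>s. F s (X n s)) absolutely_integrable_on {a..r}" "(\<lambda>s. F s (x s)) absolutely_integrable_on {a..r}"
        "k absolutely_integrable_on {a..r}" for n
        by (rule absolutely_integrable_on_subinterval[OF iX sub] absolutely_integrable_on_subinterval[OF int[OF cx] sub]
          absolutely_integrable_on_subinterval[OF k sub])+
      show "AE s in lebesgue. s \<in> {a..r} \<longrightarrow> norm (F s (X n s)) \<le> k s" for n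
        using dom[of n] by eventually_elim (use sub in blast)
      show "AE s in lebesgue. s \<in> {a..r} \<longrightarrow> (\<lambda>n. F s (X n s)) \<longlonglongrightarrow> F s (x s)"
        using lip
      proof eventually_elim
        case (elim s)
        show ?case
        proof
          assume "s \<in> {a..r}"
          then have s: "s \<in> {a..b}" using sub by blast
          have "(\<lambda>n. l s * norm (X n s - x s)) \<longlonglongrightarrow> l s * norm (x s - x s)"
            by (intro tendsto_intros x s)
          then have "(\<lambda>n. l s * norm (X n s - x s)) \<longlonglongrightarrow> 0" by simp
          moreover have "\<forall>\<^sub>F n in sequentially. norm (F s (X n s) - F s (x s)) \<le> l s * norm (X n s - x s)"
            using elim[rule_format, OF s] by (intro always_eventually allI)
          ultimately have "(\<lambda>n. F s (X n s) - F s (x s)) \<longlonglongrightarrow> 0"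
            by (rule Lim_null_comparison[rotated])
          then show "(\<lambda>n. F s (X n s)) \<longlonglongrightarrow> F s (x s)" by (subst Lim_null)
        qed
      qed
    qed
    have "(\<lambda>n. X (Suc n) t) \<longlonglongrightarrow> x0 + integral_from_0 a (\<lambda>s. F s (x s)) t"
      unfolding XS P_def integral_from_0_def using t ab by (intro tendsto_intros lim) auto
    with LIMSEQ_Suc[OF x[OF t]] show ?thesis by (rule LIMSEQ_unique)
  qed
  then have "caratheodory_solution F x0 {a..b} x"
    unfolding caratheodory_solution_iff[OF ab] using cx int[OF cx] by blast
  then show thesis by (rule that)
qed

section \<open>Superposition operators and the seminorms\<close>

lemma Lp_loc_absolutely_integrable:
  assumes "1 \<le> p" and m: "m \<in> Lp_loc p"
  shows "m absolutely_integrable_on {a..b}"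
proof (rule set_integrable_bound)
  show "(\<lambda>t. 1 + \<bar>m t\<bar> powr p) absolutely_integrable_on {a..b}"
    using m by (intro set_integral_add(1)) (auto simp: Lp_loc_def)
  have "m \<in> borel_measurable lebesgue" using m by (auto simp: Lp_loc_def)
  show "set_borel_measurable lebesgue {a..b} m"
    unfolding set_borel_measurable_def
    by (intro borel_measurable_scaleR borel_measurable_indicator \<open>m \<in> borel_measurable lebesgue\<close>) auto
  have "\<bar>m t\<bar> \<le> 1 + \<bar>m t\<bar> powr p" for t
  proof (cases "\<bar>m t\<bar> \<le> 1")
    case False
    then have "\<bar>m t\<bar> powr 1 \<le> \<bar>m t\<bar> powr p" using assms(1) by (intro powr_mono) auto
    then show ?thesis by simp
  qed (simp add: add_increasing2)
  then show "AE t in lebesgue. t \<in> {a..b} \<longrightarrow> norm (m t) \<le> norm (1 + \<bar>m t\<bar> powr p)"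
    by (intro AE_I2 impI) (simp add: abs_of_nonneg add_nonneg_nonneg)
qed

lemma powr_add_le:
  fixes x y :: real
  assumes "1 \<le> p" "0 \<le> x" "0 \<le> y"
  shows "(x + y) powr p \<le> 2 powr p * (x powr p + y powr p)"
proof -
  have "(x + y) powr p \<le> (2 * max x y) powr p"
    using assms by (intro powr_mono2) auto
  also have "\<dots> = 2 powr p * max x y powr p" by (simp add: powr_mult)
  also have "\<dots> \<le> 2 powr p * (x powr p + y powr p)"
    by (intro mult_left_mono) (auto simp: max_def)
  finally show ?thesis .
qed

lemma Lp_loc_add:
  assumes "1 \<le> p" and m: "m1 \<in> Lp_loc p" "m2 \<in> Lp_loc p"
  shows "(\<lambda>t. \<bar>m1 t\<bar> + \<bar>m2 t\<bar>) \<in> Lp_loc p"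
proof -
  have meas: "(\<lambda>t. \<bar>m1 t\<bar> + \<bar>m2 t\<bar>) \<in> borel_measurable lebesgue"
    using m unfolding Lp_loc_def by (intro borel_measurable_add borel_measurable_abs) auto
  have powr_meas: "(\<lambda>x::real. \<bar>x\<bar> powr p) \<in> borel_measurable borel" by measurable
  have "(\<lambda>t. \<bar>\<bar>m1 t\<bar> + \<bar>m2 t\<bar>\<bar> powr p) absolutely_integrable_on {a..b}" for a b
  proof (rule set_integrable_bound)
    show "(\<lambda>t. 2 powr p * (\<bar>m1 t\<bar> powr p + \<bar>m2 t\<bar> powr p)) absolutely_integrable_on {a..b}"
      using m by (intro set_integrable_mult_right set_integral_add(1)) (auto simp: Lp_loc_def)
    show "set_borel_measurable lebesgue {a..b} (\<lambda>t. \<bar>\<bar>m1 t\<bar> + \<bar>m2 t\<bar>\<bar> powr p)"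
      unfolding set_borel_measurable_def
      by (intro borel_measurable_scaleR borel_measurable_indicator measurable_compose[OF meas powr_meas]) auto
    show "AE t in lebesgue. t \<in> {a..b} \<longrightarrow> norm (\<bar>\<bar>m1 t\<bar> + \<bar>m2 t\<bar>\<bar> powr p)
        \<le> norm (2 powr p * (\<bar>m1 t\<bar> powr p + \<bar>m2 t\<bar> powr p))"
      using powr_add_le[OF assms(1), of "\<bar>m1 t\<bar>" "\<bar>m2 t\<bar>" for t] by (intro AE_I2 impI) (simp add: abs_mult)
  qed
  then show ?thesis using meas unfolding Lp_loc_def by blast
qed

lemma cond_C1_diff: "cond_C1 f \<Longrightarrow> cond_C1 g \<Longrightarrow> cond_C1 (\<lambda>t x. f t x - g t x)"
  unfolding cond_C1_def case_prod_unfold by (rule borel_measurable_diff)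

lemma cond_C2E:
  assumes "cond_C2 p f" "compact K"
  obtains m where "m \<in> Lp_loc p" "AE t in lebesgue. \<forall>x\<in>K. norm (f t x) \<le> m t"
proof -
  from assms have "\<exists>m\<in>Lp_loc p. AE t in lebesgue. \<forall>x\<in>K. norm (f t x) \<le> m t"
    unfolding cond_C2_def by (elim allE impE)
  then show thesis by (elim bexE) (rule that)
qed

lemma cond_C2_diff:
  assumes "1 \<le> p" "cond_C2 p f" "cond_C2 p g"
  shows "cond_C2 p (\<lambda>t x. f t x - g t x)"
  unfolding cond_C2_def
proof (intro allI impI)
  fix K :: "'a set" assume K: "compact K"
  obtain m1 where m1: "m1 \<in> Lp_loc p" "AE t in lebesgue. \<forall>x\<in>K. norm (f t x) \<le> m1 t"
    by (rule cond_C2E[OF assms(2) K])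
  obtain m2 where m2: "m2 \<in> Lp_loc p" "AE t in lebesgue. \<forall>x\<in>K. norm (g t x) \<le> m2 t"
    by (rule cond_C2E[OF assms(3) K])
  have "AE t in lebesgue. \<forall>x\<in>K. norm (f t x - g t x) \<le> \<bar>m1 t\<bar> + \<bar>m2 t\<bar>"
    using m1(2) m2(2) by eventually_elim (smt (verit) norm_triangle_ineq4)
  then show "\<exists>m\<in>Lp_loc p. AE t in lebesgue. \<forall>x\<in>K. norm (f t x - g t x) \<le> m t"
    by (rule bexI[OF _ Lp_loc_add[OF assms(1) m1(1) m2(1)]])
qed

lemma borel_measurable_superposition:
  assumes "cond_C1 f" and y: "y \<in> borel_measurable borel"
  shows "(\<lambda>t. f t (y t)) \<in> borel_measurable borel"
proof -
  have "(\<lambda>t. (t, y t)) \<in> borel_measurable borel"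
    using y by (intro borel_measurable_Pair) auto
  from measurable_compose[OF this assms(1)[unfolded cond_C1_def]] show ?thesis by simp
qed

lemma set_borel_measurable_superposition:
  assumes "cond_C1 f" and y: "set_borel_measurable borel {a..b::real} y"
  shows "set_borel_measurable borel {a..b} (\<lambda>t. f t (y t))"
proof -
  have [measurable]: "(\<lambda>t. f t (indicator {a..b} t *\<^sub>R y t)) \<in> borel_measurable borel"
    using y unfolding set_borel_measurable_def by (rule borel_measurable_superposition[OF assms(1)])
  have "(\<lambda>t. indicat_real {a..b} t *\<^sub>R f t (indicator {a..b} t *\<^sub>R y t)) \<in> borel_measurable borel"
    by measurable
  also have "(\<lambda>t. indicat_real {a..b} t *\<^sub>R f t (indicator {a..b} t *\<^sub>R y t)) = (\<lambda>t. indicat_real {a..b} t *\<^sub>R f t (y t))"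
    by (auto simp: indicator_def fun_eq_iff)
  finally show ?thesis unfolding set_borel_measurable_def .
qed

text \<open>
  \<open>y\<close> is only Borel measurable with values in a compact set, as the step functions that approximate a
  solution are discontinuous.
\<close>

lemma superposition_absolutely_integrable:
  assumes p: "1 \<le> p" and f: "cond_C1 f" "cond_C2 p f"
    and y: "set_borel_measurable borel {a..b} y" "y ` {a..b} \<subseteq> K" "compact K"
  shows "(\<lambda>t. f t (y t)) absolutely_integrable_on {a..b}"
    and "(\<lambda>t. norm (f t (y t)) powr p) absolutely_integrable_on {a..b}"
proof -
  obtain m where m: "m \<in> Lp_loc p" "AE t in lebesgue. \<forall>x\<in>K. norm (f t x) \<le> m t"
    by (rule cond_C2E[OF f(2) y(3)])
  have borel: "set_borel_measurable borel {a..b} (\<lambda>t. f t (y t))"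
    by (rule set_borel_measurable_superposition[OF f(1) y(1)])
  show "(\<lambda>t. f t (y t)) absolutely_integrable_on {a..b}"
  proof (rule set_integrable_bound[OF Lp_loc_absolutely_integrable[OF p m(1)]])
    show "set_borel_measurable lebesgue {a..b} (\<lambda>t. f t (y t))"
      using borel unfolding set_borel_measurable_def by (intro measurable_completion) simp
    show "AE t in lebesgue. t \<in> {a..b} \<longrightarrow> norm (f t (y t)) \<le> norm (m t)"
      using m(2) by eventually_elim (use y(2) in force)
  qed
  show "(\<lambda>t. norm (f t (y t)) powr p) absolutely_integrable_on {a..b}"
  proof (rule set_integrable_bound)
    show "(\<lambda>t. \<bar>m t\<bar> powr p) absolutely_integrable_on {a..b}"
      using m(1) by (auto simp: Lp_loc_def)
    have "(\<lambda>t. norm (indicat_real {a..b} t *\<^sub>R f t (y t)) powr p) \<in> borel_measurable borel"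
      using borel unfolding set_borel_measurable_def by measurable
    also have "(\<lambda>t. norm (indicat_real {a..b} t *\<^sub>R f t (y t)) powr p)
        = (\<lambda>t. indicat_real {a..b} t *\<^sub>R norm (f t (y t)) powr p)"
      by (auto simp: indicator_def fun_eq_iff)
    finally show "set_borel_measurable lebesgue {a..b} (\<lambda>t. norm (f t (y t)) powr p)"
      unfolding set_borel_measurable_def by (intro measurable_completion) simp
    show "AE t in lebesgue. t \<in> {a..b} \<longrightarrow> norm (norm (f t (y t)) powr p) \<le> norm (\<bar>m t\<bar> powr p)"
      using m(2)
    proof eventually_elim
      case (elim t)
      show ?case
      proof
        assume "t \<in> {a..b}"
        then have "norm (f t (y t)) \<le> \<bar>m t\<bar>" using elim y(2) by force
        then show "norm (norm (f t (y t)) powr p) \<le> norm (\<bar>m t\<bar> powr p)"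
          using p by (simp add: powr_mono2)
      qed
    qed
  qed
qed

lemma moduli_functionsD:
  assumes "x \<in> moduli_functions \<Theta> {a..b} j"
  shows "set_borel_measurable borel {a..b} x" "x ` {a..b} \<subseteq> cball 0 (real j)" "continuous_on {a..b} x"
proof -
  show "x ` {a..b} \<subseteq> cball 0 (real j)" and c: "continuous_on {a..b} x"
    using assms unfolding moduli_functions_def by blast+
  show "set_borel_measurable borel {a..b} x" by (rule set_measurable_continuous_on[OF _ c]) simp
qed

lemma integrable_moduli_superposition:
  assumes p: "1 \<le> p" and f: "cond_C1 f" "cond_C2 p f" and x: "x \<in> moduli_functions \<Theta> {a..b} j"
  shows "(\<lambda>t. f t (x t)) absolutely_integrable_on {a..b}"
    and "(\<lambda>t. norm (f t (x t)) powr p) absolutely_integrable_on {a..b}"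
  by (rule superposition_absolutely_integrable[OF p f moduli_functionsD(1,2)[OF x] compact_cball])+

text \<open>
  Replaces Hoelder's inequality.  It loses the sharp constant, but still shows that a small \<open>L\<^sup>p\<close> seminorm
  on a bounded interval forces a small \<open>L\<^sup>1\<close> seminorm: choose \<open>\<eta>\<close> small first.
\<close>

lemma le_const_plus_powr:
  fixes h :: real
  assumes "1 \<le> p" "0 < \<eta>" "0 \<le> h"
  shows "h \<le> \<eta> + \<eta> powr (1 - p) * h powr p"
proof (cases "h \<le> \<eta>")
  case True
  then show ?thesis by (simp add: add_increasing2)
next
  case False
  have "h = \<eta> * (h / \<eta>) powr 1" using assms by simp
  also have "\<dots> \<le> \<eta> * (h / \<eta>) powr p"
    using assms False by (intro mult_left_mono powr_mono) auto
  also have "\<dots> = \<eta> powr (1 - p) * h powr p"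
    using assms by (simp add: powr_divide powr_diff)
  also have "\<dots> \<le> \<eta> + \<eta> powr (1 - p) * h powr p" using assms by simp
  finally show ?thesis .
qed

lemma L1_le_Lp:
  fixes h :: "real \<Rightarrow> 'a::euclidean_space"
  assumes p: "1 \<le> p" and \<eta>: "0 < \<eta>" and ab: "a \<le> b"
    and h: "h absolutely_integrable_on {a..b}" "(\<lambda>t. norm (h t) powr p) absolutely_integrable_on {a..b}"
  shows "integral {a..b} (\<lambda>t. norm (h t)) \<le> \<eta> * (b - a) + \<eta> powr (1 - p) * integral {a..b} (\<lambda>t. norm (h t) powr p)"
proof -
  note i = set_lebesgue_integral_eq_integral(1)
  have hp: "(\<lambda>t. norm (h t) powr p) integrable_on {a..b}" by (rule i[OF h(2)])
  have "integral {a..b} (\<lambda>t. norm (h t)) \<le> integral {a..b} (\<lambda>t. \<eta> + \<eta> powr (1 - p) * norm (h t) powr p)"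
    using le_const_plus_powr[OF p \<eta>]
    by (intro integral_le i[OF set_integrable_norm[OF h(1)]] integrable_add integrable_on_mult_right hp) auto
  also have "\<dots> = integral {a..b} (\<lambda>t. \<eta>) + integral {a..b} (\<lambda>t. \<eta> powr (1 - p) * norm (h t) powr p)"
    by (intro integral_add integrable_on_mult_right hp) auto
  also have "\<dots> = \<eta> * (b - a) + \<eta> powr (1 - p) * integral {a..b} (\<lambda>t. norm (h t) powr p)"
    using ab by simp
  finally show ?thesis .
qed

lemma Lp_small_imp_L1_small:
  assumes p: "1 \<le> p" and \<tau>: "0 < \<tau>" and ab: "a \<le> b"
  obtains \<sigma> where "0 < \<sigma>"
    "\<And>h :: real \<Rightarrow> 'a::euclidean_space. h absolutely_integrable_on {a..b} \<Longrightarrow>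
      (\<lambda>t. norm (h t) powr p) absolutely_integrable_on {a..b} \<Longrightarrow>
      integral {a..b} (\<lambda>t. norm (h t) powr p) \<le> \<sigma> \<Longrightarrow> integral {a..b} (\<lambda>t. norm (h t)) \<le> \<tau>"
proof -
  define \<eta> where "\<eta> = \<tau> / (2 * (b - a + 1))"
  have \<eta>: "0 < \<eta>" using \<tau> ab by (simp add: \<eta>_def)
  have "\<eta> * (b - a) \<le> \<eta> * (b - a + 1)" using \<eta> by simp
  also have "\<dots> = \<tau> / 2" using ab by (simp add: \<eta>_def field_simps)
  finally have \<eta>2: "\<eta> * (b - a) \<le> \<tau> / 2" .
  define \<sigma> where "\<sigma> = \<tau> / 2 / \<eta> powr (1 - p)"
  show thesis
  proof (rule that[of \<sigma>])
    show "0 < \<sigma>" using \<tau> \<eta> by (simp add: \<sigma>_def)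
    fix h :: "real \<Rightarrow> 'a"
    assume h: "h absolutely_integrable_on {a..b}" "(\<lambda>t. norm (h t) powr p) absolutely_integrable_on {a..b}"
      and le: "integral {a..b} (\<lambda>t. norm (h t) powr p) \<le> \<sigma>"
    have "\<eta> powr (1 - p) * integral {a..b} (\<lambda>t. norm (h t) powr p) \<le> \<eta> powr (1 - p) * \<sigma>"
      using le by (intro mult_left_mono) auto
    also have "\<dots> = \<tau> / 2" using \<eta> by (simp add: \<sigma>_def)
    finally show "integral {a..b} (\<lambda>t. norm (h t)) \<le> \<tau>"
      using L1_le_Lp[OF p \<eta> ab h] \<eta>2 by linarith
  qed
qed

lemma absolutely_integrable_norm_diff_powr:
  fixes h k :: "real \<Rightarrow> 'a::euclidean_space"
  assumes p: "1 \<le> p" and h: "h absolutely_integrable_on {a..b}" "(\<lambda>t. norm (h t) powr p) absolutely_integrable_on {a..b}"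
    and k: "k absolutely_integrable_on {a..b}" "(\<lambda>t. norm (k t) powr p) absolutely_integrable_on {a..b}"
  shows "(\<lambda>t. norm (h t - k t) powr p) absolutely_integrable_on {a..b}"
proof (rule set_integrable_bound)
  show "(\<lambda>t. 2 powr p * (norm (h t) powr p + norm (k t) powr p)) absolutely_integrable_on {a..b}"
    by (intro set_integrable_mult_right impI set_integral_add(1) h k)
  have "(\<lambda>t. indicat_real {a..b} t *\<^sub>R (h t - k t)) \<in> borel_measurable lebesgue"
    using set_integral_diff(1)[OF h(1) k(1)] unfolding set_integrable_def by (rule borel_measurable_integrable)
  moreover have "(\<lambda>z::'a. norm z powr p) \<in> borel_measurable borel" by measurable
  ultimately have "(\<lambda>t. norm (indicat_real {a..b} t *\<^sub>R (h t - k t)) powr p) \<in> borel_measurable lebesgue"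
    by (rule measurable_compose)
  also have "(\<lambda>t. norm (indicat_real {a..b} t *\<^sub>R (h t - k t)) powr p)
      = (\<lambda>t. indicat_real {a..b} t *\<^sub>R norm (h t - k t) powr p)"
    by (auto simp: indicator_def fun_eq_iff)
  finally show "set_borel_measurable lebesgue {a..b} (\<lambda>t. norm (h t - k t) powr p)"
    unfolding set_borel_measurable_def .
  have "norm (h t - k t) powr p \<le> 2 powr p * (norm (h t) powr p + norm (k t) powr p)" for t
  proof -
    have "norm (h t - k t) powr p \<le> (norm (h t) + norm (k t)) powr p"
      using p by (intro powr_mono2 norm_triangle_ineq4) auto
    also have "\<dots> \<le> 2 powr p * (norm (h t) powr p + norm (k t) powr p)"
      by (rule powr_add_le[OF p]) auto
    finally show ?thesis .
  qed
  then show "AE t in lebesgue. t \<in> {a..b} \<longrightarrow> norm (norm (h t - k t) powr p)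
      \<le> norm (2 powr p * (norm (h t) powr p + norm (k t) powr p))"
    by (intro AE_I2 impI) (simp add: abs_mult)
qed

text \<open>
  A supremum of reals bounds its members only if the set is bounded; this is where (C2) enters.
\<close>

lemma integral_le_Theta_seminorm:
  assumes p: "1 \<le> p" and f: "cond_C1 f" "cond_C2 p f" and x: "x \<in> moduli_functions \<Theta> {a..b} j"
    and less: "Theta_seminorm \<Theta> p {a..b} j f < r"
  shows "integral {a..b} (\<lambda>t. norm (f t (x t)) powr p) \<le> r powr p"
proof -
  let ?J = "\<lambda>x. LINT t:{a..b}|lebesgue. norm (f t (x t)) powr p"
  have J0: "0 \<le> ?J x" for x unfolding set_lebesgue_integral_def by (rule integral_nonneg_AE) auto
  obtain m where m: "m \<in> Lp_loc p" "AE t in lebesgue. \<forall>x\<in>cball 0 (real j). norm (f t x) \<le> m t"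
    by (rule cond_C2E[OF f(2) compact_cball])
  have mp: "(\<lambda>t. \<bar>m t\<bar> powr p) absolutely_integrable_on {a..b}" using m(1) by (auto simp: Lp_loc_def)
  have J: "?J y \<le> (LINT t:{a..b}|lebesgue. \<bar>m t\<bar> powr p)" if y: "y \<in> moduli_functions \<Theta> {a..b} j" for y
  proof (rule set_integral_mono_AE[OF integrable_moduli_superposition(2)[OF p f y] mp])
    show "AE t in lebesgue. t \<in> {a..b} \<longrightarrow> norm (f t (y t)) powr p \<le> \<bar>m t\<bar> powr p"
      using m(2)
    proof eventually_elim
      case (elim t)
      show ?case
      proof
        assume "t \<in> {a..b}"
        then have "norm (f t (y t)) \<le> \<bar>m t\<bar>" using elim moduli_functionsD(2)[OF y] by force
        then show "norm (f t (y t)) powr p \<le> \<bar>m t\<bar> powr p" using p by (simp add: powr_mono2)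
      qed
    qed
  qed
  have "?J x powr (1 / p) \<le> Theta_seminorm \<Theta> p {a..b} j f"
    unfolding Theta_seminorm_def
  proof (rule cSUP_upper[OF x])
    show "bdd_above ((\<lambda>x. ?J x powr (1 / p)) ` moduli_functions \<Theta> {a..b} j)"
      using J J0 p by (intro bdd_aboveI2[where M="(LINT t:{a..b}|lebesgue. \<bar>m t\<bar> powr p) powr (1 / p)"] powr_mono2) auto
  qed
  then have "(?J x powr (1 / p)) powr p \<le> r powr p"
    using less p by (intro powr_mono2) auto
  then have "?J x \<le> r powr p" using p J0[of x] by (simp add: powr_powr)
  then show ?thesis
    using set_lebesgue_integral_eq_integral(2)[OF integrable_moduli_superposition(2)[OF p f x]] by simp
qed

text \<open>
  The form in which the topology is used: closeness in one seminorm gives \<open>L\<^sup>1\<close> closeness along all of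
  \<open>\<K>\<^sup>I\<^sub>j\<close> simultaneously.
\<close>

lemma L1_le_of_Theta_seminorm:
  assumes p: "1 \<le> p" and \<tau>: "0 < \<tau>" and ab: "a \<le> b"
  obtains r where "0 < r"
    "\<And>(f :: real \<Rightarrow> 'a::euclidean_space \<Rightarrow> 'b::euclidean_space) (x :: real \<Rightarrow> 'a). \<lbrakk>cond_C1 f; cond_C2 p f;
      Theta_seminorm \<Theta> p {a..b} j f < r; x \<in> moduli_functions \<Theta> {a..b} j\<rbrakk> \<Longrightarrow>
      integral {a..b} (\<lambda>t. norm (f t (x t))) \<le> \<tau>"
proof -
  obtain \<sigma> where \<sigma>: "0 < \<sigma>"
    "\<And>h :: real \<Rightarrow> 'b. h absolutely_integrable_on {a..b} \<Longrightarrow>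
      (\<lambda>t. norm (h t) powr p) absolutely_integrable_on {a..b} \<Longrightarrow>
      integral {a..b} (\<lambda>t. norm (h t) powr p) \<le> \<sigma> \<Longrightarrow> integral {a..b} (\<lambda>t. norm (h t)) \<le> \<tau>"
    by (rule Lp_small_imp_L1_small[OF p \<tau> ab, where ?'a='b]) blast
  show thesis
  proof (rule that[of "\<sigma> powr (1 / p)"])
    show "0 < \<sigma> powr (1 / p)" using \<sigma>(1) by simp
    fix f :: "real \<Rightarrow> 'a \<Rightarrow> 'b" and x :: "real \<Rightarrow> 'a"
    assume f: "cond_C1 f" "cond_C2 p f" "Theta_seminorm \<Theta> p {a..b} j f < \<sigma> powr (1 / p)"
      and x: "x \<in> moduli_functions \<Theta> {a..b} j"
    have "integral {a..b} (\<lambda>t. norm (f t (x t)) powr p) \<le> (\<sigma> powr (1 / p)) powr p"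
      by (rule integral_le_Theta_seminorm[OF p f(1,2) x f(3)])
    also have "\<dots> = \<sigma>" using \<sigma>(1) p by (simp add: powr_powr)
    finally show "integral {a..b} (\<lambda>t. norm (f t (x t))) \<le> \<tau>"
      by (intro \<sigma>(2) integrable_moduli_superposition[OF p f(1,2) x])
  qed
qed

section \<open>Approximation in the product topology\<close>

lemma const_in_moduli_functions:
  assumes "v \<in> cball 0 (real j)" "\<And>s. 0 \<le> s \<Longrightarrow> 0 \<le> \<Theta> I j s"
  shows "(\<lambda>_. v) \<in> moduli_functions \<Theta> I j"
proof -
  have "(\<lambda>_. v) ` I \<subseteq> cball 0 (real j)" using assms(1) by blast
  then show ?thesis
    unfolding moduli_functions_def mem_Collect_eq by (simp add: assms(2))
qed

lemma openin_Theta_ball: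
  assumes "I \<in> rat_intervals" "g \<in> S" "0 < r"
  shows "openin (Theta_topology \<Theta> p S) {h \<in> S. Theta_seminorm \<Theta> p I j (\<lambda>t x. h t x - g t x) < r}"
  unfolding Theta_topology_def by (rule topology_generated_by_Basis) (use assms in blast)

lemma topspace_Theta_topology_subset: "topspace (Theta_topology \<Theta> p S) \<subseteq> S"
  unfolding Theta_topology_def topology_generated_by_topspace by blast

lemma Theta_seminorm_diff_self:
  fixes g :: "real \<Rightarrow> 'a::euclidean_space \<Rightarrow> 'b::euclidean_space"
  assumes "(moduli_functions \<Theta> I j :: (real \<Rightarrow> 'a) set) \<noteq> {}"
  shows "Theta_seminorm \<Theta> p I j (\<lambda>t x. g t x - g t x) = 0"
  using assms by (simp add: Theta_seminorm_def set_lebesgue_integral_def)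

lemma Theta_closure_subset:
  assumes gG: "(g, G) \<in> prod_topology (Theta_topology \<Theta> p S) (Theta_topology \<Theta> p S') closure_of A"
  shows "g \<in> S" "G \<in> S'"
proof -
  have "(g, G) \<in> topspace (prod_topology (Theta_topology \<Theta> p S) (Theta_topology \<Theta> p S'))"
    using gG by (rule subsetD[OF closure_of_subset_topspace])
  then have g: "g \<in> topspace (Theta_topology \<Theta> p S)" and G: "G \<in> topspace (Theta_topology \<Theta> p S')"
    by simp_all
  show "g \<in> S" using g by (rule subsetD[OF topspace_Theta_topology_subset])
  show "G \<in> S'" using G by (rule subsetD[OF topspace_Theta_topology_subset])
qed

text \<open>
  A ball of one seminorm in each factor is a neighbourhood of \<open>(g, G)\<close>.  It contains its centre because
  the seminorm of \<open>0\<close> is \<open>0\<close>, being a supremum over a set that is nonempty: it contains the constants.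
\<close>

lemma Theta_closure_approximation:
  fixes g :: "real \<Rightarrow> 'a::euclidean_space \<Rightarrow> 'b::euclidean_space" and G :: "real \<Rightarrow> 'c::euclidean_space \<Rightarrow> 'd::euclidean_space"
  assumes gG: "(g, G) \<in> prod_topology (Theta_topology \<Theta> p S) (Theta_topology \<Theta> p S') closure_of A"
    and I: "I \<in> rat_intervals" and \<Theta>: "\<And>s. 0 \<le> s \<Longrightarrow> 0 \<le> \<Theta> I j s" and r: "0 < r" "0 < r'"
  obtains f J where "(f, J) \<in> A" "f \<in> S" "J \<in> S'"
    "Theta_seminorm \<Theta> p I j (\<lambda>t x. f t x - g t x) < r"
    "Theta_seminorm \<Theta> p I j (\<lambda>t x. J t x - G t x) < r'"
proof -
  let ?X = "Theta_topology \<Theta> p S" and ?Y = "Theta_topology \<Theta> p S'"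
  have near: "\<forall>T. (g, G) \<in> T \<and> openin (prod_topology ?X ?Y) T \<longrightarrow> (\<exists>y. y \<in> A \<and> y \<in> T)"
    using gG unfolding in_closure_of by (rule conjunct2)
  note g = Theta_closure_subset(1)[OF gG] and G = Theta_closure_subset(2)[OF gG]
  let ?U = "{h \<in> S. Theta_seminorm \<Theta> p I j (\<lambda>t x. h t x - g t x) < r}"
  let ?V = "{h \<in> S'. Theta_seminorm \<Theta> p I j (\<lambda>t x. h t x - G t x) < r'}"
  have "Theta_seminorm \<Theta> p I j (\<lambda>t x. g t x - g t x) = 0"
    by (rule Theta_seminorm_diff_self) (use const_in_moduli_functions[of "0::'a" j \<Theta> I] \<Theta> in auto)
  moreover have "Theta_seminorm \<Theta> p I j (\<lambda>t x. G t x - G t x) = 0"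
    by (rule Theta_seminorm_diff_self) (use const_in_moduli_functions[of "0::'c" j \<Theta> I] \<Theta> in auto)
  ultimately have mem: "(g, G) \<in> ?U \<times> ?V" using g G r by simp
  have "openin (prod_topology ?X ?Y) (?U \<times> ?V)"
    unfolding openin_prod_Times_iff
    by (intro disjI2 conjI openin_Theta_ball[OF I g r(1)] openin_Theta_ball[OF I G r(2)])
  from near[rule_format, OF conjI[OF mem this]] obtain y where "y \<in> A" "y \<in> ?U \<times> ?V" by (elim exE conjE) (rule that)
  obtain f J where y: "y = (f, J)" by (cases y)
  have "(f, J) \<in> A" using \<open>y \<in> A\<close> y by simp
  moreover have "f \<in> ?U" "J \<in> ?V" using \<open>y \<in> ?U \<times> ?V\<close> y by simp_all
  ultimately show thesis by (intro that[of f J]) simp_all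
qed

section \<open>Optimal m-bounds\<close>

lemma LC_lipschitz:
  assumes "f \<in> LC p" "compact K"
  obtains l where "l \<in> Lp_loc p" "AE t in lebesgue. \<forall>x\<in>K. \<forall>y\<in>K. norm (f t x - f t y) \<le> l t * norm (x - y)"
proof -
  have "\<exists>l\<in>Lp_loc p. AE t in lebesgue. \<forall>x\<in>K. \<forall>y\<in>K. norm (f t x - f t y) \<le> l t * norm (x - y)"
    using assms unfolding LC_def mem_Collect_eq by (elim conjE allE impE)
  then show thesis by (elim bexE) (rule that)
qed

text \<open>
  Continuity for almost every \<open>t\<close> makes suprema over a ball countable.
\<close>

lemma LC_continuous_AE:
  assumes "f \<in> LC p" "compact K"
  shows "AE t in lebesgue. continuous_on K (f t)"
proof -
  obtain l where "AE t in lebesgue. \<forall>x\<in>K. \<forall>y\<in>K. norm (f t x - f t y) \<le> l t * norm (x - y)"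
    by (rule LC_lipschitz[OF assms])
  then show ?thesis
  proof eventually_elim
    case (elim t)
    have "\<bar>l t\<bar>-lipschitz_on K (f t)"
    proof (rule lipschitz_onI)
      fix x y assume "x \<in> K" "y \<in> K"
      then have "norm (f t x - f t y) \<le> l t * norm (x - y)" using elim by blast
      also have "\<dots> \<le> \<bar>l t\<bar> * norm (x - y)" by (intro mult_right_mono) auto
      finally show "dist (f t x) (f t y) \<le> \<bar>l t\<bar> * dist x y" by (simp add: dist_norm)
    qed simp
    then show ?case by (rule lipschitz_on_continuous_on)
  qed
qed

lemma norm_le_m_bound_AE:
  assumes "cond_C2 p f"
  shows "AE t in lebesgue. \<forall>x\<in>cball 0 (real j). norm (f t x) \<le> m_bound f j t"
proof -
  obtain m where "AE t in lebesgue. \<forall>x\<in>cball 0 (real j). norm (f t x) \<le> m t"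
    by (rule cond_C2E[OF assms compact_cball])
  then show ?thesis
    by eventually_elim (auto simp: m_bound_def intro!: cSUP_upper bdd_aboveI2)
qed

lemma m_bound_nonneg_AE:
  assumes "cond_C2 p f"
  shows "AE t in lebesgue. 0 \<le> m_bound f j t"
  using norm_le_m_bound_AE[OF assms, of j]
proof eventually_elim
  case (elim t)
  have "norm (f t 0) \<le> m_bound f j t" using elim by simp
  then show ?case using norm_ge_zero order_trans by blast
qed

text \<open>
  For almost every \<open>t\<close> the supremum over the ball is a supremum over a countable dense subset, hence
  measurable; (C2) bounds it by an integrable function.
\<close>

lemma m_bound_absolutely_integrable:
  fixes f :: "real \<Rightarrow> 'a::euclidean_space \<Rightarrow> 'b::euclidean_space"
  assumes p: "1 \<le> p" and f: "f \<in> LC p"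
  shows "m_bound f j absolutely_integrable_on {a..b}"
proof -
  have C1: "cond_C1 f" and C2: "cond_C2 p f" using f by (auto simp: LC_def)
  let ?K = "cball (0::'a) (real j)"
  obtain m where m: "m \<in> Lp_loc p" "AE t in lebesgue. \<forall>x\<in>?K. norm (f t x) \<le> m t"
    by (rule cond_C2E[OF C2 compact_cball])
  obtain D where D: "countable D" "D \<subseteq> ?K" "?K \<subseteq> closure D" by (rule separable)
  have D0: "D \<noteq> {}" using D(3) by (metis closure_empty cball_eq_empty not_less of_nat_0_le_iff subset_empty)
  have DK: "closure D = ?K" using D by (intro antisym closure_minimal) auto
  define d where "d = from_nat_into D"
  have d: "range d = D" unfolding d_def by (rule range_from_nat_into[OF D0 D(1)])
  have "(\<lambda>t. f t (d n)) \<in> borel_measurable borel" for n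
    using borel_measurable_superposition[OF C1 borel_measurable_const] .
  \<comment> \<open>In \<open>ereal\<close> the countable supremum is measurable also at those
    \<open>t\<close> where the family is unbounded.\<close>
  then have meas: "(\<lambda>t. SUP n. ereal (norm (f t (d n)))) \<in> borel_measurable borel"
    by (intro borel_measurable_SUP borel_measurable_ereal borel_measurable_norm) auto
  have "AE t in lebesgue. real_of_ereal (SUP n. ereal (norm (f t (d n)))) = m_bound f j t"
    using m(2) LC_continuous_AE[OF f compact_cball[of 0 "real j"]]
  proof eventually_elim
    case (elim t)
    define z where "z = (SUP n. ereal (norm (f t (d n))))"
    have up: "norm (f t x) \<le> m_bound f j t" if "x \<in> ?K" for x
      unfolding m_bound_def by (rule cSUP_upper[OF that]) (use elim in \<open>auto intro!: bdd_aboveI2\<close>)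
    have z1: "z \<le> ereal (m_bound f j t)"
      unfolding z_def using d D(2) by (intro SUP_least) (auto intro!: up)
    have z2: "ereal (norm (f t (d n))) \<le> z" for n unfolding z_def by (rule SUP_upper) simp
    obtain r where r: "z = ereal r" using z1 z2[of 0] by (cases z) auto
    have "norm (f t x) \<le> r" if "x \<in> ?K" for x
    proof (rule continuous_le_on_closure[where S=D and f="\<lambda>x. norm (f t x)"])
      show "continuous_on (closure D) (\<lambda>x. norm (f t x))"
        unfolding DK using elim(2) by (rule continuous_on_norm)
      show "x \<in> closure D" using that DK by simp
      fix y assume "y \<in> D"
      then obtain n where "y = d n" using d by blast
      then show "norm (f t y) \<le> r" using z2[of n] r by simp
    qed
    then have "m_bound f j t \<le> r" unfolding m_bound_def by (intro cSUP_least) auto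
    then have "z = ereal (m_bound f j t)" using z1 r by simp
    then show "real_of_ereal (SUP n. ereal (norm (f t (d n)))) = m_bound f j t" by (simp add: z_def)
  qed
  then have leb: "m_bound f j \<in> borel_measurable lebesgue"
    by (rule borel_measurable_AE[rotated]) (intro measurable_completion, use borel_measurable_real_of_ereal[OF meas] in simp)
  show ?thesis
  proof (rule set_integrable_bound[OF Lp_loc_absolutely_integrable[OF p m(1)]])
    show "set_borel_measurable lebesgue {a..b} (m_bound f j)"
      unfolding set_borel_measurable_def by (intro borel_measurable_scaleR borel_measurable_indicator leb) auto
    show "AE t in lebesgue. t \<in> {a..b} \<longrightarrow> norm (m_bound f j t) \<le> norm (m t)"
      using m(2) m_bound_nonneg_AE[OF C2, of j]
    proof eventually_elim
      case (elim t)
      have "m_bound f j t \<le> m t" unfolding m_bound_def using elim by (intro cSUP_least) auto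
      then show ?case using elim by simp
    qed
  qed
qed

lemma integral_m_bound_mono:
  assumes p: "1 \<le> p" and f: "f \<in> LC p" and "{a..b} \<subseteq> {c..d}"
  shows "integral {a..b} (m_bound f j) \<le> integral {c..d} (m_bound f j)"
  using f assms(3)
  by (intro integral_subset_le_AE m_bound_absolutely_integrable[OF p f] m_bound_nonneg_AE[where p=p]) (auto simp: LC_def)

text \<open>
  Equicontinuity bounds the integrals over short intervals by \<open>1\<close>, uniformly in \<open>f\<close>; finitely many of
  these cover \<open>{c..d}\<close>.
\<close>

lemma integral_m_bound_bounded:
  assumes p: "1 \<le> p" and E1: "E1 \<subseteq> LC p" and equi: "L1_loc_equicontinuous_m_bounds E1"
  shows "\<exists>B. \<forall>f\<in>E1. integral {c..d} (m_bound f j) \<le> B"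
proof -
  define r where "r = \<bar>c\<bar> + \<bar>d\<bar> + 1"
  have r: "0 < r" by (simp add: r_def)
  obtain \<delta> where \<delta>: "0 < \<delta>" "\<And>s t. - r \<le> s \<and> s \<le> t \<and> t \<le> r \<and> t - s < \<delta> \<Longrightarrow>
      (SUP f\<in>E1. ereal (LINT u:{s..t}|lebesgue. m_bound f j u)) < ereal 1"
  proof -
    have "\<exists>\<delta>>0. \<forall>s t. - r \<le> s \<and> s \<le> t \<and> t \<le> r \<and> t - s < \<delta> \<longrightarrow>
        (SUP f\<in>E1. ereal (LINT u:{s..t}|lebesgue. m_bound f j u)) < ereal 1"
      using equi r unfolding L1_loc_equicontinuous_m_bounds_def by simp
    then show thesis by (elim exE conjE) (rule that, auto)
  qed
  have short: "integral {s..t} (m_bound f j) \<le> 1" if "- r \<le> s" "s \<le> t" "t \<le> r" "t - s < \<delta>" "f \<in> E1" for s t f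
  proof -
    have fL: "f \<in> LC p" by (rule subsetD[OF E1 that(5)])
    have "ereal (LINT u:{s..t}|lebesgue. m_bound f j u) \<le> (SUP f\<in>E1. ereal (LINT u:{s..t}|lebesgue. m_bound f j u))"
      using SUP_upper[OF that(5), of "\<lambda>f. ereal (LINT u:{s..t}|lebesgue. m_bound f j u)"] .
    also have "\<dots> < ereal 1" by (rule \<delta>(2)) (use that(1-4) in simp)
    finally show ?thesis
      using set_lebesgue_integral_eq_integral(2)[OF m_bound_absolutely_integrable[OF p fL, where j=j and a=s and b=t]] by simp
  qed
  have *: "\<forall>t f. c \<le> t \<longrightarrow> t \<le> d \<longrightarrow> t - c \<le> real n * (\<delta> / 2) \<longrightarrow> f \<in> E1 \<longrightarrow> integral {c..t} (m_bound f j) \<le> real n" for n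
  proof (induction n)
    case 0
    show ?case by auto
  next
    case (Suc n)
    show ?case
    proof (intro allI impI)
      fix t f assume t: "c \<le> t" "t \<le> d" "t - c \<le> real (Suc n) * (\<delta> / 2)" and f: "f \<in> E1"
      \<comment> \<open>\<open>max\<close> with \<open>c\<close> covers the first piece, which may be shorter
        than \<open>\<delta> / 2\<close>.\<close>
      define s where "s = max c (t - \<delta> / 2)"
      have s: "c \<le> s" "s \<le> t" "s \<le> d" "s - c \<le> real n * (\<delta> / 2)" "t - s < \<delta>"
      proof -
        have "0 \<le> real n * (\<delta> / 2)" using \<delta>(1) by simp
        moreover have "t - \<delta> / 2 - c \<le> real n * (\<delta> / 2)" using t(3) by (simp add: algebra_simps)
        ultimately show "s - c \<le> real n * (\<delta> / 2)" unfolding s_def max_def by auto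
      qed (use t(1,2) \<delta>(1) in \<open>auto simp: s_def\<close>)
      have "integral {c..s} (m_bound f j) + integral {s..t} (m_bound f j) = integral {c..t} (m_bound f j)"
        using s subsetD[OF E1 f] by (intro Henstock_Kurzweil_Integration.integral_combine set_lebesgue_integral_eq_integral(1)
            m_bound_absolutely_integrable[OF p]) auto
      moreover have "integral {c..s} (m_bound f j) \<le> real n" by (rule Suc[rule_format]) (use s f in simp_all)
      moreover have "integral {s..t} (m_bound f j) \<le> 1"
        using s t f by (intro short) (auto simp: r_def)
      ultimately show "integral {c..t} (m_bound f j) \<le> real (Suc n)" by simp
    qed
  qed
  have "0 < \<delta> / 2" using \<delta>(1) by simp
  from reals_Archimedean3[OF this] obtain n where n: "d - c < real n * (\<delta> / 2)" by blast
  show ?thesis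
  proof (cases "c \<le> d")
    case True
    show ?thesis
      by (intro exI[of _ "real n"] ballI *[rule_format]) (use True n in simp_all)
  qed (auto intro!: exI[of _ 0])
qed

text \<open>
  The family over which \<open>m_bound_moduli\<close> takes the supremum is bounded, so the member for \<open>(c, f)\<close> is below
  the supremum; enlarging the interval from \<open>{c..d}\<close> to \<open>{c..c + h}\<close> only increases the integral.
\<close>

lemma integral_m_bound_le_moduli:
  assumes p: "1 \<le> p" and E1: "E1 \<subseteq> LC p" and equi: "L1_loc_equicontinuous_m_bounds E1"
    and f: "f \<in> E1" and c: "c \<in> {q1..q2}" and h: "d - c \<le> h"
  shows "integral {c..d} (m_bound f j) \<le> m_bound_moduli E1 {q1..q2} j h"
proof -
  obtain B where B: "\<forall>f\<in>E1. integral {q1..q2 + h} (m_bound f j) \<le> B"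
    using integral_m_bound_bounded[OF p E1 equi, of q1 "q2 + h" j] by (elim exE)
  have eq: "(LINT u:{t..t + h}|lebesgue. m_bound f j u) = integral {t..t + h} (m_bound f j)" if "f \<in> E1" for t f
    using subsetD[OF E1 that] by (intro set_lebesgue_integral_eq_integral(2) m_bound_absolutely_integrable[OF p]) auto
  have bdd: "bdd_above ((\<lambda>(t, f). LINT u:{t..t + h}|lebesgue. m_bound f j u) ` ({q1..q2} \<times> E1))"
  proof (rule bdd_aboveI2[where M=B], clarify)
    fix t f assume t: "t \<in> {q1..q2}" and f: "f \<in> E1"
    have "integral {t..t + h} (m_bound f j) \<le> integral {q1..q2 + h} (m_bound f j)"
      using t subsetD[OF E1 f] by (intro integral_m_bound_mono[OF p]) auto
    then show "(LINT u:{t..t + h}|lebesgue. m_bound f j u) \<le> B"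
      using bspec[OF B f] eq[OF f, of t] by linarith
  qed
  have "integral {c..d} (m_bound f j) \<le> integral {c..c + h} (m_bound f j)"
    using subsetD[OF E1 f] h by (intro integral_m_bound_mono[OF p]) auto
  also have "\<dots> = (case (c, f) of (t, f) \<Rightarrow> LINT u:{t..t + h}|lebesgue. m_bound f j u)"
    using eq[OF f, of c] by simp
  also have "\<dots> \<le> m_bound_moduli E1 {q1..q2} j h"
    unfolding m_bound_moduli_def by (rule cSUP_upper[OF _ bdd]) (use c f in simp)
  finally show ?thesis .
qed

lemma m_bound_moduli_nonneg:
  assumes p: "1 \<le> p" and E1: "E1 \<subseteq> LC p" "E1 \<noteq> {}" and equi: "L1_loc_equicontinuous_m_bounds E1"
    and q: "q1 \<le> q2" and h: "0 \<le> h"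
  shows "0 \<le> m_bound_moduli E1 {q1..q2} j h"
proof -
  obtain f where f: "f \<in> E1" using E1(2) by blast
  show ?thesis
    using integral_m_bound_le_moduli[OF p E1(1) equi f, of q1 q1 q2 q1 h j] q h by simp
qed

section \<open>Moduli of continuity of solutions\<close>

text \<open>
  For \<open>f \<in> E1\<close> in place of \<open>g\<close> this is immediate from \<open>norm (f t (x t)) \<le> m_bound f j t\<close>.  A limit \<open>g\<close> is close to
  \<open>E1\<close> only along functions in \<open>\<K>\<^sup>I\<^sub>j\<close>, and \<open>x\<close> is not known to be one of them: for a solution \<open>x\<close> that is what
  this lemma will prove.  But the constants belong to \<open>\<K>\<^sup>I\<^sub>j\<close>.  So \<open>x\<close> is first replaced by step functions
  with finitely many values \<open>v\<close>, along which the error is at most the sum over \<open>v\<close> of the errors along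
  the constants \<open>v\<close>; continuity of \<open>g\<close> in the second variable then gives the claim for \<open>x\<close>.
\<close>

lemma integral_superposition_le_modulus:
  fixes g :: "real \<Rightarrow> 'a::euclidean_space \<Rightarrow> 'b::euclidean_space"
  assumes p: "1 \<le> p" and g: "g \<in> LC p" and E1: "E1 \<subseteq> LC p" and equi: "L1_loc_equicontinuous_m_bounds E1"
    and approx: "\<And>\<tau>. 0 < \<tau> \<Longrightarrow> \<exists>f\<in>E1. \<forall>v\<in>cball 0 (real j). integral {q1..q2} (\<lambda>t. norm (f t v - g t v)) \<le> \<tau>"
    and x: "continuous_on {c..d} x" "x ` {c..d} \<subseteq> cball 0 (real j)"
    and cd: "c \<le> d" "{c..d} \<subseteq> {q1..q2}" "d - c \<le> h"
  shows "integral {c..d} (\<lambda>t. norm (g t (x t))) \<le> m_bound_moduli E1 {q1..q2} j h"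
proof -
  let ?K = "cball (0::'a) (real j)" and ?\<theta> = "m_bound_moduli E1 {q1..q2} j h"
  have gC1: "cond_C1 g" and gC2: "cond_C2 p g" using g by (simp_all add: LC_def)
  \<comment> \<open>Extended by constants, because the grid point below \<open>u\<close> may lie to the left
    of \<open>c\<close>.\<close>
  define xt where "xt u = x (max c (min d u))" for u
  have xt_cont: "continuous_on UNIV xt"
    unfolding xt_def by (rule continuous_on_compose2[OF x(1)]) (use cd in \<open>auto intro!: continuous_intros\<close>)
  have xt_K: "xt u \<in> ?K" for u
  proof -
    have "max c (min d u) \<in> {c..d}" using cd by auto
    then show ?thesis using x(2) unfolding xt_def by blast
  qed
  have xt_eq: "xt u = x u" if "u \<in> {c..d}" for u using that by (simp add: xt_def)
  define step where "step k u = xt (real_of_int \<lfloor>real (Suc k) * u\<rfloor> / real (Suc k))" for k u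
  have step_K: "step k u \<in> ?K" for k u unfolding step_def by (rule xt_K)
  have step_meas: "step k \<in> borel_measurable borel" for k
  proof -
    have "(\<lambda>u. real_of_int \<lfloor>real (Suc k) * u\<rfloor> / real (Suc k)) \<in> borel_measurable borel" by measurable
    from measurable_compose[OF this borel_measurable_continuous_onI[OF xt_cont]]
    show ?thesis by (simp add: step_def[abs_def])
  qed
  have step_set_meas: "set_borel_measurable borel {c..d} (step k)" for k
    unfolding set_borel_measurable_def using step_meas by measurable
  have step_fin: "finite (step k ` {c..d})" for k
  proof (rule finite_subset)
    show "step k ` {c..d} \<subseteq> (\<lambda>i. xt (real_of_int i / real (Suc k))) ` {\<lfloor>real (Suc k) * c\<rfloor>..\<lfloor>real (Suc k) * d\<rfloor>}"
    proof
      fix v assume "v \<in> step k ` {c..d}"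
      then obtain u where u: "u \<in> {c..d}" "v = step k u" by blast
      have "\<lfloor>real (Suc k) * u\<rfloor> \<in> {\<lfloor>real (Suc k) * c\<rfloor>..\<lfloor>real (Suc k) * d\<rfloor>}"
        using u(1) unfolding atLeastAtMost_iff by (intro conjI floor_mono mult_left_mono) auto
      then show "v \<in> (\<lambda>i. xt (real_of_int i / real (Suc k))) ` {\<lfloor>real (Suc k) * c\<rfloor>..\<lfloor>real (Suc k) * d\<rfloor>}"
        unfolding u(2) step_def by (rule imageI)
    qed
  qed auto
  have step_lim: "(\<lambda>k. step k u) \<longlonglongrightarrow> xt u" for u
  proof -
    have "(\<lambda>k. real_of_int \<lfloor>real (Suc k) * u\<rfloor> / real (Suc k)) \<longlonglongrightarrow> u"
    proof (rule LIM_zero_cancel, rule Lim_null_comparison)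
      show "(\<lambda>k. inverse (real (Suc k))) \<longlonglongrightarrow> 0" by (rule LIMSEQ_inverse_real_of_nat)
      have "norm (real_of_int \<lfloor>real (Suc k) * u\<rfloor> / real (Suc k) - u) \<le> inverse (real (Suc k))" for k
      proof -
        define n where "n = real (Suc k)"
        have n: "0 < n" by (simp add: n_def)
        have "\<bar>real_of_int \<lfloor>n * u\<rfloor> - n * u\<bar> \<le> 1" by linarith
        moreover have "real_of_int \<lfloor>n * u\<rfloor> / n - u = (real_of_int \<lfloor>n * u\<rfloor> - n * u) / n"
          using n by (simp add: field_simps)
        ultimately show ?thesis
          using n unfolding n_def[symmetric] by (simp add: inverse_eq_divide divide_right_mono)
      qed
      then show "\<forall>\<^sub>F k in sequentially. norm (real_of_int \<lfloor>real (Suc k) * u\<rfloor> / real (Suc k) - u) \<le> inverse (real (Suc k))"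
        by (intro always_eventually allI)
    qed
    moreover have "isCont xt u" using xt_cont by (simp add: continuous_on_eq_continuous_at)
    ultimately show ?thesis unfolding step_def by (rule isCont_tendsto_compose[rotated])
  qed
  have step_int: "(\<lambda>t. g t (step k t)) absolutely_integrable_on {c..d}" for k
    by (rule superposition_absolutely_integrable(1)[OF p gC1 gC2 step_set_meas _ compact_cball[of 0 "real j"]])
      (use step_K in blast)
  have const_int: "(\<lambda>t. h t v) absolutely_integrable_on {c..d}"
    if "cond_C1 h" "cond_C2 p h" for h :: "real \<Rightarrow> 'a \<Rightarrow> 'b" and v c d
    by (rule superposition_absolutely_integrable(1)[OF p that _ _ compact_sing[of v]])
      (auto simp: set_borel_measurable_def)
  have step_le: "integral {c..d} (\<lambda>t. norm (g t (step k t))) \<le> ?\<theta>" for k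
  proof (rule field_le_epsilon)
    fix e :: real assume e: "0 < e"
    define V where "V = step k ` {c..d}"
    have V: "finite V" "V \<subseteq> ?K" unfolding V_def using step_fin step_K by blast+
    \<comment> \<open>The error \<open>\<tau>\<close> occurs once for each value of the step function.\<close>
    define \<tau> where "\<tau> = e / (real (card V) + 1)"
    have \<tau>: "0 < \<tau>" using e by (simp add: \<tau>_def add_nonneg_pos)
    obtain f where f: "f \<in> E1" "\<forall>v\<in>?K. integral {q1..q2} (\<lambda>t. norm (f t v - g t v)) \<le> \<tau>"
      using approx[OF \<tau>] by blast
    have fL: "f \<in> LC p" by (rule subsetD[OF E1 f(1)])
    then have fC1: "cond_C1 f" and fC2: "cond_C2 p f" by (simp_all add: LC_def)
    have di: "(\<lambda>t. norm (f t v - g t v)) absolutely_integrable_on {c..d}" for v c d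
      by (intro set_integrable_norm set_integral_diff(1) const_int fC1 fC2 gC1 gC2)
    have si: "(\<lambda>t. \<Sum>v\<in>V. norm (f t v - g t v)) absolutely_integrable_on {c..d}"
      by (intro absolutely_integrable_sum V(1) di)
    have mi: "m_bound f j absolutely_integrable_on {c..d}" by (rule m_bound_absolutely_integrable[OF p fL])
    have "integral {c..d} (\<lambda>t. norm (g t (step k t)))
        \<le> integral {c..d} (\<lambda>t. m_bound f j t + (\<Sum>v\<in>V. norm (f t v - g t v)))"
    proof (rule integral_le_AE)
      show "(\<lambda>t. norm (g t (step k t))) absolutely_integrable_on {c..d}"
        by (rule set_integrable_norm[OF step_int])
      show "(\<lambda>t. m_bound f j t + (\<Sum>v\<in>V. norm (f t v - g t v))) absolutely_integrable_on {c..d}"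
        by (rule set_integral_add(1)[OF mi si])
      show "AE t in lebesgue. t \<in> {c..d} \<longrightarrow>
          norm (g t (step k t)) \<le> m_bound f j t + (\<Sum>v\<in>V. norm (f t v - g t v))"
        using norm_le_m_bound_AE[OF fC2, of j]
      proof eventually_elim
        case (elim t)
        show ?case
        proof
          assume "t \<in> {c..d}"
          then have "step k t \<in> V" unfolding V_def by (rule imageI)
          then have "norm (f t (step k t) - g t (step k t)) \<le> (\<Sum>v\<in>V. norm (f t v - g t v))"
            using V(1) by (intro member_le_sum[where f="\<lambda>v. norm (f t v - g t v)"]) auto
          moreover have "norm (f t (step k t)) \<le> m_bound f j t" using elim step_K by (rule bspec)
          moreover have "norm (g t (step k t)) \<le> norm (f t (step k t)) + norm (f t (step k t) - g t (step k t))"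
            by (metis norm_minus_commute norm_triangle_sub)
          ultimately show "norm (g t (step k t)) \<le> m_bound f j t + (\<Sum>v\<in>V. norm (f t v - g t v))" by linarith
        qed
      qed
    qed
    also have "\<dots> = integral {c..d} (m_bound f j) + (\<Sum>v\<in>V. integral {c..d} (\<lambda>t. norm (f t v - g t v)))"
      using V(1) by (subst integral_add integral_sum, auto intro!: set_lebesgue_integral_eq_integral(1) mi si di)+
    also have "\<dots> \<le> ?\<theta> + (\<Sum>v\<in>V. \<tau>)"
    proof (intro add_mono sum_mono)
      show "integral {c..d} (m_bound f j) \<le> ?\<theta>"
        using cd by (intro integral_m_bound_le_moduli[OF p E1 equi f(1)]) auto
      fix v assume "v \<in> V"
      then have v: "v \<in> ?K" using V(2) by blast
      have "integral {c..d} (\<lambda>t. norm (f t v - g t v)) \<le> integral {q1..q2} (\<lambda>t. norm (f t v - g t v))"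
        by (rule integral_subset_le[OF cd(2)]) (auto intro: set_lebesgue_integral_eq_integral(1)[OF di])
      also have "\<dots> \<le> \<tau>" using f(2) v by (rule bspec)
      finally show "integral {c..d} (\<lambda>t. norm (f t v - g t v)) \<le> \<tau>" .
    qed
    also have "(\<Sum>v\<in>V. \<tau>) \<le> e"
    proof -
      have "(\<Sum>v\<in>V. \<tau>) = real (card V) * \<tau>" by simp
      also have "\<dots> \<le> (real (card V) + 1) * \<tau>" using \<tau> by simp
      also have "\<dots> = e" by (simp add: \<tau>_def add_nonneg_eq_0_iff)
      finally show ?thesis .
    qed
    finally show "integral {c..d} (\<lambda>t. norm (g t (step k t))) \<le> ?\<theta> + e" by simp
  qed
  obtain m where m: "m \<in> Lp_loc p" "AE t in lebesgue. \<forall>x\<in>?K. norm (g t x) \<le> m t"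
    by (rule cond_C2E[OF gC2 compact_cball])
  have xi: "(\<lambda>t. g t (x t)) absolutely_integrable_on {c..d}"
    by (rule superposition_absolutely_integrable(1)[OF p gC1 gC2 set_measurable_continuous_on[OF _ x(1)] x(2) compact_cball]) simp
  have "(\<lambda>k. integral {c..d} (\<lambda>t. norm (g t (step k t)))) \<longlonglongrightarrow> integral {c..d} (\<lambda>t. norm (g t (x t)))"
  proof (rule integral_tendsto_AE)
    show "(\<lambda>t. norm (g t (step k t))) absolutely_integrable_on {c..d}" for k
      by (rule set_integrable_norm[OF step_int])
    show "(\<lambda>t. norm (g t (x t))) absolutely_integrable_on {c..d}" by (rule set_integrable_norm[OF xi])
    show "m absolutely_integrable_on {c..d}" by (rule Lp_loc_absolutely_integrable[OF p m(1)])
    show "AE t in lebesgue. t \<in> {c..d} \<longrightarrow> norm (norm (g t (step k t))) \<le> m t" for k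
      using m(2) by eventually_elim (use step_K in auto)
    show "AE t in lebesgue. t \<in> {c..d} \<longrightarrow> (\<lambda>k. norm (g t (step k t))) \<longlonglongrightarrow> norm (g t (x t))"
      using LC_continuous_AE[OF g compact_cball[of 0 "real j"]]
    proof eventually_elim
      case (elim t)
      show ?case
      proof
        assume t: "t \<in> {c..d}"
        have "(\<lambda>k. g t (step k t)) \<longlonglongrightarrow> g t (xt t)"
          by (rule continuous_on_tendsto_compose[OF elim step_lim xt_K]) (intro always_eventually allI step_K)
        then show "(\<lambda>k. norm (g t (step k t))) \<longlonglongrightarrow> norm (g t (x t))"
          unfolding xt_eq[OF t] by (rule tendsto_norm)
      qed
    qed
  qed
  then show ?thesis by (rule LIMSEQ_le_const2) (use step_le in blast)
qed

text \<open>
  The seminorms live on intervals with rational end points, so a solution is extended by constants to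
  a larger such interval.  This does not increase its modulus of continuity.
\<close>

lemma clamped_solution_in_moduli_functions:
  fixes g :: "real \<Rightarrow> 'a::euclidean_space \<Rightarrow> 'a"
  assumes p: "1 \<le> p" and g: "g \<in> LC p" and E1: "E1 \<subseteq> LC p" and equi: "L1_loc_equicontinuous_m_bounds E1"
    and approx: "\<And>\<tau>. 0 < \<tau> \<Longrightarrow> \<exists>f\<in>E1. \<forall>v\<in>cball 0 (real j). integral {q1..q2} (\<lambda>t. norm (f t v - g t v)) \<le> \<tau>"
    and ab: "a \<le> 0" "0 \<le> b" "{a..b} \<subseteq> {q1..q2}"
    and x: "caratheodory_solution g x0 {a..b} x" "x ` {a..b} \<subseteq> cball 0 (real j)"
  shows "(\<lambda>t. x (max a (min b t))) \<in> moduli_functions (m_bound_moduli E1) {q1..q2} j"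
proof -
  let ?c = "\<lambda>t. max a (min b t)" and ?\<Theta> = "m_bound_moduli E1 {q1..q2} j"
  have cx: "continuous_on {a..b} x" and hi: "(\<lambda>s. g s (x s)) absolutely_integrable_on {a..b}"
    and eq: "\<And>t. t \<in> {a..b} \<Longrightarrow> x t = x0 + integral_from_0 a (\<lambda>s. g s (x s)) t"
    using x(1) unfolding caratheodory_solution_iff[OF ab(1,2)] by auto
  have cI: "?c t \<in> {a..b}" for t using ab by auto
  have mono: "norm (x (?c t) - x (?c s)) \<le> ?\<Theta> (t - s)" if st: "s \<le> t" for s t
  proof -
    have le: "?c s \<le> ?c t" "?c t - ?c s \<le> t - s" using st by auto
    have sub: "{?c s..?c t} \<subseteq> {a..b}" using cI[of s] cI[of t] by auto
    have hs: "(\<lambda>r. g r (x r)) absolutely_integrable_on {?c s..?c t}"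
      by (rule absolutely_integrable_on_subinterval[OF hi sub])
    have "x (?c t) - x (?c s) = integral {?c s..?c t} (\<lambda>r. g r (x r))"
      using integral_from_0_diff[OF hi _ le(1)] cI[of s] cI[of t] eq[OF cI] by auto
    also have "norm \<dots> \<le> integral {?c s..?c t} (\<lambda>r. norm (g r (x r)))"
      by (rule integral_norm_le_AE[OF hs set_integrable_norm[OF hs]]) simp
    also have "\<dots> \<le> ?\<Theta> (t - s)"
    proof (rule integral_superposition_le_modulus[OF p g E1 equi approx _ _ le(1) _ le(2)])
      show "continuous_on {?c s..?c t} x" by (rule continuous_on_subset[OF cx sub])
      show "x ` {?c s..?c t} \<subseteq> cball 0 (real j)" using x(2) sub by blast
      show "{?c s..?c t} \<subseteq> {q1..q2}" using sub ab(3) by blast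
    qed
    finally show ?thesis .
  qed
  show ?thesis
    unfolding moduli_functions_def mem_Collect_eq
  proof (intro conjI ballI)
    show "continuous_on {q1..q2} (\<lambda>t. x (?c t))"
      by (rule continuous_on_compose2[OF cx]) (use cI in \<open>auto intro!: continuous_intros\<close>)
    show "(\<lambda>t. x (?c t)) ` {q1..q2} \<subseteq> cball 0 (real j)" using x(2) cI by blast
    fix s t
    show "norm (x (?c t) - x (?c s)) \<le> ?\<Theta> \<bar>t - s\<bar>"
      using mono[of s t] mono[of t s] by (cases "s \<le> t") (auto simp: norm_minus_commute)
  qed
qed

section \<open>The linearization remainder\<close>

lemma norm_matrix_vector_mult_le:
  fixes A :: "real^'n^'m"
  shows "norm (A *v x) \<le> norm A * norm x"
proof -
  have "norm (A *v x) = L2_set (\<lambda>i. \<bar>A $ i \<bullet> x\<bar>) UNIV"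
    by (simp add: norm_vec_def matrix_vector_mul_component)
  also have "\<dots> \<le> L2_set (\<lambda>i. norm (A $ i) * norm x) UNIV"
    by (intro L2_set_mono Cauchy_Schwarz_ineq2) auto
  also have "\<dots> = norm A * norm x"
    by (simp add: norm_vec_def[of A] L2_set_left_distrib)
  finally show ?thesis .
qed

text \<open>
  The mean value formula: the remainder is the integral over \<open>l\<close> of the derivative of
  \<open>f (x + l (y - x)) - l J (y - x)\<close>, where \<open>J\<close> is the Jacobian at \<open>x\<close>.
\<close>

lemma C1_remainder_le:
  fixes f :: "real^'n \<Rightarrow> real^'m"
  assumes diff: "\<And>x. f differentiable at x" and cont: "continuous_on UNIV (\<lambda>x. jacobian f (at x))"
  shows "norm (f y - f x - jacobian f (at x) *v (y - x))
    \<le> norm (y - x) * integral {0..1} (\<lambda>l. norm (jacobian f (at (x + l *\<^sub>R (y - x))) - jacobian f (at x)))"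
proof -
  define d where "d = y - x"
  let ?J = "\<lambda>x. jacobian f (at x)"
  define \<phi> where "\<phi> l = f (x + l *\<^sub>R d) - l *\<^sub>R (?J x *v d)" for l
  have der: "(\<phi> has_vector_derivative (?J (x + l *\<^sub>R d) - ?J x) *v d) (at l within {0..1})" for l
  proof -
    have "(f has_derivative (\<lambda>h. ?J (x + l *\<^sub>R d) *v h)) (at (x + l *\<^sub>R d))"
      using diff unfolding jacobian_works by blast
    moreover have "((\<lambda>l. x + l *\<^sub>R d) has_derivative (\<lambda>h. h *\<^sub>R d)) (at l within {0..1})"
      by (auto intro!: derivative_eq_intros)
    ultimately have "((\<lambda>l. f (x + l *\<^sub>R d)) has_derivative (\<lambda>h. ?J (x + l *\<^sub>R d) *v (h *\<^sub>R d))) (at l within {0..1})"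
      by (rule has_derivative_compose[rotated])
    then have "(\<phi> has_derivative (\<lambda>h. ?J (x + l *\<^sub>R d) *v (h *\<^sub>R d) - h *\<^sub>R (?J x *v d))) (at l within {0..1})"
      unfolding \<phi>_def by (auto intro!: derivative_eq_intros)
    then show ?thesis
      unfolding has_vector_derivative_def
      by (simp add: matrix_vector_mult_scaleR matrix_vector_mult_diff_rdistrib scaleR_diff_right)
  qed
  have cJ: "continuous_on {0..1} (\<lambda>l. ?J (x + l *\<^sub>R d))"
    by (rule continuous_on_compose2[OF cont]) (auto intro!: continuous_intros)
  have "((\<lambda>l. (?J (x + l *\<^sub>R d) - ?J x) *v d) has_integral (\<phi> 1 - \<phi> 0)) {0..1}"
    by (rule fundamental_theorem_of_calculus) (use der in auto)
  then have int: "(\<lambda>l. (?J (x + l *\<^sub>R d) - ?J x) *v d) integrable_on {0..1}"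
    and eq: "\<phi> 1 - \<phi> 0 = integral {0..1} (\<lambda>l. (?J (x + l *\<^sub>R d) - ?J x) *v d)"
    by (auto simp: integral_unique integrable_on_def)
  have "norm (\<phi> 1 - \<phi> 0) \<le> integral {0..1} (\<lambda>l. norm (?J (x + l *\<^sub>R d) - ?J x) * norm d)"
    unfolding eq
  proof (rule integral_norm_bound_integral[OF int])
    show "(\<lambda>l. norm (?J (x + l *\<^sub>R d) - ?J x) * norm d) integrable_on {0..1}"
      by (intro integrable_continuous_real continuous_intros cJ)
  qed (rule norm_matrix_vector_mult_le)
  also have "\<dots> = norm d * integral {0..1} (\<lambda>l. norm (?J (x + l *\<^sub>R d) - ?J x))" by simp
  also have "\<phi> 1 - \<phi> 0 = f y - f x - ?J x *v d" by (simp add: \<phi>_def d_def)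
  finally show ?thesis by (simp add: d_def)
qed

text \<open>
  Convexity of \<open>\<K>\<^sup>I\<^sub>j\<close>: the intermediate functions of the mean value formula are again test functions of the
  seminorms.
\<close>

lemma moduli_functions_segment:
  assumes u: "u \<in> moduli_functions \<Theta> I j" and v: "v \<in> moduli_functions \<Theta> I j" and l: "0 \<le> l" "l \<le> 1"
  shows "(\<lambda>t. v t + l *\<^sub>R (u t - v t)) \<in> moduli_functions \<Theta> I j"
  unfolding moduli_functions_def mem_Collect_eq
proof (intro conjI ballI image_subsetI)
  note u = u[unfolded moduli_functions_def mem_Collect_eq] and v = v[unfolded moduli_functions_def mem_Collect_eq]
  have eq: "v t + l *\<^sub>R (u t - v t) = (1 - l) *\<^sub>R v t + l *\<^sub>R u t" for t by (simp add: algebra_simps)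
  show "continuous_on I (\<lambda>t. v t + l *\<^sub>R (u t - v t))"
    using u v by (intro continuous_intros) auto
  show "v t + l *\<^sub>R (u t - v t) \<in> cball 0 (real j)" if "t \<in> I" for t
    unfolding eq using u v l that by (intro convexD_alt[OF convex_cball]) auto
  fix s t assume st: "s \<in> I" "t \<in> I"
  have "v t + l *\<^sub>R (u t - v t) - (v s + l *\<^sub>R (u s - v s)) = (1 - l) *\<^sub>R (v t - v s) + l *\<^sub>R (u t - u s)"
    by (simp add: algebra_simps)
  also have "norm \<dots> \<le> (1 - l) * norm (v t - v s) + l * norm (u t - u s)"
    using l by (intro norm_triangle_le) simp
  also have "\<dots> \<le> (1 - l) * \<Theta> I j \<bar>t - s\<bar> + l * \<Theta> I j \<bar>t - s\<bar>"
    using u v st l by (intro add_mono mult_left_mono) auto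
  also have "\<dots> = \<Theta> I j \<bar>t - s\<bar>" by (simp add: algebra_simps)
  finally show "norm (v t + l *\<^sub>R (u t - v t) - (v s + l *\<^sub>R (u s - v s))) \<le> \<Theta> I j \<bar>t - s\<bar>" .
qed

lemma absolutely_integrable_matrix_vector_mult:
  fixes A :: "real \<Rightarrow> real^'n^'m"
  assumes "A absolutely_integrable_on {a..b}" and y: "continuous_on {a..b} y"
  shows "(\<lambda>t. A t *v y t) absolutely_integrable_on {a..b}"
proof (rule absolutely_integrable_bounded_measurable_product[where h="\<lambda>x A. A *v x" and f=y and g=A])
  show "bilinear (\<lambda>(x::real^'n) (A::real^'n^'m). A *v x)"
    unfolding bilinear_def
    by (auto intro!: linearI simp: matrix_vector_right_distrib matrix_vector_mult_add_rdistrib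
        matrix_vector_mult_scaleR scaleR_matrix_vector_assoc)
  show "y \<in> borel_measurable (lebesgue_on {a..b})"
    by (rule continuous_imp_measurable_on_sets_lebesgue[OF y]) simp
  show "bounded (y ` {a..b})"
    by (intro compact_imp_bounded compact_continuous_image y) simp
qed (use assms(1) in auto)

lemma remainder_absolutely_integrable:
  fixes f :: "real \<Rightarrow> real^'n \<Rightarrow> real^'m" and J :: "real \<Rightarrow> real^'n \<Rightarrow> real^'n^'m"
  assumes p: "1 \<le> p" and f: "cond_C1 f" "cond_C2 p f" and J: "cond_C1 J" "cond_C2 p J"
    and u: "u \<in> moduli_functions \<Theta> {q1..q2} j" and v: "v \<in> moduli_functions \<Theta> {q1..q2} j"
  shows "(\<lambda>t. f t (u t) - f t (v t) - J t (v t) *v (u t - v t)) absolutely_integrable_on {q1..q2}"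
  by (intro set_integral_diff(1) absolutely_integrable_matrix_vector_mult continuous_on_diff
      integrable_moduli_superposition(1)[OF p f u] integrable_moduli_superposition(1)[OF p f v]
      integrable_moduli_superposition(1)[OF p J v] moduli_functionsD(3)[OF u] moduli_functionsD(3)[OF v])

text \<open>
  The pointwise remainder estimate, integrated over \<open>t\<close>.  Tonelli's theorem exchanges the integrals over
  \<open>t\<close> and over the segment parameter \<open>l\<close>, which turns the estimate into one along the functions
  \<open>v + l (u - v)\<close> for fixed \<open>l\<close>.
\<close>

lemma integral_remainder_le:
  fixes f :: "real \<Rightarrow> real^'n \<Rightarrow> real^'n" and J :: "real \<Rightarrow> real^'n \<Rightarrow> real^'n^'n"
  assumes p: "1 \<le> p" and f: "cond_C1 f" "cond_C2 p f" and J: "cond_C1 J" "cond_C2 p J"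
    and diff: "continuously_differentiable_in_x f" and jac: "is_jacobian_x f J"
    and u: "u \<in> moduli_functions \<Theta> {q1..q2} j" and v: "v \<in> moduli_functions \<Theta> {q1..q2} j"
    and d: "0 \<le> d" "\<And>t. t \<in> {q1..q2} \<Longrightarrow> norm (u t - v t) \<le> d"
    and c: "0 \<le> c" "\<And>l. 0 \<le> l \<Longrightarrow> l \<le> 1 \<Longrightarrow>
      integral {q1..q2} (\<lambda>t. norm (J t (v t + l *\<^sub>R (u t - v t)) - J t (v t))) \<le> c"
  shows "integral {q1..q2} (\<lambda>t. norm (f t (u t) - f t (v t) - J t (v t) *v (u t - v t))) \<le> d * c"
proof -
  let ?I = "{q1..q2}"
  note w = moduli_functions_segment[OF u v]
  define R where "R t = f t (u t) - f t (v t) - J t (v t) *v (u t - v t)" for t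
  have iR: "R absolutely_integrable_on ?I"
    unfolding R_def by (rule remainder_absolutely_integrable[OF p f J u v])
  \<comment> \<open>Outside \<open>I\<close> nothing is known about \<open>u\<close> and \<open>v\<close>;
    cut off, they are Borel on the whole line, as Tonelli's theorem requires.\<close>
  define u' where "u' t = indicat_real ?I t *\<^sub>R u t" for t
  define v' where "v' t = indicat_real ?I t *\<^sub>R v t" for t
  have u'v': "u' t = u t" "v' t = v t" if "t \<in> ?I" for t using that by (auto simp: u'_def v'_def)
  have mu: "u' \<in> borel_measurable borel" and mv: "v' \<in> borel_measurable borel"
    using moduli_functionsD(1)[OF u] moduli_functionsD(1)[OF v]
    by (simp_all add: u'_def[abs_def] v'_def[abs_def] set_borel_measurable_def)
  define k where "k t l = ennreal (d * norm (J t (v' t + l *\<^sub>R (u' t - v' t)) - J t (v' t)))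
      * indicator ?I t * indicator {0..1} l" for t l :: real
  have mk: "(\<lambda>z. k (fst z) (snd z)) \<in> borel_measurable (lborel \<Otimes>\<^sub>M lborel)"
  proof -
    have fs: "fst \<in> borel_measurable (borel :: (real \<times> real) measure)"
      "snd \<in> borel_measurable (borel :: (real \<times> real) measure)"
      by (intro borel_measurable_continuous_onI continuous_intros)+
    have mu': "(\<lambda>z. u' (fst z)) \<in> borel_measurable (borel :: (real \<times> real) measure)"
      and mv': "(\<lambda>z. v' (fst z)) \<in> borel_measurable (borel :: (real \<times> real) measure)"
      by (rule measurable_compose[OF fs(1) mu] measurable_compose[OF fs(1) mv])+
    have JJ: "(\<lambda>z. J (fst z) (y z)) \<in> borel_measurable borel"
      if "y \<in> borel_measurable borel" for y :: "real \<times> real \<Rightarrow> real^'n"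
    proof -
      have "(\<lambda>z. (fst z, y z)) \<in> borel_measurable borel"
        by (rule borel_measurable_Pair[OF fs(1) that])
      from measurable_compose[OF this J(1)[unfolded cond_C1_def]] show ?thesis by simp
    qed
    have "(\<lambda>z. J (fst z) (v' (fst z) + snd z *\<^sub>R (u' (fst z) - v' (fst z)))) \<in> borel_measurable borel"
      by (intro JJ borel_measurable_add borel_measurable_scaleR borel_measurable_diff mu' mv' fs)
    note m1 = this and m2 = JJ[OF mv']
    have ind: "(indicator S :: real \<Rightarrow> ennreal) \<in> borel_measurable borel" if "S \<in> sets borel" for S
      using that by simp
    have m3: "(\<lambda>z::real \<times> real. indicator ?I (fst z) :: ennreal) \<in> borel_measurable borel"
      by (rule measurable_compose[OF fs(1) ind]) simp
    have m4: "(\<lambda>z::real \<times> real. indicator {0..1} (snd z) :: ennreal) \<in> borel_measurable borel"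
      by (rule measurable_compose[OF fs(2) ind]) simp
    have "(\<lambda>z. norm (J (fst z) (v' (fst z) + snd z *\<^sub>R (u' (fst z) - v' (fst z))) - J (fst z) (v' (fst z))))
        \<in> borel_measurable borel"
      by (rule measurable_compose[OF borel_measurable_diff[OF m1 m2] borel_measurable_norm])
    then have "(\<lambda>z. ennreal (d * norm (J (fst z) (v' (fst z) + snd z *\<^sub>R (u' (fst z) - v' (fst z))) - J (fst z) (v' (fst z)))))
        \<in> borel_measurable borel"
      by (intro measurable_compose[OF _ measurable_ennreal] borel_measurable_times borel_measurable_const)
    then have "(\<lambda>z. k (fst z) (snd z)) \<in> borel_measurable borel"
      unfolding k_def by (intro borel_measurable_times_ennreal m3 m4)
    then show ?thesis by (simp add: lborel_prod)
  qed
  have "ennreal (integral ?I (\<lambda>t. norm (R t))) = (\<integral>\<^sup>+t. ennreal (norm (R t)) * indicator ?I t \<partial>lebesgue)"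
    by (rule nn_integral_eq_integral_on[symmetric, OF set_integrable_norm[OF iR]]) simp
  also have "\<dots> \<le> (\<integral>\<^sup>+t. (\<integral>\<^sup>+l. k t l \<partial>lborel) \<partial>lebesgue)"
  proof (rule nn_integral_mono_AE)
    show "AE t in lebesgue. ennreal (norm (R t)) * indicator ?I t \<le> (\<integral>\<^sup>+l. k t l \<partial>lborel)"
      using diff[unfolded continuously_differentiable_in_x_def] jac[unfolded is_jacobian_x_def]
    proof eventually_elim
      case (elim t)
      show ?case
      proof (cases "t \<in> ?I")
        case True
        let ?n = "\<lambda>l. norm (J t (v t + l *\<^sub>R (u t - v t)) - J t (v t))"
        have cJ: "continuous_on UNIV (J t)" using elim by simp
        have cn: "continuous_on {0..1} ?n"
          by (intro continuous_intros continuous_on_compose2[OF cJ]) auto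
        have "norm (R t) \<le> norm (u t - v t) * integral {0..1} ?n"
          unfolding R_def using C1_remainder_le[of "f t" "u t" "v t"] elim by simp
        also have "\<dots> \<le> d * integral {0..1} ?n"
          using True by (intro mult_right_mono d integral_nonneg integrable_continuous_real cn) auto
        also have "\<dots> = integral {0..1} (\<lambda>l. d * ?n l)" by simp
        finally have "ennreal (norm (R t)) \<le> ennreal (integral {0..1} (\<lambda>l. d * ?n l))" by (rule ennreal_leI)
        also have "\<dots> = (\<integral>\<^sup>+l. ennreal (d * ?n l) * indicator {0..1} l \<partial>lebesgue)"
          by (rule nn_integral_eq_integral_on[symmetric])
            (intro absolutely_integrable_continuous_real continuous_intros cn, use d(1) in simp)
        also have "\<dots> = (\<integral>\<^sup>+l. k t l \<partial>lborel)"
          using True by (simp add: nn_integral_completion k_def u'v')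
        finally show ?thesis using True by simp
      qed simp
    qed
  qed
  also have "\<dots> = (\<integral>\<^sup>+t. (\<integral>\<^sup>+l. k t l \<partial>lborel) \<partial>lborel)" by (rule nn_integral_completion)
  also have "\<dots> = (\<integral>\<^sup>+l. (\<integral>\<^sup>+t. k t l \<partial>lborel) \<partial>lborel)"
    using lborel_pair.Fubini[OF mk] by simp
  also have "\<dots> \<le> (\<integral>\<^sup>+l. ennreal (d * c) * indicator {0..1} (l::real) \<partial>lborel)"
  proof (rule nn_integral_mono)
    fix l :: real
    show "(\<integral>\<^sup>+t. k t l \<partial>lborel) \<le> ennreal (d * c) * indicator {0..1} l"
    proof (cases "l \<in> {0..1}")
      case True
      let ?n = "\<lambda>t. norm (J t (v t + l *\<^sub>R (u t - v t)) - J t (v t))"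
      have i: "?n absolutely_integrable_on ?I"
        using True by (intro set_integrable_norm set_integral_diff(1) integrable_moduli_superposition(1)[OF p J w]
            integrable_moduli_superposition(1)[OF p J v]) auto
      have "(\<integral>\<^sup>+t. k t l \<partial>lborel) = (\<integral>\<^sup>+t. ennreal (d * ?n t) * indicator ?I t \<partial>lborel)"
        using True by (intro nn_integral_cong) (auto simp: k_def u'v' indicator_def)
      also have "\<dots> = (\<integral>\<^sup>+t. ennreal (d * ?n t) * indicator ?I t \<partial>lebesgue)"
        by (simp add: nn_integral_completion)
      also have "\<dots> = ennreal (integral ?I (\<lambda>t. d * ?n t))"
        using d(1) by (intro nn_integral_eq_integral_on set_integrable_mult_right impI i) auto
      also have "\<dots> \<le> ennreal (d * c)"
        using True d(1) c(2)[of l] by (intro ennreal_leI) (simp add: mult_left_mono)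
      finally show ?thesis using True by simp
    qed (simp add: k_def)
  qed
  also have "\<dots> = ennreal (d * c)" by (simp add: nn_integral_cmult_indicator)
  finally have "integral ?I (\<lambda>t. norm (R t)) \<le> d * c"
    using d(1) c(1) by (simp add: ennreal_le_iff)
  then show "integral ?I (\<lambda>t. norm (f t (u t) - f t (v t) - J t (v t) *v (u t - v t))) \<le> d * c"
    unfolding R_def .
qed

text \<open>
  Sequential continuity, turned into a modulus that is uniform over \<open>\<K>\<^sup>I\<^sub>j\<close>; this form applies to all
  \<open>v + l (u - v)\<close> with \<open>l \<in> [0, 1]\<close> at once.
\<close>

lemma Theta_C_L1_modulus:
  fixes G :: "real \<Rightarrow> 'a::euclidean_space \<Rightarrow> 'b::euclidean_space"
  assumes p: "1 \<le> p" and G: "G \<in> Theta_C \<Theta> p" and I: "{q1..q2} \<in> rat_intervals" "q1 \<le> q2"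
    and v: "v \<in> moduli_functions \<Theta> {q1..q2} j" and \<eta>: "0 < \<eta>"
  obtains \<delta> where "0 < \<delta>"
    "\<And>w. w \<in> moduli_functions \<Theta> {q1..q2} j \<Longrightarrow> (\<And>t. t \<in> {q1..q2} \<Longrightarrow> norm (w t - v t) \<le> \<delta>) \<Longrightarrow>
      integral {q1..q2} (\<lambda>t. norm (G t (w t) - G t (v t))) \<le> \<eta>"
proof (rule ccontr)
  let ?I = "{q1..q2}" and ?M = "moduli_functions \<Theta> {q1..q2} j"
  assume neg: "\<not> thesis"
  have GC: "cond_C1 G" "cond_C2 p G" using G by (simp_all add: Theta_C_def)
  have "\<exists>w. w \<in> ?M \<and> (\<forall>t\<in>?I. norm (w t - v t) \<le> inverse (real (Suc n))) \<and>
      \<eta> < integral ?I (\<lambda>t. norm (G t (w t) - G t (v t)))" for n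
  proof (rule ccontr)
    assume no: "\<not> ?thesis"
    have thesis
    proof (rule that[of "inverse (real (Suc n))"])
      fix w assume "w \<in> ?M" "\<And>t. t \<in> ?I \<Longrightarrow> norm (w t - v t) \<le> inverse (real (Suc n))"
      then show "integral ?I (\<lambda>t. norm (G t (w t) - G t (v t))) \<le> \<eta>"
        using no[unfolded not_ex, THEN spec, of w] by (simp add: not_less del: of_nat_Suc)
    qed simp
    with neg show False by contradiction
  qed
  then have "\<exists>ws. \<forall>n. ws n \<in> ?M \<and> (\<forall>t\<in>?I. norm (ws n t - v t) \<le> inverse (real (Suc n))) \<and>
      \<eta> < integral ?I (\<lambda>t. norm (G t (ws n t) - G t (v t)))" by (intro choice allI)
  then obtain ws where ws': "\<forall>n. ws n \<in> ?M \<and> (\<forall>t\<in>?I. norm (ws n t - v t) \<le> inverse (real (Suc n))) \<and>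
      \<eta> < integral ?I (\<lambda>t. norm (G t (ws n t) - G t (v t)))" by (elim exE) (rule that)
  have ws: "ws n \<in> ?M" "t \<in> ?I \<Longrightarrow> norm (ws n t - v t) \<le> inverse (real (Suc n))"
    "\<eta> < integral ?I (\<lambda>t. norm (G t (ws n t) - G t (v t)))" for n t
    using ws'[THEN spec, of n] by blast+
  have "uniform_limit ?I ws v sequentially"
  proof (rule uniform_limitI)
    fix e :: real assume "0 < e"
    then have "\<forall>\<^sub>F n in sequentially. inverse (real (Suc n)) < e"
      using LIMSEQ_inverse_real_of_nat by (rule order_tendstoD(2)[rotated])
    then show "\<forall>\<^sub>F n in sequentially. \<forall>t\<in>?I. dist (ws n t) (v t) < e"
      by eventually_elim (unfold dist_norm, intro ballI le_less_trans[OF ws(2)])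
  qed
  then have lim: "(\<lambda>n::nat. LINT t:?I|lebesgue. norm (G t (ws n t) - G t (v t)) powr p) \<longlonglongrightarrow> 0"
    using G[unfolded Theta_C_def mem_Collect_eq, THEN conjunct2, THEN conjunct2, rule_format, OF I(1) ws(1) v]
    by simp
  obtain \<sigma> where \<sigma>: "0 < \<sigma>"
    "\<And>h :: real \<Rightarrow> 'b. h absolutely_integrable_on ?I \<Longrightarrow>
      (\<lambda>t. norm (h t) powr p) absolutely_integrable_on ?I \<Longrightarrow>
      integral ?I (\<lambda>t. norm (h t) powr p) \<le> \<sigma> \<Longrightarrow> integral ?I (\<lambda>t. norm (h t)) \<le> \<eta>"
    by (rule Lp_small_imp_L1_small[OF p \<eta> I(2), where ?'a='b]) blast
  obtain n where n: "(LINT t:?I|lebesgue. norm (G t (ws n t) - G t (v t)) powr p) < \<sigma>"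
    using order_tendstoD(2)[OF lim \<sigma>(1)] unfolding eventually_sequentially by blast
  have i1: "(\<lambda>t. G t (ws n t) - G t (v t)) absolutely_integrable_on ?I"
    by (intro set_integral_diff(1) integrable_moduli_superposition(1)[OF p GC ws(1)]
        integrable_moduli_superposition(1)[OF p GC v])
  have i2: "(\<lambda>t. norm (G t (ws n t) - G t (v t)) powr p) absolutely_integrable_on ?I"
    by (intro absolutely_integrable_norm_diff_powr[OF p] integrable_moduli_superposition[OF p GC ws(1)] integrable_moduli_superposition[OF p GC v])
  have "integral ?I (\<lambda>t. norm (G t (ws n t) - G t (v t))) \<le> \<eta>"
    using n set_lebesgue_integral_eq_integral(2)[OF i2] by (intro \<sigma>(2) i1 i2) simp
  with ws(3)[of n] show False by simp
qed

text \<open>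
  The heart of the proof: \<open>g\<close> is differentiable in an \<open>L\<^sup>1\<close> sense along \<open>v\<close>, with derivative \<open>G\<close>.
  For \<open>(f, J)\<close> close to \<open>(g, G)\<close> the remainder is controlled by the oscillation of \<open>J\<close> along the segment,
  hence by that of \<open>G\<close> up to errors that vanish with \<open>\<tau>\<close>.  The pair \<open>(f, J)\<close> is chosen after \<open>u\<close> and \<open>d\<close>,
  so these errors, even those without a factor \<open>d\<close>, disappear altogether.
\<close>

lemma linearization_remainder:
  fixes g :: "real \<Rightarrow> real^'n \<Rightarrow> real^'n" and G :: "real \<Rightarrow> real^'n \<Rightarrow> real^'n^'n"
  assumes p: "1 \<le> p" and g: "cond_C1 g" "cond_C2 p g" and G: "G \<in> Theta_C \<Theta> p"
    and I: "{q1..q2} \<in> rat_intervals" "q1 \<le> q2"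
    and approx: "\<And>\<tau>. 0 < \<tau> \<Longrightarrow> \<exists>f J. (cond_C1 f \<and> cond_C2 p f \<and> cond_C1 J \<and> cond_C2 p J \<and>
      continuously_differentiable_in_x f \<and> is_jacobian_x f J) \<and>
      (\<forall>x\<in>moduli_functions \<Theta> {q1..q2} j. integral {q1..q2} (\<lambda>t. norm (f t (x t) - g t (x t))) \<le> \<tau>) \<and>
      (\<forall>x\<in>moduli_functions \<Theta> {q1..q2} j. integral {q1..q2} (\<lambda>t. norm (J t (x t) - G t (x t))) \<le> \<tau>)"
    and v: "v \<in> moduli_functions \<Theta> {q1..q2} j" and \<eta>: "0 < \<eta>"
  shows "\<exists>\<delta>>0. \<forall>u\<in>moduli_functions \<Theta> {q1..q2} j. \<forall>d. 0 \<le> d \<and> d \<le> \<delta> \<and> (\<forall>t\<in>{q1..q2}. norm (u t - v t) \<le> d) \<longrightarrow>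
    integral {q1..q2} (\<lambda>t. norm (g t (u t) - g t (v t) - G t (v t) *v (u t - v t))) \<le> d * \<eta>"
proof -
  let ?I = "{q1..q2}" and ?M = "moduli_functions \<Theta> {q1..q2} j"
  have GC: "cond_C1 G" "cond_C2 p G" using G by (simp_all add: Theta_C_def)
  obtain \<delta> where \<delta>: "0 < \<delta>"
    "\<And>w. w \<in> ?M \<Longrightarrow> (\<And>t. t \<in> ?I \<Longrightarrow> norm (w t - v t) \<le> \<delta>) \<Longrightarrow>
      integral ?I (\<lambda>t. norm (G t (w t) - G t (v t))) \<le> \<eta>"
    by (rule Theta_C_L1_modulus[OF p G I v \<eta>]) blast
  show ?thesis
  proof (rule exI[of _ \<delta>], intro conjI \<delta>(1) ballI allI impI, rule field_le_epsilon)
    fix u d and e :: real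
    assume u: "u \<in> ?M" and "0 \<le> d \<and> d \<le> \<delta> \<and> (\<forall>t\<in>?I. norm (u t - v t) \<le> d)" and e: "0 < e"
    then have d: "0 \<le> d" "d \<le> \<delta>" "t \<in> ?I \<Longrightarrow> norm (u t - v t) \<le> d" for t by simp_all
    \<comment> \<open>The errors add up to \<open>2 \<tau>\<close> from \<open>f - g\<close> along
      \<open>u\<close> and \<open>v\<close>, \<open>d \<tau>\<close> from \<open>J - G\<close> along
      \<open>v\<close>, and \<open>2 d \<tau>\<close> from the oscillation of \<open>J\<close>.\<close>
    define \<tau> where "\<tau> = e / (2 + 3 * d)"
    have \<tau>: "0 < \<tau>" "(2 + 3 * d) * \<tau> = e" using e d(1) by (simp_all add: \<tau>_def)
    from approx[OF \<tau>(1)] obtain f J where f: "cond_C1 f" "cond_C2 p f" and J: "cond_C1 J" "cond_C2 p J"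
      and diff: "continuously_differentiable_in_x f" "is_jacobian_x f J"
      and fg: "\<forall>x\<in>?M. integral ?I (\<lambda>t. norm (f t (x t) - g t (x t))) \<le> \<tau>"
      and JG: "\<forall>x\<in>?M. integral ?I (\<lambda>t. norm (J t (x t) - G t (x t))) \<le> \<tau>"
      by (elim exE conjE) (rule that)
    note int = set_lebesgue_integral_eq_integral(1)
    have ifg: "(\<lambda>t. norm (f t (x t) - g t (x t))) integrable_on ?I" if "x \<in> ?M" for x
      using integrable_moduli_superposition(1)[OF p f that] integrable_moduli_superposition(1)[OF p g that]
      by (intro int set_integrable_norm set_integral_diff(1))
    have iJG: "(\<lambda>t. norm (J t (x t) - G t (x t))) integrable_on ?I" if "x \<in> ?M" for x
      using integrable_moduli_superposition(1)[OF p J that] integrable_moduli_superposition(1)[OF p GC that]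
      by (intro int set_integrable_norm set_integral_diff(1))
    have c: "integral ?I (\<lambda>t. norm (J t (v t + l *\<^sub>R (u t - v t)) - J t (v t))) \<le> 2 * \<tau> + \<eta>"
      if l: "0 \<le> l" "l \<le> 1" for l
    proof -
      define w where "w t = v t + l *\<^sub>R (u t - v t)" for t
      have w: "w \<in> ?M" unfolding w_def by (rule moduli_functions_segment[OF u v l])
      have "norm (w t - v t) \<le> \<delta>" if "t \<in> ?I" for t
      proof -
        have "norm (w t - v t) = l * norm (u t - v t)" using l by (simp add: w_def)
        also have "\<dots> \<le> 1 * norm (u t - v t)" using l by (intro mult_right_mono) auto
        finally show ?thesis using d(2) d(3)[OF that] by simp
      qed
      then have Gw: "integral ?I (\<lambda>t. norm (G t (w t) - G t (v t))) \<le> \<eta>" by (rule \<delta>(2)[OF w])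
      have iG: "(\<lambda>t. norm (G t (w t) - G t (v t))) integrable_on ?I"
        using integrable_moduli_superposition(1)[OF p GC w] integrable_moduli_superposition(1)[OF p GC v]
        by (intro int set_integrable_norm set_integral_diff(1))
      have iJ: "(\<lambda>t. norm (J t (w t) - J t (v t))) integrable_on ?I"
        using integrable_moduli_superposition(1)[OF p J w] integrable_moduli_superposition(1)[OF p J v]
        by (intro int set_integrable_norm set_integral_diff(1))
      have "integral ?I (\<lambda>t. norm (J t (w t) - J t (v t)))
          \<le> integral ?I (\<lambda>t. norm (J t (w t) - G t (w t)) + norm (J t (v t) - G t (v t)) + norm (G t (w t) - G t (v t)))"
      proof (intro integral_le iJ integrable_add iJG[OF w] iJG[OF v] iG)
        fix t
        have "norm (J t (w t) - J t (v t))
            = norm ((J t (w t) - G t (w t)) - (J t (v t) - G t (v t)) + (G t (w t) - G t (v t)))" by simp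
        also have "\<dots> \<le> norm (J t (w t) - G t (w t)) + norm (J t (v t) - G t (v t)) + norm (G t (w t) - G t (v t))"
          by (intro order_trans[OF norm_triangle_ineq] add_right_mono norm_triangle_ineq4)
        finally show "norm (J t (w t) - J t (v t))
            \<le> norm (J t (w t) - G t (w t)) + norm (J t (v t) - G t (v t)) + norm (G t (w t) - G t (v t))" .
      qed
      also have "\<dots> = integral ?I (\<lambda>t. norm (J t (w t) - G t (w t))) + integral ?I (\<lambda>t. norm (J t (v t) - G t (v t)))
          + integral ?I (\<lambda>t. norm (G t (w t) - G t (v t)))"
        by (simp add: integral_add integrable_add iJG[OF w] iJG[OF v] iG)
      also have "\<dots> \<le> \<tau> + \<tau> + \<eta>"
        using JG w v Gw by (intro add_mono) simp_all
      finally show ?thesis by (simp add: w_def)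
    qed
    have Rf: "integral ?I (\<lambda>t. norm (f t (u t) - f t (v t) - J t (v t) *v (u t - v t))) \<le> d * (2 * \<tau> + \<eta>)"
      using \<tau>(1) \<eta> by (intro integral_remainder_le[OF p f J diff u v d(1,3) _ c]) simp_all
    have iRf: "(\<lambda>t. norm (f t (u t) - f t (v t) - J t (v t) *v (u t - v t))) integrable_on ?I"
      by (intro int set_integrable_norm remainder_absolutely_integrable[OF p f J u v])
    have iRg: "(\<lambda>t. norm (g t (u t) - g t (v t) - G t (v t) *v (u t - v t))) integrable_on ?I"
      by (intro int set_integrable_norm remainder_absolutely_integrable[OF p g GC u v])
    have "integral ?I (\<lambda>t. norm (g t (u t) - g t (v t) - G t (v t) *v (u t - v t)))
        \<le> integral ?I (\<lambda>t. norm (f t (u t) - g t (u t)) + norm (f t (v t) - g t (v t))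
            + d * norm (J t (v t) - G t (v t)) + norm (f t (u t) - f t (v t) - J t (v t) *v (u t - v t)))"
    proof (intro integral_le iRg integrable_add ifg[OF u] ifg[OF v] integrable_on_mult_right iJG[OF v] iRf)
      fix t assume t: "t \<in> ?I"
      let ?e1 = "f t (u t) - g t (u t)" and ?e2 = "f t (v t) - g t (v t)"
        and ?e3 = "(J t (v t) - G t (v t)) *v (u t - v t)" and ?e4 = "f t (u t) - f t (v t) - J t (v t) *v (u t - v t)"
      have "g t (u t) - g t (v t) - G t (v t) *v (u t - v t) = - ?e1 + ?e2 + ?e3 + ?e4"
        by (simp add: matrix_vector_mult_diff_rdistrib)
      moreover have "norm (- ?e1 + ?e2 + ?e3 + ?e4) \<le> norm (- ?e1) + norm ?e2 + norm ?e3 + norm ?e4"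
        by (intro norm_triangle_le add_mono order_refl)
      moreover have "norm ?e3 \<le> norm (J t (v t) - G t (v t)) * norm (u t - v t)"
        by (rule norm_matrix_vector_mult_le)
      moreover have "norm (J t (v t) - G t (v t)) * norm (u t - v t) \<le> norm (J t (v t) - G t (v t)) * d"
        by (intro mult_left_mono d(3)[OF t]) simp
      ultimately show "norm (g t (u t) - g t (v t) - G t (v t) *v (u t - v t))
          \<le> norm ?e1 + norm ?e2 + d * norm (J t (v t) - G t (v t)) + norm ?e4"
        by (simp only: norm_minus_cancel mult.commute[of d])
    qed
    also have "\<dots> = integral ?I (\<lambda>t. norm (f t (u t) - g t (u t))) + integral ?I (\<lambda>t. norm (f t (v t) - g t (v t)))
        + d * integral ?I (\<lambda>t. norm (J t (v t) - G t (v t)))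
        + integral ?I (\<lambda>t. norm (f t (u t) - f t (v t) - J t (v t) *v (u t - v t)))"
      by (simp add: integral_add integrable_add integrable_on_mult_right ifg[OF u] ifg[OF v] iJG[OF v] iRf)
    also have "\<dots> \<le> \<tau> + \<tau> + d * \<tau> + d * (2 * \<tau> + \<eta>)"
      using fg JG u v Rf d(1) by (intro add_mono mult_left_mono) simp_all
    also have "\<dots> = d * \<eta> + (2 + 3 * d) * \<tau>" by (simp add: algebra_simps)
    also have "\<dots> = d * \<eta> + e" by (simp only: \<tau>(2))
    finally show "integral ?I (\<lambda>t. norm (g t (u t) - g t (v t) - G t (v t) *v (u t - v t))) \<le> d * \<eta> + e" .
  qed
qed

section \<open>Perturbed solutions and the linearized equation\<close>

lemma LC_imp_L1_locally_lipschitz_on: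
  assumes p: "1 \<le> p" and g: "g \<in> LC p"
  shows "L1_locally_lipschitz_on {a..b} g"
  unfolding L1_locally_lipschitz_on_def
proof (intro allI impI)
  fix K :: "'a set" assume "compact K"
  from LC_lipschitz[OF g this] obtain l where l: "l \<in> Lp_loc p"
    "AE t in lebesgue. \<forall>x\<in>K. \<forall>y\<in>K. norm (g t x - g t y) \<le> l t * norm (x - y)" .
  have "AE t in lebesgue. t \<in> {a..b} \<longrightarrow> (\<forall>x\<in>K. \<forall>y\<in>K. norm (g t x - g t y) \<le> l t * norm (x - y))"
    using l(2) by eventually_elim simp
  with Lp_loc_absolutely_integrable[OF p l(1)]
  show "\<exists>l. l absolutely_integrable_on {a..b} \<and>
      (AE t in lebesgue. t \<in> {a..b} \<longrightarrow> (\<forall>x\<in>K. \<forall>y\<in>K. norm (g t x - g t y) \<le> l t * norm (x - y)))"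
    by (intro exI[of _ l] conjI)
qed

text \<open>
  Composing \<open>g\<close> with the projection onto a ball makes it globally Lipschitz without leaving the class of
  fields with integrable bounds, so perturbed solutions exist on the whole interval.  By Gronwall's
  inequality they stay within distance \<open>1\<close> of \<open>x\<close>, where the projection is the identity.
\<close>

lemma nearby_solutions:
  fixes g :: "real \<Rightarrow> 'a::euclidean_space \<Rightarrow> 'a"
  assumes p: "1 \<le> p" and g: "g \<in> LC p" and ab: "a \<le> 0" "0 \<le> b"
    and x: "caratheodory_solution g x0 {a..b} x" and r: "x ` {a..b} \<subseteq> cball 0 r"
  obtains C where "0 \<le> C"
    "\<And>x1. C * norm (x1 - x0) \<le> 1 \<Longrightarrow> \<exists>y. caratheodory_solution g x1 {a..b} y \<and>
      y ` {a..b} \<subseteq> cball 0 (r + 1) \<and> (\<forall>t\<in>{a..b}. norm (y t - x t) \<le> C * norm (x1 - x0))"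
proof -
  let ?K = "cball (0::'a) (r + 1)"
  define \<pi> where "\<pi> = closest_point ?K"
  have "x 0 \<in> x ` {a..b}" by (rule imageI) (use ab in simp)
  then have "norm (x 0) \<le> r" using r by auto
  then have "0 \<le> r" using norm_ge_zero[of "x 0"] by linarith
  then have K0: "?K \<noteq> {}" by simp
  have K: "convex ?K" "closed ?K" by simp_all
  have \<pi>K: "\<pi> z \<in> ?K" for z unfolding \<pi>_def by (rule closest_point_in_set[OF K(2) K0])
  have \<pi>_self: "\<pi> z = z" if "z \<in> ?K" for z unfolding \<pi>_def using that by (rule closest_point_self)
  have \<pi>_lip: "norm (\<pi> y - \<pi> z) \<le> norm (y - z)" for y z
    using closest_point_lipschitz[OF K K0, of y z] by (simp add: \<pi>_def dist_norm)
  define F where "F t z = g t (\<pi> z)" for t z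
  from LC_lipschitz[OF g compact_cball] obtain l where l: "l \<in> Lp_loc p"
    "AE t in lebesgue. \<forall>x\<in>?K. \<forall>y\<in>?K. norm (g t x - g t y) \<le> l t * norm (x - y)" .
  have li: "(\<lambda>t. \<bar>l t\<bar>) absolutely_integrable_on {a..b}"
    by (rule set_integrable_abs[OF Lp_loc_absolutely_integrable[OF p l(1)]])
  have lip: "AE t in lebesgue. t \<in> {a..b} \<longrightarrow> (\<forall>y z. norm (F t y - F t z) \<le> \<bar>l t\<bar> * norm (y - z))"
    using l(2)
  proof eventually_elim
    case (elim t)
    have "norm (F t y - F t z) \<le> \<bar>l t\<bar> * norm (y - z)" for y z
    proof -
      have "norm (F t y - F t z) \<le> l t * norm (\<pi> y - \<pi> z)" using elim \<pi>K by (simp add: F_def)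
      also have "\<dots> \<le> \<bar>l t\<bar> * norm (\<pi> y - \<pi> z)" by (intro mult_right_mono) auto
      also have "\<dots> \<le> \<bar>l t\<bar> * norm (y - z)" by (intro mult_left_mono \<pi>_lip) auto
      finally show ?thesis .
    qed
    then show ?case by blast
  qed
  have int: "(\<lambda>t. F t (y t)) absolutely_integrable_on {a..b}" if y: "continuous_on {a..b} y" for y
  proof -
    have c: "continuous_on {a..b} (\<lambda>t. \<pi> (y t))"
      unfolding \<pi>_def by (rule continuous_on_compose2[OF continuous_on_closest_point[OF K K0, of UNIV] y]) simp
    show ?thesis
      unfolding F_def
    proof (rule superposition_absolutely_integrable(1)[where f=g and y="\<lambda>t. \<pi> (y t)", OF p _ _ _ _ compact_cball[of 0 "r + 1"]])
      show "cond_C1 g" "cond_C2 p g" using g by (simp_all add: LC_def)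
      show "set_borel_measurable borel {a..b} (\<lambda>t. \<pi> (y t))" by (rule set_measurable_continuous_on[OF _ c]) simp
      show "(\<lambda>t. \<pi> (y t)) ` {a..b} \<subseteq> ?K" using \<pi>K by blast
    qed
  qed
  have rK: "cball (0::'a) r \<subseteq> ?K" by (intro subset_cball) simp
  have xF: "caratheodory_solution F x0 {a..b} x"
  proof (rule caratheodory_solution_cong[OF ab x])
    fix t assume "t \<in> {a..b}"
    then have "x t \<in> ?K" using r rK by blast
    then show "g t (x t) = F t (x t)" by (simp add: F_def \<pi>_self)
  qed simp
  have "AE t in lebesgue. t \<in> {a..b} \<longrightarrow> (\<forall>y\<in>UNIV. \<forall>z\<in>UNIV. norm (F t y - F t z) \<le> \<bar>l t\<bar> * norm (y - z))"
    using lip by simp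
  then obtain C where C: "0 \<le> C"
    "\<And>x0 y0 x y t. \<lbrakk>caratheodory_solution F x0 {a..b} x; caratheodory_solution F y0 {a..b} y;
      x ` {a..b} \<subseteq> UNIV; y ` {a..b} \<subseteq> UNIV; t \<in> {a..b}\<rbrakk> \<Longrightarrow> norm (x t - y t) \<le> C * norm (x0 - y0)"
    by (rule caratheodory_solution_dist[OF ab li abs_ge_zero]) blast
  show thesis
  proof (rule that[OF C(1)])
    fix x1 assume x1: "C * norm (x1 - x0) \<le> 1"
    obtain y where y: "caratheodory_solution F x1 {a..b} y"
      by (rule caratheodory_global_existence[OF ab li abs_ge_zero lip int])
    have dist: "norm (y t - x t) \<le> C * norm (x1 - x0)" if "t \<in> {a..b}" for t
      using that by (intro C(2)[OF y xF]) auto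
    have yK: "y t \<in> ?K" if t: "t \<in> {a..b}" for t
    proof -
      have "norm (x t) \<le> r" using r t by (auto simp: image_subset_iff)
      moreover have "norm (y t) \<le> norm (x t) + norm (y t - x t)" by (metis add.commute norm_triangle_sub)
      ultimately show ?thesis using dist[OF t] x1 by simp
    qed
    have "caratheodory_solution g x1 {a..b} y"
      by (rule caratheodory_solution_cong[OF ab y]) (simp_all only: F_def \<pi>_self[OF yK])
    then show "\<exists>y. caratheodory_solution g x1 {a..b} y \<and> y ` {a..b} \<subseteq> ?K \<and>
        (\<forall>t\<in>{a..b}. norm (y t - x t) \<le> C * norm (x1 - x0))"
      using yK dist by (intro exI[of _ y] conjI image_subsetI ballI)
  qed
qed

lemma linear_equation:
  fixes A :: "real \<Rightarrow> real^'n^'n"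
  assumes ab: "a \<le> 0" "0 \<le> b" and A: "A absolutely_integrable_on {a..b}"
  shows "\<exists>y. caratheodory_solution (\<lambda>t y. A t *v y) y0 {a..b} y"
    and "L1_locally_lipschitz_on {a..b} (\<lambda>t y. A t *v y)"
proof -
  have nA: "(\<lambda>t. norm (A t)) absolutely_integrable_on {a..b}" by (rule set_integrable_norm[OF A])
  have lip: "norm (A t *v x - A t *v y) \<le> norm (A t) * norm (x - y)" for t x y
    using norm_matrix_vector_mult_le[of "A t" "x - y"] by (simp add: matrix_vector_mult_diff_distrib)
  show "L1_locally_lipschitz_on {a..b} (\<lambda>t y. A t *v y)"
    unfolding L1_locally_lipschitz_on_def
    by (intro allI impI exI[of _ "\<lambda>t. norm (A t)"] conjI nA AE_I2 ballI lip)
  obtain y where "caratheodory_solution (\<lambda>t y. A t *v y) y0 {a..b} y"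
    by (rule caratheodory_global_existence[OF ab nA norm_ge_zero, of "\<lambda>t y. A t *v y" y0])
      (auto simp: lip intro: absolutely_integrable_matrix_vector_mult[OF A])
  then show "\<exists>y. caratheodory_solution (\<lambda>t y. A t *v y) y0 {a..b} y" by (rule exI[of _ y])
qed

text \<open>
  The error \<open>w = u - x - \<epsilon> y\<close> solves \<open>w' = A w + R\<close> with \<open>w 0 = 0\<close>, where \<open>R\<close> is the linearization remainder;
  Gronwall's inequality bounds it by the integral of \<open>norm R\<close>.
\<close>

lemma linearization_error_le:
  fixes A :: "real \<Rightarrow> real^'n^'n" and g :: "real \<Rightarrow> real^'n \<Rightarrow> real^'n"
  assumes ab: "a \<le> 0" "0 \<le> b" and A: "A absolutely_integrable_on {a..b}"
  obtains C where "0 \<le> C"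
    "\<And>u x y \<epsilon> x0 y0 \<rho> t. \<lbrakk>caratheodory_solution g (x0 + \<epsilon> *\<^sub>R y0) {a..b} u; caratheodory_solution g x0 {a..b} x;
      caratheodory_solution (\<lambda>t y. A t *v y) y0 {a..b} y;
      integral {a..b} (\<lambda>t. norm (g t (u t) - g t (x t) - A t *v (u t - x t))) \<le> \<rho>; t \<in> {a..b}\<rbrakk>
      \<Longrightarrow> norm (u t - x t - \<epsilon> *\<^sub>R y t) \<le> C * \<rho>"
proof -
  have nA: "(\<lambda>t. norm (A t)) absolutely_integrable_on {a..b}" by (rule set_integrable_norm[OF A])
  obtain C where C: "0 \<le> C"
    "\<And>u c t. \<lbrakk>continuous_on {a..b} u; \<And>t. t \<in> {a..b} \<Longrightarrow> 0 \<le> u t;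
      \<And>t. t \<in> {a..b} \<Longrightarrow> u t \<le> c + integral {min 0 t..max 0 t} (\<lambda>s. norm (A s) * u s); t \<in> {a..b}\<rbrakk>
      \<Longrightarrow> u t \<le> C * c"
    by (rule gronwall_two_sided[OF ab nA norm_ge_zero]) blast
  show thesis
  proof (rule that[OF C(1)])
    fix u x y \<epsilon> x0 y0 \<rho> t
    assume u: "caratheodory_solution g (x0 + \<epsilon> *\<^sub>R y0) {a..b} u" and x: "caratheodory_solution g x0 {a..b} x"
      and y: "caratheodory_solution (\<lambda>t y. A t *v y) y0 {a..b} y"
      and \<rho>: "integral {a..b} (\<lambda>t. norm (g t (u t) - g t (x t) - A t *v (u t - x t))) \<le> \<rho>"
      and t: "t \<in> {a..b}"
    note u = u[unfolded caratheodory_solution_iff[OF ab]] and x = x[unfolded caratheodory_solution_iff[OF ab]]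
      and y = y[unfolded caratheodory_solution_iff[OF ab]]
    have cont: "continuous_on {a..b} u" "continuous_on {a..b} x" "continuous_on {a..b} y"
      using u x y by simp_all
    have iu: "(\<lambda>s. g s (u s)) absolutely_integrable_on {a..b}" and ix: "(\<lambda>s. g s (x s)) absolutely_integrable_on {a..b}"
      and iy: "(\<lambda>s. A s *v y s) absolutely_integrable_on {a..b}"
      using u x y by simp_all
    define w where "w s = u s - x s - \<epsilon> *\<^sub>R y s" for s
    define R where "R s = g s (u s) - g s (x s) - A s *v (u s - x s)" for s
    have cw: "continuous_on {a..b} w" unfolding w_def by (intro continuous_intros cont)
    have iR: "R absolutely_integrable_on {a..b}"
      unfolding R_def by (intro set_integral_diff(1) iu ix absolutely_integrable_matrix_vector_mult[OF A] continuous_intros cont)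
    define h where "h s = g s (u s) - g s (x s) - \<epsilon> *\<^sub>R (A s *v y s)" for s
    have i2: "(\<lambda>s. \<epsilon> *\<^sub>R (A s *v y s)) absolutely_integrable_on {a..b}"
      by (intro set_integrable_scaleR_right impI iy)
    have ih: "h absolutely_integrable_on {a..b}" unfolding h_def by (intro set_integral_diff(1) iu ix i2)
    have hR: "h s = R s + A s *v w s" for s
      by (simp add: h_def R_def w_def matrix_vector_mult_diff_distrib matrix_vector_mult_scaleR)
    \<comment> \<open>The initial values cancel: \<open>u\<close> starts at \<open>x0 + \<epsilon>
      y0\<close>, \<open>x\<close> at \<open>x0\<close> and \<open>\<epsilon> y\<close> at \<open>\<epsilon>
      y0\<close>.\<close>
    have weq: "w s = integral_from_0 a h s" if s: "s \<in> {a..b}" for s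
    proof -
      have sb: "s \<le> b" using s by simp
      have "integral_from_0 a h s = integral_from_0 a (\<lambda>s. g s (u s)) s - integral_from_0 a (\<lambda>s. g s (x s)) s
          - integral_from_0 a (\<lambda>s. \<epsilon> *\<^sub>R (A s *v y s)) s"
        unfolding h_def
        using integral_from_0_minus[OF set_integral_diff(1)[OF iu ix] i2 ab(2) sb]
          integral_from_0_minus[OF iu ix ab(2) sb] by simp
      also have "integral_from_0 a (\<lambda>s. \<epsilon> *\<^sub>R (A s *v y s)) s = \<epsilon> *\<^sub>R integral_from_0 a (\<lambda>s. A s *v y s) s"
        by (simp add: integral_from_0_def scaleR_diff_right)
      finally show ?thesis using u x y s by (simp add: w_def algebra_simps)
    qed
    have cn: "continuous_on {a..b} (\<lambda>s. norm (w s))" by (intro continuous_intros cw)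
    have iAw: "(\<lambda>s. norm (A s) * norm (w s)) absolutely_integrable_on {a..b}"
      by (rule absolutely_integrable_continuous_mult[OF nA cn])
    have "norm (w t) \<le> C * \<rho>"
    proof (rule C(2)[OF cn _ _ t])
      fix s assume s: "s \<in> {a..b}"
      have sub: "{min 0 s..max 0 s} \<subseteq> {a..b}" using s ab by auto
      note int = set_lebesgue_integral_eq_integral(1)
      have "norm (w s) \<le> integral {min 0 s..max 0 s} (\<lambda>s. norm (R s) + norm (A s) * norm (w s))"
        unfolding weq[OF s]
      proof (rule norm_integral_from_0_le[OF ih _ ab s])
        show "(\<lambda>s. norm (R s) + norm (A s) * norm (w s)) absolutely_integrable_on {a..b}"
          by (intro set_integral_add(1) set_integrable_norm iR iAw)
        have "norm (h s) \<le> norm (R s) + norm (A s) * norm (w s)" for s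
          unfolding hR by (intro norm_triangle_le add_left_mono norm_matrix_vector_mult_le)
        then show "AE s in lebesgue. s \<in> {a..b} \<longrightarrow> norm (h s) \<le> norm (R s) + norm (A s) * norm (w s)"
          by (intro AE_I2 impI)
      qed
      also have "\<dots> = integral {min 0 s..max 0 s} (\<lambda>s. norm (R s)) + integral {min 0 s..max 0 s} (\<lambda>s. norm (A s) * norm (w s))"
        by (intro integral_add integrable_on_subinterval[OF int[OF set_integrable_norm[OF iR]] sub]
            integrable_on_subinterval[OF int[OF iAw] sub])
      also have "integral {min 0 s..max 0 s} (\<lambda>s. norm (R s)) \<le> integral {a..b} (\<lambda>s. norm (R s))"
        by (intro integral_subset_le sub integrable_on_subinterval[OF int[OF set_integrable_norm[OF iR]] sub]
            int[OF set_integrable_norm[OF iR]]) auto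
      also have "\<dots> \<le> \<rho>" using \<rho> by (simp add: R_def)
      finally show "norm (w s) \<le> \<rho> + integral {min 0 s..max 0 s} (\<lambda>s. norm (A s) * norm (w s))" by simp
    qed simp
    then show "norm (u t - x t - \<epsilon> *\<^sub>R y t) \<le> C * \<rho>" by (simp add: w_def)
  qed
qed

section \<open>Differentiability with respect to the initial value\<close>

theorem theorem6p1:
  fixes p :: real
    and E1 :: "(real \<Rightarrow> real^'n \<Rightarrow> real^'n) set"
    and \<Theta> :: "real set \<Rightarrow> nat \<Rightarrow> real \<Rightarrow> real"
    and E :: "((real \<Rightarrow> real^'n \<Rightarrow> real^'n) \<times> (real \<Rightarrow> real^'n \<Rightarrow> real^'n^'n)) set"
    and g :: "real \<Rightarrow> real^'n \<Rightarrow> real^'n"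
    and G :: "real \<Rightarrow> real^'n \<Rightarrow> real^'n^'n"
    and x0 :: "real^'n"
    and T0 T1 :: real
  assumes "1 \<le> p"
    and "E1 \<subseteq> LC p"
    and "L1_loc_equicontinuous_m_bounds E1"
    and "\<forall>f\<in>E1. continuously_differentiable_in_x f"
    and "\<forall>f\<in>E1. \<exists>J\<in>SC p. is_jacobian_x f J"
    and "\<Theta> = m_bound_moduli E1"
    and "E = prod_topology (Theta_topology \<Theta> p (LC p)) (Theta_topology \<Theta> p (Theta_C \<Theta> p))
               closure_of {(f, J) | f J. f \<in> E1 \<and> J \<in> SC p \<and> is_jacobian_x f J}"
    and "(g, G) \<in> E"
    and "T0 \<le> T1"
    and "{T0..T1} \<subseteq> maximal_interval g x0"
  shows "(\<forall>y0\<in>cball 0 1. {T0..T1} \<subseteq> maximal_interval (linearized_field g G x0) y0)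
    \<and> (\<forall>\<^sub>F \<epsilon> in at_right 0. \<forall>y0\<in>cball 0 1. {T0..T1} \<subseteq> maximal_interval g (x0 + \<epsilon> *\<^sub>R y0))
    \<and> uniform_limit ({T0..T1} \<times> cball 0 1)
           (\<lambda>\<epsilon> (t, y0). norm ((sol g (x0 + \<epsilon> *\<^sub>R y0) t - sol g x0 t) /\<^sub>R \<epsilon>
                              - sol (linearized_field g G x0) y0 t))
           (\<lambda>_. 0) (at_right 0)"
proof -
  note p = assms(1) and E1 = assms(2) and equi = assms(3) and diff = assms(4)
  let ?A = "{(f, J) | f J. f \<in> E1 \<and> J \<in> SC p \<and> is_jacobian_x f J}"
  have gG: "(g, G) \<in> prod_topology (Theta_topology \<Theta> p (LC p)) (Theta_topology \<Theta> p (Theta_C \<Theta> p)) closure_of ?A"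
    using assms(7,8) by simp
  have g: "g \<in> LC p" and G: "G \<in> Theta_C \<Theta> p" by (rule Theta_closure_subset[OF gG])+
  have gC: "cond_C1 g" "cond_C2 p g" using g by (simp_all add: LC_def)
  have GC: "cond_C1 G" "cond_C2 p G" using G by (simp_all add: Theta_C_def)
  have E1_ne: "E1 \<noteq> {}"
  proof
    assume "E1 = {}"
    then have "?A = {}" by simp
    with gG have "(g, G) \<in> prod_topology (Theta_topology \<Theta> p (LC p)) (Theta_topology \<Theta> p (Theta_C \<Theta> p)) closure_of {}"
      by (simp only:)
    then show False by (simp only: closure_of_empty empty_iff)
  qed
  \<comment> \<open>An interval that contains both \<open>{T0..T1}\<close> and the initial time
    \<open>0\<close>.\<close>
  define a b where "a = min 0 T0" and "b = max 0 T1"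
  have ab: "a \<le> 0" "0 \<le> b" and T_sub: "{T0..T1} \<subseteq> {a..b}" by (auto simp: a_def b_def)
  obtain x where x: "caratheodory_solution g x0 {a..b} x"
    unfolding a_def b_def by (rule solution_on_maximal_subinterval[OF assms(9,10)])
  have cx: "continuous_on {a..b} x" using x by (simp add: caratheodory_solution_def)
  have "bounded (x ` {a..b})" by (intro compact_imp_bounded compact_continuous_image cx) simp
  then obtain r where "\<forall>y\<in>x ` {a..b}. norm y \<le> r" unfolding bounded_iff by (elim exE)
  then have r: "x ` {a..b} \<subseteq> cball 0 r" by (intro subsetI) (simp only: mem_cball_0)
  \<comment> \<open>The ball of radius \<open>j\<close> contains \<open>x\<close> with a margin of
    \<open>1\<close> for the perturbed solutions.\<close>
  define j where "j = nat \<lceil>r + 1\<rceil>"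
  have j: "r + 1 \<le> real j" unfolding j_def by linarith
  define q1 q2 where "q1 = real_of_int \<lfloor>a\<rfloor>" and "q2 = real_of_int \<lceil>b\<rceil>"
  have q: "q1 \<le> a" "b \<le> q2" "q1 \<le> q2"
    using ab unfolding q1_def q2_def by linarith+
  have I: "{q1..q2} \<in> rat_intervals"
    unfolding rat_intervals_def mem_Collect_eq using q(3)
    by (intro exI[of _ q1] exI[of _ q2]) (simp add: q1_def q2_def)
  have ab_sub: "{a..b} \<subseteq> {q1..q2}" using q by auto
  let ?I = "{q1..q2}" and ?M = "moduli_functions \<Theta> {q1..q2} j"
  have \<Theta>_nonneg: "0 \<le> \<Theta> ?I j s" if "0 \<le> s" for s
    unfolding assms(6) by (rule m_bound_moduli_nonneg[OF p E1 E1_ne equi q(3) that])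
  have approx: "\<exists>f J. f \<in> E1 \<and> (cond_C1 f \<and> cond_C2 p f \<and> cond_C1 J \<and> cond_C2 p J \<and>
      continuously_differentiable_in_x f \<and> is_jacobian_x f J) \<and>
      (\<forall>x\<in>?M. integral ?I (\<lambda>t. norm (f t (x t) - g t (x t))) \<le> \<tau>) \<and>
      (\<forall>x\<in>?M. integral ?I (\<lambda>t. norm (J t (x t) - G t (x t))) \<le> \<tau>)" if \<tau>: "0 < \<tau>" for \<tau>
  proof -
    obtain r where r: "0 < r" "\<And>(f :: real \<Rightarrow> real^'n \<Rightarrow> real^'n) (x :: real \<Rightarrow> real^'n). \<lbrakk>cond_C1 f; cond_C2 p f;
        Theta_seminorm \<Theta> p ?I j f < r; x \<in> ?M\<rbrakk> \<Longrightarrow> integral ?I (\<lambda>t. norm (f t (x t))) \<le> \<tau>"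
      by (rule L1_le_of_Theta_seminorm[OF p \<tau> q(3), where ?'a="real^'n" and ?'b="real^'n"]) blast
    obtain r' where r': "0 < r'" "\<And>(f :: real \<Rightarrow> real^'n \<Rightarrow> real^'n^'n) (x :: real \<Rightarrow> real^'n). \<lbrakk>cond_C1 f; cond_C2 p f;
        Theta_seminorm \<Theta> p ?I j f < r'; x \<in> ?M\<rbrakk> \<Longrightarrow> integral ?I (\<lambda>t. norm (f t (x t))) \<le> \<tau>"
      by (rule L1_le_of_Theta_seminorm[OF p \<tau> q(3), where ?'a="real^'n" and ?'b="real^'n^'n"]) blast
    from Theta_closure_approximation[OF gG I \<Theta>_nonneg r(1) r'(1)]
    obtain f J where fJ: "(f, J) \<in> ?A" "f \<in> LC p" "J \<in> Theta_C \<Theta> p"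
      "Theta_seminorm \<Theta> p ?I j (\<lambda>t x. f t x - g t x) < r"
      "Theta_seminorm \<Theta> p ?I j (\<lambda>t x. J t x - G t x) < r'" .
    have fE: "f \<in> E1" and jac: "is_jacobian_x f J" using fJ(1) by simp_all
    have fC: "cond_C1 f" "cond_C2 p f" using fJ(2) by (simp_all add: LC_def)
    have JC: "cond_C1 J" "cond_C2 p J" using fJ(3) by (simp_all add: Theta_C_def)
    show ?thesis
      by (intro exI[of _ f] exI[of _ J] conjI ballI fE jac fC JC diff[rule_format, OF fE]
          r(2)[OF cond_C1_diff[OF fC(1) gC(1)] cond_C2_diff[OF p fC(2) gC(2)] fJ(4)]
          r'(2)[OF cond_C1_diff[OF JC(1) GC(1)] cond_C2_diff[OF p JC(2) GC(2)] fJ(5)])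
  qed
  have approx_const: "\<exists>f\<in>E1. \<forall>v\<in>cball 0 (real j). integral ?I (\<lambda>t. norm (f t v - g t v)) \<le> \<tau>" if \<tau>: "0 < \<tau>" for \<tau>
  proof -
    from approx[OF \<tau>] obtain f where f: "f \<in> E1" "\<forall>x\<in>?M. integral ?I (\<lambda>t. norm (f t (x t) - g t (x t))) \<le> \<tau>"
      by (elim exE conjE) (rule that)
    show ?thesis
    proof (intro bexI[OF _ f(1)] ballI)
      fix v :: "real^'n" assume v: "v \<in> cball 0 (real j)"
      show "integral ?I (\<lambda>t. norm (f t v - g t v)) \<le> \<tau>"
        using bspec[OF f(2) const_in_moduli_functions[where \<Theta>=\<Theta> and I="?I", OF v \<Theta>_nonneg]] by simp
    qed
  qed
  have clamp: "(\<lambda>t. u (max a (min b t))) \<in> ?M"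
    if "caratheodory_solution g u0 {a..b} u" "u ` {a..b} \<subseteq> cball 0 (r + 1)" for u u0
  proof -
    have "u ` {a..b} \<subseteq> cball 0 (real j)" using that(2) j subset_cball[of "r + 1" "real j" "0::real^'n"] by blast
    from clamped_solution_in_moduli_functions[OF p g E1 equi approx_const ab ab_sub that(1) this]
    show ?thesis by (simp only: assms(6))
  qed
  \<comment> \<open>The extension of \<open>x\<close> to the rational interval; \<open>w\<close> below is
    that of \<open>u\<close>.\<close>
  define v where "v t = x (max a (min b t))" for t
  have "x ` {a..b} \<subseteq> cball 0 (r + 1)" using r subset_cball[of r "r + 1" "0::real^'n"] by (meson le_add_same_cancel1 order_trans zero_le_one)
  from clamp[OF x this] have v: "v \<in> ?M" unfolding v_def .
  have lip_g: "L1_locally_lipschitz_on {a..b} g" by (rule LC_imp_L1_locally_lipschitz_on[OF p g])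
  have sol_x: "sol g x0 t = x t" if "t \<in> {a..b}" for t by (rule sol_eq[OF ab lip_g x that])
  define A where "A t = G t (sol g x0 t)" for t
  have A: "A absolutely_integrable_on {a..b}"
  proof (rule absolutely_integrable_spike[where f="\<lambda>t. G t (x t)" and S="{}"])
    show "(\<lambda>t. G t (x t)) absolutely_integrable_on {a..b}"
      by (rule superposition_absolutely_integrable(1)[where f=G and y=x, OF p GC set_measurable_continuous_on[OF _ cx] r compact_cball]) simp
  qed (simp_all add: A_def sol_x)
  have lin: "linearized_field g G x0 = (\<lambda>t y. A t *v y)" by (simp add: linearized_field_def A_def fun_eq_iff)
  have "\<forall>y0. \<exists>y. caratheodory_solution (\<lambda>t y. A t *v y) y0 {a..b} y"
    using linear_equation(1)[OF ab A] by (rule allI)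
  from choice[OF this] obtain Y where Y: "\<forall>y0. caratheodory_solution (\<lambda>t y. A t *v y) y0 {a..b} (Y y0)"
    by (elim exE) (rule that)
  have sol_Y: "sol (linearized_field g G x0) y0 t = Y y0 t" if "t \<in> {a..b}" for y0 t
    unfolding lin by (rule sol_eq[OF ab linear_equation(2)[OF ab A] Y[THEN spec] that])
  have maxI: "{T0..T1} \<subseteq> maximal_interval F z" if "caratheodory_solution F z {a..b} y"
    for F :: "real \<Rightarrow> real^'n \<Rightarrow> real^'n" and z y
  proof -
    have "{a..b} \<in> {J. \<exists>x. caratheodory_solution F z J x}" using that by (intro CollectI exI[of _ y])
    then have "{a..b} \<subseteq> maximal_interval F z" unfolding maximal_interval_def by (rule Union_upper)
    with T_sub show ?thesis by (rule subset_trans)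
  qed
  obtain C where C: "0 \<le> C" "\<And>x1. C * norm (x1 - x0) \<le> 1 \<Longrightarrow> \<exists>y. caratheodory_solution g x1 {a..b} y \<and>
      y ` {a..b} \<subseteq> cball 0 (r + 1) \<and> (\<forall>t\<in>{a..b}. norm (y t - x t) \<le> C * norm (x1 - x0))"
    by (rule nearby_solutions[OF p g ab x r]) blast
  have near: "\<exists>u. caratheodory_solution g (x0 + \<epsilon> *\<^sub>R y0) {a..b} u \<and> u ` {a..b} \<subseteq> cball 0 (r + 1) \<and>
      (\<forall>t\<in>{a..b}. norm (u t - x t) \<le> C * \<epsilon>)"
    if \<epsilon>: "0 < \<epsilon>" "C * \<epsilon> \<le> 1" and y0: "y0 \<in> cball 0 1" for \<epsilon> y0
  proof -
    have "norm (x0 + \<epsilon> *\<^sub>R y0 - x0) \<le> \<epsilon> * 1" using \<epsilon>(1) y0 by (simp add: mult_left_le)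
    then have le: "C * norm (x0 + \<epsilon> *\<^sub>R y0 - x0) \<le> C * \<epsilon>" using C(1) by (intro mult_left_mono) auto
    from C(2)[OF order_trans[OF this \<epsilon>(2)]]
    obtain u where "caratheodory_solution g (x0 + \<epsilon> *\<^sub>R y0) {a..b} u" "u ` {a..b} \<subseteq> cball 0 (r + 1)"
      "\<forall>t\<in>{a..b}. norm (u t - x t) \<le> C * norm (x0 + \<epsilon> *\<^sub>R y0 - x0)" by (elim exE conjE) (rule that)
    with le show ?thesis by (intro exI[of _ u] conjI ballI) (auto intro: order_trans)
  qed
  have small: "\<forall>\<^sub>F \<epsilon> in at_right 0. 0 < \<epsilon> \<and> C * \<epsilon> \<le> s" if "0 < s" for s :: real
  proof -
    have "\<forall>\<^sub>F \<epsilon> in at_right 0. \<epsilon> \<in> {0<..<s / (C + 1)}"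
      by (rule eventually_at_right_real) (use that C(1) in simp)
    then show ?thesis
    proof eventually_elim
      case (elim \<epsilon>)
      then have "0 < \<epsilon>" "(C + 1) * \<epsilon> < s" using C(1) by (auto simp: pos_less_divide_eq mult.commute)
      then show ?case by (simp add: algebra_simps)
    qed
  qed
  obtain C' where C': "0 \<le> C'"
    "\<And>u x y \<epsilon> x0 y0 \<rho> t. \<lbrakk>caratheodory_solution g (x0 + \<epsilon> *\<^sub>R y0) {a..b} u; caratheodory_solution g x0 {a..b} x;
      caratheodory_solution (\<lambda>t y. A t *v y) y0 {a..b} y;
      integral {a..b} (\<lambda>t. norm (g t (u t) - g t (x t) - A t *v (u t - x t))) \<le> \<rho>; t \<in> {a..b}\<rbrakk>
      \<Longrightarrow> norm (u t - x t - \<epsilon> *\<^sub>R y t) \<le> C' * \<rho>"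
    by (rule linearization_error_le[OF ab A, of g]) blast
  have main: "\<forall>\<^sub>F \<epsilon> in at_right 0. \<forall>t\<in>{a..b}. \<forall>y0\<in>cball 0 1.
      norm ((sol g (x0 + \<epsilon> *\<^sub>R y0) t - sol g x0 t) /\<^sub>R \<epsilon> - sol (linearized_field g G x0) y0 t) < e" if e: "0 < e" for e
  proof -
    \<comment> \<open>The \<open>+ 1\<close> avoids a division by zero and makes the final inequality strict.\<close>
    define \<eta> where "\<eta> = e / (C' * C + 1)"
    have C'C: "0 \<le> C' * C" using C'(1) C(1) by simp
    have \<eta>: "0 < \<eta>" using e C'C by (simp add: \<eta>_def)
    have "C' * C * \<eta> < (C' * C + 1) * \<eta>" using \<eta> by simp
    also have "\<dots> = e" using C'C by (simp add: \<eta>_def)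
    finally have \<eta>e: "C' * C * \<eta> < e" .
    have approx': "\<exists>f J. (cond_C1 f \<and> cond_C2 p f \<and> cond_C1 J \<and> cond_C2 p J \<and>
      continuously_differentiable_in_x f \<and> is_jacobian_x f J) \<and>
      (\<forall>x\<in>?M. integral ?I (\<lambda>t. norm (f t (x t) - g t (x t))) \<le> \<tau>) \<and>
      (\<forall>x\<in>?M. integral ?I (\<lambda>t. norm (J t (x t) - G t (x t))) \<le> \<tau>)" if "0 < \<tau>" for \<tau>
      using approx[OF that] by (elim exE conjE) (intro exI conjI)
    have "\<exists>\<delta>>0. \<forall>u\<in>?M. \<forall>d. 0 \<le> d \<and> d \<le> \<delta> \<and> (\<forall>t\<in>?I. norm (u t - v t) \<le> d) \<longrightarrow>
        integral ?I (\<lambda>t. norm (g t (u t) - g t (v t) - G t (v t) *v (u t - v t))) \<le> d * \<eta>"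
      by (rule linearization_remainder[OF p gC G I q(3) _ v \<eta>]) (rule approx')
    then obtain \<delta> where \<delta>: "0 < \<delta>" "\<forall>u\<in>?M. \<forall>d. 0 \<le> d \<and> d \<le> \<delta> \<and> (\<forall>t\<in>?I. norm (u t - v t) \<le> d) \<longrightarrow>
        integral ?I (\<lambda>t. norm (g t (u t) - g t (v t) - G t (v t) *v (u t - v t))) \<le> d * \<eta>"
      by (elim exE conjE) (rule that)
    have "0 < min 1 \<delta>" using \<delta>(1) by simp
    from small[OF this] show ?thesis
    proof (eventually_elim, intro ballI)
      fix \<epsilon> t and y0 :: "real^'n"
      assume \<epsilon>: "0 < \<epsilon> \<and> C * \<epsilon> \<le> min 1 \<delta>" and t: "t \<in> {a..b}" and y0: "y0 \<in> cball 0 1"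
      then have \<epsilon>': "0 < \<epsilon>" "C * \<epsilon> \<le> 1" "C * \<epsilon> \<le> \<delta>" "0 \<le> C * \<epsilon>" using C(1) by auto
      from near[OF \<epsilon>'(1,2) y0] obtain u where u: "caratheodory_solution g (x0 + \<epsilon> *\<^sub>R y0) {a..b} u"
        "u ` {a..b} \<subseteq> cball 0 (r + 1)" "\<forall>t\<in>{a..b}. norm (u t - x t) \<le> C * \<epsilon>" by (elim exE conjE) (rule that)
      define w where "w t = u (max a (min b t))" for t
      have w: "w \<in> ?M" unfolding w_def by (rule clamp[OF u(1,2)])
      have wv: "norm (w s - v s) \<le> C * \<epsilon>" for s
        unfolding w_def v_def using ab by (intro bspec[OF u(3)]) auto
      have R: "integral ?I (\<lambda>t. norm (g t (w t) - g t (v t) - G t (v t) *v (w t - v t))) \<le> C * \<epsilon> * \<eta>"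
        by (rule \<delta>(2)[rule_format, OF w]) (intro conjI \<epsilon>'(4,3) ballI wv)
      have iR: "(\<lambda>t. norm (g t (w t) - g t (v t) - G t (v t) *v (w t - v t))) integrable_on ?I"
        by (intro set_lebesgue_integral_eq_integral(1) set_integrable_norm remainder_absolutely_integrable[OF p gC GC w v])
      have "integral {a..b} (\<lambda>t. norm (g t (u t) - g t (x t) - A t *v (u t - x t)))
          = integral {a..b} (\<lambda>t. norm (g t (w t) - g t (v t) - G t (v t) *v (w t - v t)))"
        by (intro integral_cong) (simp add: w_def v_def A_def sol_x)
      also have "\<dots> \<le> integral ?I (\<lambda>t. norm (g t (w t) - g t (v t) - G t (v t) *v (w t - v t)))"
        by (intro integral_subset_le ab_sub iR integrable_on_subinterval[OF iR ab_sub]) simp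
      finally have "integral {a..b} (\<lambda>t. norm (g t (u t) - g t (x t) - A t *v (u t - x t))) \<le> C * \<epsilon> * \<eta>"
        using R by linarith
      from C'(2)[OF u(1) x Y[THEN spec] this t]
      have err: "norm (u t - x t - \<epsilon> *\<^sub>R Y y0 t) \<le> C' * (C * \<epsilon> * \<eta>)" .
      have "(u t - x t) /\<^sub>R \<epsilon> - Y y0 t = (u t - x t - \<epsilon> *\<^sub>R Y y0 t) /\<^sub>R \<epsilon>"
        using \<epsilon>'(1) by (simp add: scaleR_diff_right)
      then have "norm ((u t - x t) /\<^sub>R \<epsilon> - Y y0 t) = norm (u t - x t - \<epsilon> *\<^sub>R Y y0 t) / \<epsilon>"
        using \<epsilon>'(1) by (simp add: divide_inverse mult.commute)
      also have "\<dots> \<le> C' * (C * \<epsilon> * \<eta>) / \<epsilon>" using err \<epsilon>'(1) by (intro divide_right_mono) auto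
      also have "\<dots> = C' * C * \<eta>" using \<epsilon>'(1) by simp
      also have "\<dots> < e" by (rule \<eta>e)
      finally show "norm ((sol g (x0 + \<epsilon> *\<^sub>R y0) t - sol g x0 t) /\<^sub>R \<epsilon> - sol (linearized_field g G x0) y0 t) < e"
        unfolding sol_eq[OF ab lip_g u(1) t] sol_x[OF t] sol_Y[OF t] .
    qed
  qed
  show ?thesis
  proof (intro conjI ballI)
    show "{T0..T1} \<subseteq> maximal_interval (linearized_field g G x0) y0" for y0
      unfolding lin by (rule maxI[OF Y[THEN spec]])
    show "\<forall>\<^sub>F \<epsilon> in at_right 0. \<forall>y0\<in>cball 0 1. {T0..T1} \<subseteq> maximal_interval g (x0 + \<epsilon> *\<^sub>R y0)"
      using small[OF zero_less_one]
    proof (eventually_elim, intro ballI)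
      fix \<epsilon> and y0 :: "real^'n" assume "0 < \<epsilon> \<and> C * \<epsilon> \<le> 1" "y0 \<in> cball 0 1"
      then obtain u where "caratheodory_solution g (x0 + \<epsilon> *\<^sub>R y0) {a..b} u"
        using near[of \<epsilon> y0] by (elim conjE exE impE) (auto elim!: exE)
      then show "{T0..T1} \<subseteq> maximal_interval g (x0 + \<epsilon> *\<^sub>R y0)" by (rule maxI)
    qed
    show "uniform_limit ({T0..T1} \<times> cball 0 1)
           (\<lambda>\<epsilon> (t, y0). norm ((sol g (x0 + \<epsilon> *\<^sub>R y0) t - sol g x0 t) /\<^sub>R \<epsilon>
                              - sol (linearized_field g G x0) y0 t))
           (\<lambda>_. 0) (at_right 0)"
    proof (rule uniform_limitI)
      fix e :: real assume "0 < e"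
      from main[OF this]
      show "\<forall>\<^sub>F \<epsilon> in at_right 0. \<forall>z\<in>{T0..T1} \<times> cball 0 1.
          dist (case z of (t, y0) \<Rightarrow> norm ((sol g (x0 + \<epsilon> *\<^sub>R y0) t - sol g x0 t) /\<^sub>R \<epsilon>
            - sol (linearized_field g G x0) y0 t)) 0 < e"
      proof (eventually_elim, intro ballI)
        fix \<epsilon> :: real and z :: "real \<times> (real^'n)"
        assume *: "\<forall>t\<in>{a..b}. \<forall>y0\<in>cball 0 1.
            norm ((sol g (x0 + \<epsilon> *\<^sub>R y0) t - sol g x0 t) /\<^sub>R \<epsilon> - sol (linearized_field g G x0) y0 t) < e"
          and z: "z \<in> {T0..T1} \<times> cball 0 1"
        obtain t y0 where ty: "z = (t, y0)" by (cases z)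
        have "t \<in> {a..b}" "y0 \<in> cball 0 1" using z T_sub ty by auto
        with * have "norm ((sol g (x0 + \<epsilon> *\<^sub>R y0) t - sol g x0 t) /\<^sub>R \<epsilon> - sol (linearized_field g G x0) y0 t) < e"
          by (metis (no_types, lifting))
        then show "dist (case z of (t, y0) \<Rightarrow> norm ((sol g (x0 + \<epsilon> *\<^sub>R y0) t - sol g x0 t) /\<^sub>R \<epsilon>
            - sol (linearized_field g G x0) y0 t)) 0 < e"
          unfolding ty by (simp add: dist_real_def)
      qed
    qed
  qed
qed

end
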